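(* For every $\epsilon>0$ there exists a compact set $M\subset\mathbb{R}^n$ (depending on $\epsilon$ and $\Omega$) such that for every $f\in V$ there exists $\tilde f\in V_M$ with $$\|f-\tilde f\|_{L^p(\Omega)}<\epsilon\,\|f\|_{L^p(\mathbb{R}^n)}.$$
   Context: Let $1\le p<\infty$; $\mu$ is Lebesgue measure on $\mathbb{R}^n$ and $L^p(\mathbb{R}^n)=L^p(\mathbb{R}^n,\mu)$; functions are real-valued. A set $U\subset\mathbb{R}^n$ is relatively separated if $\inf_{u\ne u'\in U}\|u-u'\|_\infty>0$. The Wiener amalgam space $W(L^1)(\mathbb{R}^n)$ consists of all $f\in L^\infty(\mathbb{R}^n)$ with $\|f\|_{W(L^1)(\mathbb{R}^n)}:=\sum_{k\in\mathbb{Z}^n}\sup_{x\in[0,1]^n}|f(x+k)|<\infty$. Setting: $W\subseteq L^2(\mathbb{R}^n)$ is a localizable reproducing kernel Hilbert space, i.e. a closed subspace for which there exist a relatively separated set $\Gamma\subseteq\mathbb{R}^n$, a function $\Theta\in W(L^1)(\mathbb{R}^n)$, and a collection of continuous functions $\{F_\gamma\}_{\gamma\in\Gamma}$ which is a frame for $W$ and satisfies $|F_\gamma(x)|\le\Theta(x-\gamma)$ for all $\gamma\in\Gamma$, $x\in\mathbb{R}^n$. Put $V:=\{\sum_{\gamma\in\Gamma}c_\gamma F_\gamma: (c_\gamma)\in\ell^p(\Gamma)\}$, a closed subspace of $L^p(\mathbb{R}^n)$. For a compact set $M\subset\mathbb{R}^n$, $V_M:=\{\sum_{\gamma\in\Gamma\cap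 M}c_\gamma F_\gamma: c_\gamma\in\mathbb{R}\}$ (finite-dimensional). Standing assumptions: $\Omega\subset\mathbb{R}^n$ is compact with $\mu(\Omega)\ge1$; $d$ is the number of unit cubes of the form $m+[0,1]^n$, $m\in\mathbb{Z}^n$, that cover the boundary of $\Omega$; the number of points of $\Gamma$ in $\Omega$ is at most $C(\Gamma)\mu(\Omega)$ for a positive constant $C(\Gamma)$. For every $N>0$, with $C_N=[-N/2,N/2]^n$, $$\sum_{k\in\mathbb{Z}^n\setminus C_N}\sup_{x\in[0,1]^n}|\Theta(x-k)|<\frac{C}{N^{n\alpha}},$$ where $C>0$ is a constant, $\alpha\ge\frac{p}{p-1}$ if $1<p<\infty$, and $\alpha\ge1$ if $p=1$.
   Formalization: The claim is stated for those f in V with nonzero L^p norm, because for f = 0 the strict inequality would read 0 < 0 and is false. *)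

theory Defs
  imports "HOL-Analysis.Analysis"
begin

section \<open>Lebesgue spaces\<close>

text \<open>The norm is \<^typ>\<open>ennreal\<close>-valued, so that a function with divergent \<open>p\<close>-integral has
  infinite norm rather than norm \<open>0\<close>. Elements of \<open>Lp_space\<close> are functions, not
  almost-everywhere classes.\<close>

definition Lp_norm :: "real \<Rightarrow> 'a measure \<Rightarrow> ('a \<Rightarrow> real) \<Rightarrow> ennreal" where
  "Lp_norm p M f =
     (let I = (\<integral>\<^sup>+x. ennreal (\<bar>f x\<bar> powr p) \<partial>M)
      in if I = \<infinity> then \<infinity> else ennreal (enn2real I powr (1 / p)))"

definition Lp_space :: "real \<Rightarrow> 'a measure \<Rightarrow> ('a \<Rightarrow> real) set" where
  "Lp_space p M = {f \<in> borel_measurable M. Lp_norm p M f < \<infinity>}"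

text \<open>The set \<open>\<ell>\<^sup>p(\<Gamma>)\<close> of coefficient families; values outside \<open>\<Gamma>\<close> are irrelevant.\<close>

abbreviation lp_seq :: "real \<Rightarrow> 'a set \<Rightarrow> ('a \<Rightarrow> real) set" where
  "lp_seq p \<Gamma> \<equiv> Lp_space p (count_space \<Gamma>)"

text \<open>Taking \<open>g\<close> constant in the last clause shows that \<open>W\<close> is saturated under
  almost-everywhere equality, so \<open>W\<close> does represent a subspace of the space of classes.\<close>

definition closed_subspace_L2 :: "('a::euclidean_space \<Rightarrow> real) set \<Rightarrow> bool" where
  "closed_subspace_L2 W \<longleftrightarrow>
     W \<subseteq> Lp_space 2 lebesgue \<and>
     (\<lambda>x. 0) \<in> W \<and>
     (\<forall>f\<in>W. \<forall>g\<in>W. (\<lambda>x. f x + g x) \<in> W) \<and>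
     (\<forall>a. \<forall>f\<in>W. (\<lambda>x. a * f x) \<in> W) \<and>
     (\<forall>g f. (\<forall>k::nat. g k \<in> W) \<and> f \<in> Lp_space 2 lebesgue \<and>
            (\<lambda>k. Lp_norm 2 lebesgue (\<lambda>x. g k x - f x)) \<longlonglongrightarrow> 0 \<longrightarrow> f \<in> W)"

definition is_frame_for ::
  "('a::euclidean_space \<Rightarrow> real) set \<Rightarrow> 'i set \<Rightarrow> ('i \<Rightarrow> 'a \<Rightarrow> real) \<Rightarrow> bool" where
  "is_frame_for W \<Gamma> F \<longleftrightarrow>
     (\<forall>\<gamma>\<in>\<Gamma>. F \<gamma> \<in> W) \<and>
     (\<exists>A B. 0 < A \<and> A \<le> B \<and>
        (\<forall>f\<in>W.
           ennreal A * (Lp_norm 2 lebesgue f)\<^sup>2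
             \<le> (\<Sum>\<^sub>\<infinity>\<gamma>\<in>\<Gamma>. ennreal ((LINT x|lebesgue. f x * F \<gamma> x)\<^sup>2)) \<and>
           (\<Sum>\<^sub>\<infinity>\<gamma>\<in>\<Gamma>. ennreal ((LINT x|lebesgue. f x * F \<gamma> x)\<^sup>2))
             \<le> ennreal B * (Lp_norm 2 lebesgue f)\<^sup>2))"


section \<open>Relatively separated sets and the Wiener amalgam space\<close>

text \<open>The infimum is taken in \<^typ>\<open>ennreal\<close>, so it is \<open>\<infinity>\<close> for sets with at most one point.\<close>

definition relatively_separated :: "'a::euclidean_space set \<Rightarrow> bool" where
  "relatively_separated U \<longleftrightarrow>
     0 < (INF (u, u') \<in> {(u, u'). u \<in> U \<and> u' \<in> U \<and> u \<noteq> u'}. ennreal (infnorm (u - u')))"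

definition int_lattice :: "(real ^ 'n) set" where
  "int_lattice = {k. \<forall>i. k $ i \<in> \<int>}"

text \<open>Here \<open>1 :: real ^ 'n\<close> is the all-ones vector, so \<open>cbox 0 1\<close> is \<open>[0,1]\<^sup>n\<close>.\<close>

abbreviation unit_cube :: "(real ^ 'n) set" where
  "unit_cube \<equiv> cbox 0 1"

definition centered_cube :: "real \<Rightarrow> (real ^ 'n) set" where
  "centered_cube N = cbox (\<chi> i. - N / 2) (\<chi> i. N / 2)"

definition amalgam_norm :: "(real ^ 'n \<Rightarrow> real) \<Rightarrow> ennreal" where
  "amalgam_norm f = (\<Sum>\<^sub>\<infinity>k\<in>int_lattice. SUP x\<in>unit_cube. ennreal \<bar>f (x + k)\<bar>)"

definition amalgam_space :: "(real ^ 'n \<Rightarrow> real) set" where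
  "amalgam_space =
     {f \<in> borel_measurable lebesgue.
        (\<exists>b. AE x in lebesgue. \<bar>f x\<bar> \<le> b) \<and> amalgam_norm f < \<infinity>}"


section \<open>Localizable reproducing kernel Hilbert spaces and the space \<open>V\<close>\<close>

definition localizable_by ::
  "(real ^ 'n \<Rightarrow> real) set \<Rightarrow> (real ^ 'n) set \<Rightarrow> (real ^ 'n \<Rightarrow> real)
     \<Rightarrow> (real ^ 'n \<Rightarrow> real ^ 'n \<Rightarrow> real) \<Rightarrow> bool" where
  "localizable_by W \<Gamma> \<Theta> F \<longleftrightarrow>
     closed_subspace_L2 W \<and>
     relatively_separated \<Gamma> \<and>
     \<Theta> \<in> amalgam_space \<and>
     (\<forall>\<gamma>\<in>\<Gamma>. continuous_on UNIV (F \<gamma>)) \<and>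
     is_frame_for W \<Gamma> F \<and>
     (\<forall>\<gamma>\<in>\<Gamma>. \<forall>x. \<bar>F \<gamma> x\<bar> \<le> \<Theta> (x - \<gamma>))"

text \<open>The series is understood as an unconditionally convergent series in \<open>L\<^sup>p\<close>, i.e. its finite
  partial sums converge along the net of finite subsets of \<open>\<Gamma>\<close>.\<close>

definition V_space ::
  "real \<Rightarrow> (real ^ 'n) set \<Rightarrow> (real ^ 'n \<Rightarrow> real ^ 'n \<Rightarrow> real) \<Rightarrow> (real ^ 'n \<Rightarrow> real) set" where
  "V_space p \<Gamma> F =
     {f \<in> Lp_space p lebesgue.
        \<exists>c\<in>lp_seq p \<Gamma>.
          ((\<lambda>X. Lp_norm p lebesgue (\<lambda>x. f x - (\<Sum>\<gamma>\<in>X. c \<gamma> * F \<gamma> x))) \<longlongrightarrow> 0)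
            (finite_subsets_at_top \<Gamma>)}"

text \<open>For relatively separated \<open>\<Gamma>\<close> and compact \<open>M\<close> the index set \<open>\<Gamma> \<inter> M\<close> is finite.\<close>

definition V_local ::
  "(real ^ 'n) set \<Rightarrow> (real ^ 'n \<Rightarrow> real ^ 'n \<Rightarrow> real) \<Rightarrow> (real ^ 'n) set
     \<Rightarrow> (real ^ 'n \<Rightarrow> real) set" where
  "V_local \<Gamma> F M = {\<lambda>x. (\<Sum>\<gamma>\<in>\<Gamma> \<inter> M. c \<gamma> * F \<gamma> x) | c. True}"

end

theory Submission
  imports Defs
begin

text \<open>
  The point is that the canonical dual frame is localized as well. Let \<open>G\<close> be the Gram matrix of
  the frame, scaled so that \<open>G\<^sup>2 \<le> G\<close>; by the frame inequalities its spectrum lies in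
  \<open>{0} \<union> [A, 1]\<close> with \<open>A > 0\<close>. The decay of \<open>\<Theta>\<close> makes the rows of \<open>G\<close> summable against the
  subadditive weight \<open>sqrt (infnorm x)\<close>. Hence, for a polynomial \<open>U\<close> in \<open>G\<close> vanishing at \<open>0\<close>, the
  spectral radius in the row-sum norm is at most the \<open>\<ell>\<^sup>2\<close>-norm (Brandenburg's trick: the weighted
  norm of \<open>U\<^sup>2\<close> is at most twice the weighted norm times the row-sum norm of \<open>U\<close>, and the latter
  interpolates between the \<open>\<ell>\<^sup>2\<close>-norm and the weighted norm).
  With \<open>R = (1 - G)\<^sup>m\<close> small on the range of \<open>G\<close> and \<open>U = R - R\<^sup>2\<close>, the Catalan series in \<open>U\<close>
  reproduces \<open>R\<close> there, and \<open>1 - R\<close> and \<open>U\<close> are multiples of \<open>G\<close>. This gives polynomials \<open>Z\<close> in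
  \<open>G\<close>, convergent in row-sum norm, such that every finite combination \<open>f\<close> of the frame is the limit
  of the combinations with coefficients \<open>Z \<langle>f, F\<rangle>\<close>. By the Schur test the error is small in \<open>L\<^sup>p\<close>
  relative to \<open>f\<close>, and the terms centred far from \<open>\<Omega>\<close> can be dropped on \<open>\<Omega>\<close>.
\<close>

section \<open>Matrices with bounded row sums\<close>

text \<open>The obstacle is redundancy: an overcomplete frame can give \<open>G\<close> a kernel, on
  which \<open>1 - G\<close> is the identity, so a Neumann series for an inverse need not converge.
  The equation x = U + x^2 has the two roots R and 1 - R, and the Catalan series picks the small
  one: R where R is small, and 0 on the kernel, where R = 1. The series thus separates the two parts
  of the spectrum without a functional calculus; only polynomials in \<open>G\<close>, their row
  sums and the quadratic form of \<open>G\<close> occur. The form replaces the l2 norm because it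
  does not see the kernel. The weight is a square root because the decay exponent of the tails is
  only known to be at least 1: tails of order 1/N bound the moments of order below 1, while the
  first moment may diverge. The given coefficients of \<open>f\<close> are never estimated, since
  redundancy allows huge coefficients that cancel; they are replaced by \<open>Z\<close> applied to
  inner products with \<open>f\<close>, which the norm of \<open>f\<close> does control.\<close>

abbreviation cs :: "'i measure" where "cs \<equiv> count_space UNIV"

abbreviation nn_abs :: "'a measure \<Rightarrow> ('a \<Rightarrow> real) \<Rightarrow> ennreal" where
  "nn_abs M f \<equiv> \<integral>\<^sup>+x. ennreal \<bar>f x\<bar> \<partial>M"

lemma integrable_csI:
  fixes f :: "'i \<Rightarrow> real"
  assumes "nn_abs cs f \<le> ennreal B" shows "integrable cs f"
proof (rule integrableI_bounded)
  show "(\<integral>\<^sup>+i. ennreal (norm (f i)) \<partial>cs) < \<infinity>"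
    using le_less_trans[OF assms ennreal_less_top] by simp
qed auto

lemma cs_nn_swap:
  fixes f :: "'i::countable \<Rightarrow> 'j::countable \<Rightarrow> ennreal"
  shows "(\<integral>\<^sup>+i. (\<integral>\<^sup>+j. f i j \<partial>cs) \<partial>cs) = (\<integral>\<^sup>+j. (\<integral>\<^sup>+i. f i j \<partial>cs) \<partial>cs)"
  by (rule nn_integral_count_space_nn_integral) auto

lemma cs_swap:
  fixes f :: "'i::countable \<Rightarrow> 'j::countable \<Rightarrow> real"
  assumes "(\<integral>\<^sup>+i. (nn_abs cs (f i)) \<partial>cs) \<le> ennreal B"
  shows "(LINT i|cs. (LINT j|cs. f i j)) = (LINT j|cs. (LINT i|cs. f i j))"
proof -
  interpret pair_sigma_finite "cs :: 'i measure" "cs :: 'j measure"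
    by (intro pair_sigma_finite.intro sigma_finite_measure_count_space)
  have "integrable (cs \<Otimes>\<^sub>M cs) (case_prod f)"
  proof (rule integrableI_bounded)
    show m: "case_prod f \<in> borel_measurable (cs \<Otimes>\<^sub>M cs)"
      by (simp add: pair_measure_countable)
    have "(\<integral>\<^sup>+ x. ennreal (norm (case_prod f x)) \<partial>(cs \<Otimes>\<^sub>M cs)) = (\<integral>\<^sup>+i. (nn_abs cs (f i)) \<partial>cs)"
      using m by (subst M2.nn_integral_fst[symmetric]) auto
    then show "(\<integral>\<^sup>+ x. ennreal (norm (case_prod f x)) \<partial>(cs \<Otimes>\<^sub>M cs)) < \<infinity>"
      using le_less_trans[OF assms ennreal_less_top] by simp
  qed
  from Fubini_integral[OF this] show ?thesis by simp
qed

text \<open>No integrability is asked for: the integral of a non-integrable function is 0 by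
  convention.\<close>

lemma abs_lint_le:
  fixes f :: "'i \<Rightarrow> real"
  shows "ennreal \<bar>LINT i|cs. f i\<bar> \<le> nn_abs cs f"
proof (cases "integrable cs f")
  case True
  then show ?thesis using integral_norm_bound_ennreal[OF True] by simp
next
  case False
  then show ?thesis by (simp add: not_integrable_integral_eq)
qed

text \<open>A predicate instead of a norm, since only upper bounds are ever combined. Row sums
  control the action on bounded sequences; for symmetric matrices they control the action on every
  l^p.\<close>

definition row_bound :: "('i \<Rightarrow> 'j \<Rightarrow> real) \<Rightarrow> real \<Rightarrow> bool" where
  "row_bound a B \<longleftrightarrow> 0 \<le> B \<and> (\<forall>i. (nn_abs cs (a i)) \<le> ennreal B)"

lemma row_bound_integrable: "row_bound a B \<Longrightarrow> integrable cs (a i)"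
  unfolding row_bound_def using integrable_csI by blast

lemma row_bound_nonneg: "row_bound a B \<Longrightarrow> 0 \<le> B"
  by (simp add: row_bound_def)

lemma row_bound_entry:
  assumes "row_bound a B" shows "\<bar>a i j\<bar> \<le> B"
proof -
  have "ennreal \<bar>a i j\<bar> = (\<integral>\<^sup>+k. ennreal \<bar>a i k\<bar> * indicator {j} k \<partial>cs)"
    by simp
  also have "... \<le> nn_abs cs (a i)"
    by (intro nn_integral_mono) (auto simp: indicator_def)
  also have "... \<le> ennreal B" using assms by (auto simp: row_bound_def)
  finally show ?thesis using assms by (auto simp: row_bound_def)
qed

lemma row_bound_add:
  assumes "row_bound a A" "row_bound b B" shows "row_bound (\<lambda>i j. a i j + b i j) (A + B)"
  unfolding row_bound_def
proof (intro conjI allI)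
  show "0 \<le> A + B" using assms by (auto simp: row_bound_def)
  fix i
  have "nn_abs cs (\<lambda>j. a i j + b i j) \<le> (\<integral>\<^sup>+j. ennreal \<bar>a i j\<bar> + ennreal \<bar>b i j\<bar> \<partial>cs)"
    by (intro nn_integral_mono) (auto simp flip: ennreal_plus)
  also have "... = nn_abs cs (a i) + nn_abs cs (b i)"
    by (rule nn_integral_add) auto
  also have "... \<le> ennreal A + ennreal B"
    using assms by (intro add_mono) (auto simp: row_bound_def)
  finally show "nn_abs cs (\<lambda>j. a i j + b i j) \<le> ennreal (A + B)"
    using assms by (simp add: row_bound_def ennreal_plus)
qed

text \<open>Absolute summability of the double series behind a product. The same estimate yields the
  row bound of the product, the interchange of sums in \<open>cs_triple_swap\<close> and the
  weighted bound \<open>went_mult\<close>.\<close>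

lemma nn_mult_bound:
  fixes a :: "'i \<Rightarrow> 'j::countable \<Rightarrow> real" and b :: "'j \<Rightarrow> 'k::countable \<Rightarrow> real"
  assumes "row_bound a A" "row_bound b B"
  shows "(\<integral>\<^sup>+j. (nn_abs cs (\<lambda>k. a i k * b k j)) \<partial>cs) \<le> ennreal (A * B)"
proof -
  have "(\<integral>\<^sup>+j. (nn_abs cs (\<lambda>k. a i k * b k j)) \<partial>cs) = (\<integral>\<^sup>+k. (nn_abs cs (\<lambda>j. a i k * b k j)) \<partial>cs)"
    by (rule cs_nn_swap)
  also have "... = (\<integral>\<^sup>+k. ennreal \<bar>a i k\<bar> * nn_abs cs (b k) \<partial>cs)"
    by (simp add: abs_mult ennreal_mult nn_integral_cmult)
  also have "... \<le> (\<integral>\<^sup>+k. ennreal \<bar>a i k\<bar> * ennreal B \<partial>cs)"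
    using assms(2) by (intro nn_integral_mono mult_left_mono) (auto simp: row_bound_def)
  also have "... = nn_abs cs (a i) * ennreal B"
    by (simp add: nn_integral_multc)
  also have "... \<le> ennreal A * ennreal B"
    using assms(1) by (intro mult_right_mono) (auto simp: row_bound_def)
  finally show ?thesis using assms by (simp add: row_bound_def ennreal_mult)
qed

lemma row_bound_mult:
  fixes a b :: "'i::countable \<Rightarrow> 'i \<Rightarrow> real"
  assumes "row_bound a A" "row_bound b B"
  shows "row_bound (\<lambda>i j. LINT k|cs. a i k * b k j) (A * B)"
  unfolding row_bound_def
proof (intro conjI allI)
  show "0 \<le> A * B" using assms by (auto simp: row_bound_def)
  fix i
  have "nn_abs cs (\<lambda>j. LINT k|cs. a i k * b k j) \<le> (\<integral>\<^sup>+j. (nn_abs cs (\<lambda>k. a i k * b k j)) \<partial>cs)"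
    by (intro nn_integral_mono abs_lint_le)
  also have "... \<le> ennreal (A * B)" by (rule nn_mult_bound[OF assms])
  finally show "nn_abs cs (\<lambda>j. LINT k|cs. a i k * b k j) \<le> ennreal (A * B)" .
qed

lemma row_bound_scale:
  assumes "row_bound a A" "\<And>i j. \<bar>b i j\<bar> \<le> t * \<bar>a i j\<bar>" "0 \<le> t"
  shows "row_bound b (t * A)"
  unfolding row_bound_def
proof (intro conjI allI)
  show "0 \<le> t * A" using assms by (auto simp: row_bound_def)
  fix i
  have "nn_abs cs (b i) \<le> (\<integral>\<^sup>+j. ennreal t * ennreal \<bar>a i j\<bar> \<partial>cs)"
    using assms by (intro nn_integral_mono) (auto simp flip: ennreal_mult intro!: ennreal_leI)
  also have "... = ennreal t * nn_abs cs (a i)"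
    by (rule nn_integral_cmult) auto
  also have "... \<le> ennreal t * ennreal A"
    using assms by (intro mult_left_mono) (auto simp: row_bound_def)
  finally show "nn_abs cs (b i) \<le> ennreal (t * A)"
    using assms by (simp add: row_bound_def ennreal_mult)
qed

lemma row_bound_0: "row_bound (\<lambda>i j. 0) 0"
  by (simp add: row_bound_def)

lemma row_bound_1: "row_bound (\<lambda>i j. if i = j then 1 else 0) 1"
proof -
  have "nn_abs cs (\<lambda>j. if i = j then 1 else 0 :: real) = (\<integral>\<^sup>+j. 1 * indicator {i} j \<partial>cs)" for i :: 'a
    by (intro nn_integral_cong) (auto simp: indicator_def)
  then show ?thesis by (simp add: row_bound_def del: mult_1)
qed

lemma integrable_row_col:
  fixes a :: "'i \<Rightarrow> 'j \<Rightarrow> real"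
  assumes "row_bound a A" "\<And>k. \<bar>c k\<bar> \<le> C"
  shows "integrable cs (\<lambda>k. a i k * c k)"
proof (rule Bochner_Integration.integrable_bound)
  show "integrable cs (\<lambda>k. C * a i k)" using row_bound_integrable[OF assms(1)] by simp
  have "\<bar>a i k\<bar> * \<bar>c k\<bar> \<le> \<bar>C\<bar> * \<bar>a i k\<bar>" for k
    using assms(2)[of k] by (auto simp: mult.commute intro!: mult_right_mono)
  then show "AE k in cs. norm (a i k * c k) \<le> norm (C * a i k)"
    by (auto simp: abs_mult)
qed auto

text \<open>Asking only that \<open>c\<close> be bounded serves two purposes: with a matrix column
  for \<open>c\<close> this is associativity of the product, with a summable sequence it is
  compatibility of product and action.\<close>

lemma cs_triple_swap:
  fixes a :: "'i \<Rightarrow> 'j::countable \<Rightarrow> real" and b :: "'j \<Rightarrow> 'k::countable \<Rightarrow> real"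
  assumes "row_bound a A" "row_bound b B" "\<And>k. \<bar>c k\<bar> \<le> C"
  shows "(LINT k|cs. (LINT l|cs. a i l * b l k) * c k) = (LINT l|cs. a i l * (LINT k|cs. b l k * c k))"
proof -
  have C0: "0 \<le> C" using assms(3)[of undefined] by linarith
  have "(LINT k|cs. (LINT l|cs. a i l * b l k) * c k) = (LINT k|cs. (LINT l|cs. a i l * b l k * c k))"
    by simp
  also have "... = (LINT l|cs. (LINT k|cs. a i l * b l k * c k))"
  proof (rule cs_swap)
    have "(\<integral>\<^sup>+ k. \<integral>\<^sup>+ l. ennreal \<bar>a i l * b l k * c k\<bar> \<partial>cs \<partial>cs)
      \<le> (\<integral>\<^sup>+ k. \<integral>\<^sup>+ l. ennreal C * ennreal \<bar>a i l * b l k\<bar> \<partial>cs \<partial>cs)"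
      using assms(3) C0
      by (intro nn_integral_mono)
         (auto simp: abs_mult mult_right_mono mult.commute simp flip: ennreal_mult intro!: ennreal_leI mult_left_mono)
    also have "... = ennreal C * (\<integral>\<^sup>+ k. \<integral>\<^sup>+ l. ennreal \<bar>a i l * b l k\<bar> \<partial>cs \<partial>cs)"
      by (simp add: nn_integral_cmult)
    also have "... \<le> ennreal C * ennreal (A * B)"
      by (intro mult_left_mono nn_mult_bound assms) auto
    also have "... = ennreal (C * (A * B))"
      using row_bound_nonneg[OF assms(1)] row_bound_nonneg[OF assms(2)] C0 by (simp add: ennreal_mult)
    finally show "(\<integral>\<^sup>+ k. \<integral>\<^sup>+ l. ennreal \<bar>a i l * b l k * c k\<bar> \<partial>cs \<partial>cs) \<le> ennreal (C * (A * B))" .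
  qed
  finally show ?thesis by (simp add: mult.assoc)
qed

lemma lint_delta: "(LINT k|cs. (if i = k then 1 else 0) * x k) = (x i :: real)"
proof -
  have "(LINT k|cs. (if i = k then 1 else 0) * x k) = (LINT k|cs. indicator {i} k * x i)"
    by (intro Bochner_Integration.integral_cong) (auto simp: indicator_def)
  then show ?thesis by simp
qed

section \<open>The ring of matrices with bounded row sums\<close>

typedef 'i rmat = "{a :: 'i \<Rightarrow> 'i \<Rightarrow> real. \<exists>B. row_bound a B}"
  morphisms ent Rmat
  using row_bound_0 by blast

setup_lifting type_definition_rmat

lemma ent_bounded: "\<exists>B. row_bound (ent a) B" using ent[of a] by simp

lemma integrable_ent: "integrable cs (ent a i)"
proof -
  obtain B where "row_bound (ent a) B" using ent_bounded by metis
  from row_bound_integrable[OF this] show ?thesis .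
qed

lemma integrable_ent_mult: "integrable cs (\<lambda>k. ent a i k * ent b k j)"
proof -
  obtain A B where "row_bound (ent a) A" "row_bound (ent b) B" using ent_bounded by metis
  from integrable_row_col[OF this(1), of "\<lambda>k. ent b k j"] row_bound_entry[OF this(2)]
  show ?thesis by blast
qed

text \<open>\<open>ring_1\<close> provides powers, finite sums and ring normalisation for
  polynomials in \<open>G\<close>. The type hides the bound; \<open>row_bound_ent_obtain\<close>
  recovers it.\<close>

instantiation rmat :: (countable) ring_1
begin

lift_definition zero_rmat :: "'a rmat" is "\<lambda>i j. 0" using row_bound_0 by blast
lift_definition one_rmat :: "'a rmat" is "\<lambda>i j. if i = j then 1 else 0" using row_bound_1 by blast
lift_definition plus_rmat :: "'a rmat \<Rightarrow> 'a rmat \<Rightarrow> 'a rmat" is "\<lambda>a b i j. a i j + b i j"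
proof -
  fix a b :: "'a \<Rightarrow> 'a \<Rightarrow> real" assume "\<exists>B. row_bound a B" "\<exists>B. row_bound b B"
  then obtain A B where ab: "row_bound a A" "row_bound b B" by blast
  show "\<exists>B. row_bound (\<lambda>i j. a i j + b i j) B"
    by (rule exI, rule row_bound_add[OF ab])
qed
lift_definition uminus_rmat :: "'a rmat \<Rightarrow> 'a rmat" is "\<lambda>a i j. - a i j"
proof -
  fix a :: "'a \<Rightarrow> 'a \<Rightarrow> real" assume "\<exists>B. row_bound a B"
  then obtain A where "row_bound a A" by blast
  then have "row_bound (\<lambda>i j. - a i j) (1 * A)" by (rule row_bound_scale) auto
  then show "\<exists>B. row_bound (\<lambda>i j. - a i j) B" by blast
qed
lift_definition minus_rmat :: "'a rmat \<Rightarrow> 'a rmat \<Rightarrow> 'a rmat" is "\<lambda>a b i j. a i j - b i j"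
proof -
  fix a b :: "'a \<Rightarrow> 'a \<Rightarrow> real" assume "\<exists>B. row_bound a B" "\<exists>B. row_bound b B"
  then obtain A B where "row_bound a A" "row_bound b B" by blast
  from this(2) have "row_bound (\<lambda>i j. - b i j) (1 * B)" by (rule row_bound_scale) auto
  from row_bound_add[OF \<open>row_bound a A\<close> this] have "row_bound (\<lambda>i j. a i j + - b i j) (A + 1 * B)" .
  then have "row_bound (\<lambda>i j. a i j - b i j) (A + 1 * B)" by simp
  then show "\<exists>B. row_bound (\<lambda>i j. a i j - b i j) B" by (rule exI)
qed
lift_definition times_rmat :: "'a rmat \<Rightarrow> 'a rmat \<Rightarrow> 'a rmat" is "\<lambda>a b i j. LINT k|cs. a i k * b k j"
proof -
  fix a b :: "'a \<Rightarrow> 'a \<Rightarrow> real" assume "\<exists>B. row_bound a B" "\<exists>B. row_bound b B"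
  then obtain A B where ab: "row_bound a A" "row_bound b B" by blast
  show "\<exists>B. row_bound (\<lambda>i j. LINT k|cs. a i k * b k j) B"
    by (rule exI, rule row_bound_mult[OF ab])
qed

instance
proof
  fix a b c :: "'a rmat"
  show "a + b + c = a + (b + c)" apply transfer apply (rule ext)+ apply simp done
  show "a + b = b + a" apply transfer apply (rule ext)+ apply simp done
  show "0 + a = a" apply transfer apply (rule ext)+ apply simp done
  show "- a + a = 0" apply transfer apply (rule ext)+ apply simp done
  show "a - b = a + - b" apply transfer apply (rule ext)+ apply simp done
  show "(0 :: 'a rmat) \<noteq> 1"
  proof
    assume "(0 :: 'a rmat) = 1"
    then have "ent (0 :: 'a rmat) undefined undefined = ent 1 undefined undefined" by simp
    then show False by (simp add: zero_rmat.rep_eq one_rmat.rep_eq)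
  qed
  show "1 * a = a" by transfer (simp only: lint_delta)
  have one2: "(LINT k|cs. x k * (if k = i then 1 else 0)) = x i" for i and x :: "'a \<Rightarrow> real"
    using lint_delta[of i x] by (simp add: mult.commute eq_commute)
  show "a * 1 = a" by transfer (simp only: one2)
  show "(a + b) * c = a * c + b * c"
    by (rule ent_inject[THEN iffD1])
       (simp add: times_rmat.rep_eq plus_rmat.rep_eq distrib_right integrable_ent_mult)
  show "a * (b + c) = a * b + a * c"
    by (rule ent_inject[THEN iffD1])
       (simp add: times_rmat.rep_eq plus_rmat.rep_eq distrib_left integrable_ent_mult)
  show "a * b * c = a * (b * c)"
  proof (rule ent_inject[THEN iffD1], intro ext)
    fix i j
    obtain A B C where bd: "row_bound (ent a) A" "row_bound (ent b) B" "row_bound (ent c) C"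
      using ent_bounded by metis
    show "ent (a * b * c) i j = ent (a * (b * c)) i j"
      unfolding times_rmat.rep_eq by (rule cs_triple_swap[OF bd(1,2) row_bound_entry[OF bd(3)]])
  qed
qed

end

lemma row_bound_ent_obtain: obtains B where "row_bound (ent a) B"
  using ent_bounded by metis

section \<open>Action on summable sequences and the l2 pairing\<close>

abbreviation l1 :: "('i \<Rightarrow> real) \<Rightarrow> bool" where "l1 c \<equiv> integrable cs c"

definition act :: "'i rmat \<Rightarrow> ('i \<Rightarrow> real) \<Rightarrow> 'i \<Rightarrow> real" where
  "act a c i = (LINT j|cs. ent a i j * c j)"

text \<open>The l2 inner product. On summable sequences, which are bounded, it needs no completion
  and no separate theory of l2.\<close>

definition l1_ip :: "('i \<Rightarrow> real) \<Rightarrow> ('i \<Rightarrow> real) \<Rightarrow> real" where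
  "l1_ip c d = (LINT i|cs. c i * d i)"

definition sym_rmat :: "'i rmat \<Rightarrow> bool" where
  "sym_rmat a \<longleftrightarrow> (\<forall>i j. ent a i j = ent a j i)"

lemma nn_l1:
  fixes c :: "'i \<Rightarrow> real"
  assumes "l1 c" shows "nn_abs cs c = ennreal (LINT i|cs. \<bar>c i\<bar>)"
  using assms by (intro nn_integral_eq_integral) auto

lemma l1_bounded:
  fixes c :: "'i \<Rightarrow> real"
  assumes "l1 c" shows "\<bar>c k\<bar> \<le> (LINT i|cs. \<bar>c i\<bar>)"
proof -
  have "row_bound (\<lambda>_::unit. c) (LINT i|cs. \<bar>c i\<bar>)"
    using nn_l1[OF assms] by (simp add: row_bound_def)
  from row_bound_entry[OF this] show ?thesis .
qed

lemma l1_mult_bounded: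
  fixes c :: "'i \<Rightarrow> real"
  assumes "l1 c" "\<And>i. \<bar>d i\<bar> \<le> C"
  shows "l1 (\<lambda>i. c i * d i)"
proof -
  have "row_bound (\<lambda>_::unit. c) (LINT i|cs. \<bar>c i\<bar>)"
    using nn_l1[OF assms(1)] by (simp add: row_bound_def)
  from integrable_row_col[OF this assms(2)] show ?thesis .
qed

lemma l1_mult: "l1 c \<Longrightarrow> l1 d \<Longrightarrow> l1 (\<lambda>i. c i * d i :: real)"
  using l1_mult_bounded[OF _ l1_bounded] .

lemma l1_ent_mult:
  assumes "l1 c" shows "l1 (\<lambda>j. ent a i j * c j)"
  by (rule l1_mult[OF integrable_ent assms])

text \<open>Symmetry turns the row sums into column sums, and these are what controls the action on
  summable sequences.\<close>

lemma nn_av_le: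
  fixes c :: "'i::countable \<Rightarrow> real"
  assumes "sym_rmat a" "row_bound (ent a) B"
  shows "(\<integral>\<^sup>+i. (nn_abs cs (\<lambda>j. ent a i j * c j)) \<partial>cs) \<le> ennreal B * nn_abs cs c"
proof -
  have "(\<integral>\<^sup>+i. (nn_abs cs (\<lambda>j. ent a i j * c j)) \<partial>cs)
    = (\<integral>\<^sup>+j. (nn_abs cs (\<lambda>i. ent a i j * c j)) \<partial>cs)" by (rule cs_nn_swap)
  also have "... = (\<integral>\<^sup>+j. (nn_abs cs (ent a j)) * ennreal \<bar>c j\<bar> \<partial>cs)"
    using assms(1) by (simp add: abs_mult ennreal_mult nn_integral_multc sym_rmat_def)
  also have "... \<le> (\<integral>\<^sup>+j. ennreal B * ennreal \<bar>c j\<bar> \<partial>cs)"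
    using assms(2) by (intro nn_integral_mono mult_right_mono) (auto simp: row_bound_def)
  also have "... = ennreal B * nn_abs cs c"
    by (rule nn_integral_cmult) auto
  finally show ?thesis .
qed

lemma act_l1:
  fixes c :: "'i::countable \<Rightarrow> real"
  assumes "sym_rmat a" "l1 c" shows "l1 (act a c)"
proof -
  obtain B where B: "row_bound (ent a) B" by (rule row_bound_ent_obtain)
  have "nn_abs cs (act a c) \<le> (\<integral>\<^sup>+i. (nn_abs cs (\<lambda>j. ent a i j * c j)) \<partial>cs)"
    unfolding act_def by (intro nn_integral_mono abs_lint_le)
  also have "... \<le> ennreal B * ennreal (LINT i|cs. \<bar>c i\<bar>)"
    using nn_av_le[OF assms(1) B, of c] nn_l1[OF assms(2)] by simp
  also have "... = ennreal (B * (LINT i|cs. \<bar>c i\<bar>))"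
    using row_bound_nonneg[OF B] by (simp add: ennreal_mult')
  finally show ?thesis by (rule integrable_csI)
qed

lemma act_add_mat: "l1 c \<Longrightarrow> act (a + b) c = (\<lambda>i. act a c i + act b c i)"
  by (intro ext) (simp add: act_def plus_rmat.rep_eq distrib_right l1_ent_mult)

lemma act_diff_mat: "l1 c \<Longrightarrow> act (a - b) c = (\<lambda>i. act a c i - act b c i)"
  by (intro ext) (simp add: act_def minus_rmat.rep_eq left_diff_distrib l1_ent_mult)

lemma act_one: "act 1 c = c"
  by (intro ext) (simp only: act_def one_rmat.rep_eq lint_delta)

lemma act_add: "l1 c \<Longrightarrow> l1 d \<Longrightarrow> act a (\<lambda>i. c i + d i) = (\<lambda>i. act a c i + act a d i)"
  by (intro ext) (simp add: act_def distrib_left l1_ent_mult)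

lemma act_diff: "l1 c \<Longrightarrow> l1 d \<Longrightarrow> act a (\<lambda>i. c i - d i) = (\<lambda>i. act a c i - act a d i)"
  by (intro ext) (simp add: act_def right_diff_distrib l1_ent_mult)

lemma act_mult:
  assumes "l1 c" shows "act (a * b) c = act a (act b c)"
proof
  fix i
  obtain A B where "row_bound (ent a) A" "row_bound (ent b) B" using row_bound_ent_obtain by metis
  from cs_triple_swap[OF this l1_bounded[OF assms]] show "act (a * b) c i = act a (act b c) i"
    unfolding act_def times_rmat.rep_eq .
qed

lemma l1_ip_commute: "l1_ip c d = l1_ip d c"
  by (simp add: l1_ip_def mult.commute)

lemma l1_ip_add_left: "l1 c \<Longrightarrow> l1 c' \<Longrightarrow> l1 d \<Longrightarrow> l1_ip (\<lambda>i. c i + c' i) d = l1_ip c d + l1_ip c' d"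
  by (simp add: l1_ip_def distrib_right l1_mult)

lemma l1_ip_diff_left: "l1 c \<Longrightarrow> l1 c' \<Longrightarrow> l1 d \<Longrightarrow> l1_ip (\<lambda>i. c i - c' i) d = l1_ip c d - l1_ip c' d"
  by (simp add: l1_ip_def left_diff_distrib l1_mult)

lemma l1_ip_add_right: "l1 c \<Longrightarrow> l1 c' \<Longrightarrow> l1 d \<Longrightarrow> l1_ip d (\<lambda>i. c i + c' i) = l1_ip d c + l1_ip d c'"
  using l1_ip_add_left[of c c' d] by (simp add: l1_ip_commute)

lemma l1_ip_diff_right: "l1 c \<Longrightarrow> l1 c' \<Longrightarrow> l1 d \<Longrightarrow> l1_ip d (\<lambda>i. c i - c' i) = l1_ip d c - l1_ip d c'"
  using l1_ip_diff_left[of c c' d] by (simp add: l1_ip_commute)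

lemma l1_ip_self_nonneg: "0 \<le> l1_ip c c"
  by (simp add: l1_ip_def)

lemma l1_ip_symm:
  fixes c d :: "'i::countable \<Rightarrow> real"
  assumes "sym_rmat a" "l1 c" "l1 d"
  shows "l1_ip (act a c) d = l1_ip c (act a d)"
proof -
  obtain A where A: "row_bound (ent a) A" using row_bound_ent_obtain by metis
  have "l1_ip (act a c) d = (LINT i|cs. (LINT j|cs. ent a i j * c j * d i))"
    by (simp add: l1_ip_def act_def)
  also have "... = (LINT j|cs. (LINT i|cs. ent a i j * c j * d i))"
  proof (rule cs_swap)
    let ?D = "LINT i|cs. \<bar>d i\<bar>"
    have D0: "0 \<le> ?D" by simp
    have "(\<integral>\<^sup>+ i. \<integral>\<^sup>+ j. ennreal \<bar>ent a i j * c j * d i\<bar> \<partial>cs \<partial>cs)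
      \<le> (\<integral>\<^sup>+ i. \<integral>\<^sup>+ j. ennreal ?D * ennreal \<bar>ent a i j * c j\<bar> \<partial>cs \<partial>cs)"
      using l1_bounded[OF assms(3)] D0
      by (intro nn_integral_mono)
         (auto simp: abs_mult mult.commute simp flip: ennreal_mult intro!: ennreal_leI mult_right_mono)
    also have "... = ennreal ?D * (\<integral>\<^sup>+ i. \<integral>\<^sup>+ j. ennreal \<bar>ent a i j * c j\<bar> \<partial>cs \<partial>cs)"
      by (simp add: nn_integral_cmult)
    also have "... \<le> ennreal ?D * (ennreal A * ennreal (LINT i|cs. \<bar>c i\<bar>))"
      using nn_av_le[OF assms(1) A, of c] nn_l1[OF assms(2)] by (intro mult_left_mono) auto
    also have "... = ennreal (?D * (A * (LINT i|cs. \<bar>c i\<bar>)))"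
      using row_bound_nonneg[OF A] by (simp add: ennreal_mult)
    finally show "(\<integral>\<^sup>+ i. \<integral>\<^sup>+ j. ennreal \<bar>ent a i j * c j * d i\<bar> \<partial>cs \<partial>cs)
      \<le> ennreal (?D * (A * (LINT i|cs. \<bar>c i\<bar>)))" .
  qed
  also have "... = (LINT j|cs. (LINT i|cs. ent a j i * d i) * c j)"
  proof -
    have "(LINT i|cs. ent a i j * c j * d i) = (LINT i|cs. ent a j i * d i) * c j" for j
    proof -
      have "(LINT i|cs. ent a i j * c j * d i) = (LINT i|cs. (ent a j i * d i) * c j)"
        using assms(1) by (intro Bochner_Integration.integral_cong) (auto simp: sym_rmat_def)
      then show ?thesis by simp
    qed
    then show ?thesis by simp
  qed
  also have "... = l1_ip c (act a d)"
    by (simp add: l1_ip_def act_def mult.commute)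
  finally show ?thesis .
qed

definition uvec :: "'i \<Rightarrow> 'i \<Rightarrow> real" where "uvec i = (\<lambda>j. if i = j then 1 else 0)"

lemma l1_uv: "l1 (uvec i)"
proof -
  have "integrable cs (indicator {i} :: 'a \<Rightarrow> real)" by simp
  moreover have "uvec i = indicator {i}" by (auto simp: uvec_def indicator_def)
  ultimately show ?thesis by simp
qed

lemma l1_ip_uv: "l1_ip (uvec i) c = c i"
  unfolding l1_ip_def uvec_def by (rule lint_delta)

lemma act_uv: "act a (uvec i) k = ent a k i"
  using l1_ip_uv[of i "ent a k"] by (simp add: l1_ip_def act_def mult.commute)

lemma sym_rmat_one: "sym_rmat 1" by (simp add: sym_rmat_def one_rmat.rep_eq)
lemma sym_rmat_add: "sym_rmat a \<Longrightarrow> sym_rmat b \<Longrightarrow> sym_rmat (a + b)" by (simp add: sym_rmat_def plus_rmat.rep_eq)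
lemma sym_rmat_diff: "sym_rmat a \<Longrightarrow> sym_rmat b \<Longrightarrow> sym_rmat (a - b)" by (simp add: sym_rmat_def minus_rmat.rep_eq)
lemma sym_rmat_mult:
  assumes "sym_rmat a" "sym_rmat b" "a * b = b * a" shows "sym_rmat (a * b)"
  unfolding sym_rmat_def
proof (intro allI)
  fix i j
  have "ent (a * b) j i = (LINT k|cs. ent a j k * ent b k i)" by (simp add: times_rmat.rep_eq)
  also have "... = (LINT k|cs. ent b i k * ent a k j)"
    using assms(1,2) by (intro Bochner_Integration.integral_cong) (auto simp: sym_rmat_def)
  also have "... = ent (b * a) i j" by (simp add: times_rmat.rep_eq)
  finally show "ent (a * b) i j = ent (a * b) j i" using assms(3) by simp
qed

text \<open>Commutation, symmetry and finiteness of weighted rows all pass to polynomials by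
  induction over this set. Integer coefficients suffice because the scaling of the Gram matrix is
  part of its entries.\<close>

inductive_set polys :: "'a::ring_1 \<Rightarrow> 'a set" for g :: 'a where
  polys_one: "1 \<in> polys g"
| polys_gen: "g \<in> polys g"
| polys_add: "p \<in> polys g \<Longrightarrow> q \<in> polys g \<Longrightarrow> p + q \<in> polys g"
| polys_diff: "p \<in> polys g \<Longrightarrow> q \<in> polys g \<Longrightarrow> p - q \<in> polys g"
| polys_mult: "p \<in> polys g \<Longrightarrow> q \<in> polys g \<Longrightarrow> p * q \<in> polys g"

lemma polys_commute_gen: "p \<in> polys g \<Longrightarrow> p * g = g * p"
proof (induction rule: polys.induct)
  case (polys_mult p q)
  then show ?case by (metis mult.assoc)
qed (auto simp: algebra_simps)

lemma polys_commute: "p \<in> polys g \<Longrightarrow> q \<in> polys g \<Longrightarrow> p * q = q * p"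
proof (induction rule: polys.induct)
  case polys_gen
  then show ?case using polys_commute_gen by metis
next
  case (polys_mult p p')
  then show ?case by (metis mult.assoc)
qed (auto simp: algebra_simps)

lemma polys_symm: "p \<in> polys g \<Longrightarrow> sym_rmat g \<Longrightarrow> sym_rmat p"
proof (induction rule: polys.induct)
  case (polys_mult p q)
  then show ?case by (intro sym_rmat_mult polys_commute[of _ g]) auto
qed (auto intro: sym_rmat_one sym_rmat_add sym_rmat_diff)

lemma polys_power: "p \<in> polys g \<Longrightarrow> p ^ k \<in> polys g"
  by (induction k) (auto intro: polys.intros)

section \<open>Positive semidefinite matrices and weights\<close>

text \<open>\<open>lower\<close> and \<open>upper\<close> are the operator inequalities A G <= G^2
  <= G. In the application they are the two frame inequalities, and \<open>A\<close> is the quotient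
  of the frame bounds.\<close>

locale psd_rmat =
  fixes G :: "'i::countable rmat" and A :: real
  assumes G_symm: "sym_rmat G" and A_pos: "0 < A" and A_le: "A \<le> 1"
    and lower: "\<And>c. l1 c \<Longrightarrow> A * l1_ip (act G c) c \<le> l1_ip (act G c) (act G c)"
    and upper: "\<And>c. l1 c \<Longrightarrow> l1_ip (act G c) (act G c) \<le> l1_ip (act G c) c"
begin

abbreviation "PG \<equiv> polys G"

text \<open>A squared seminorm. In the application it is the squared L2 norm of the synthesised
  function divided by the upper frame bound, so coefficients that synthesise 0 have \<open>q\<close>
  equal to 0.\<close>

definition q :: "('i \<Rightarrow> real) \<Rightarrow> real" where "q c = l1_ip (act G c) c"

lemma PG_symm: "p \<in> PG \<Longrightarrow> sym_rmat p"
  using polys_symm G_symm by blast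

lemma PG_l1: "p \<in> PG \<Longrightarrow> l1 c \<Longrightarrow> l1 (act p c)"
  by (rule act_l1[OF PG_symm])

lemma G_l1: "l1 c \<Longrightarrow> l1 (act G c)"
  by (rule act_l1[OF G_symm])

lemma q_nonneg: "l1 c \<Longrightarrow> 0 \<le> q c"
  using upper[of c] l1_ip_self_nonneg[of "act G c"] by (simp add: q_def)

lemma q_add_eq:
  assumes "l1 c" "l1 d"
  shows "q (\<lambda>i. c i + d i) = q c + 2 * l1_ip (act G c) d + q d"
proof -
  have "l1_ip (act G d) c = l1_ip (act G c) d"
    using l1_ip_symm[OF G_symm assms(2,1)] by (simp add: l1_ip_commute)
  then show ?thesis using assms
    by (simp add: q_def act_add l1_ip_add_left l1_ip_add_right G_l1)
qed

lemma q_diff_eq: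
  assumes "l1 c" "l1 d"
  shows "q (\<lambda>i. c i - d i) = q c - 2 * l1_ip (act G c) d + q d"
proof -
  have "l1_ip (act G d) c = l1_ip (act G c) d"
    using l1_ip_symm[OF G_symm assms(2,1)] by (simp add: l1_ip_commute)
  then show ?thesis using assms
    by (simp add: q_def act_diff l1_ip_diff_left l1_ip_diff_right G_l1)
qed

text \<open>The parallelogram law stands in for the triangle inequality. The factors 2 that this
  costs are harmless because \<open>R\<close> will be made very small.\<close>

lemma q_add_le: "l1 c \<Longrightarrow> l1 d \<Longrightarrow> q (\<lambda>i. c i + d i) \<le> 2 * q c + 2 * q d"
  using q_nonneg[of "\<lambda>i. c i - d i"] by (simp add: q_add_eq q_diff_eq)

lemma q_diff_le: "l1 c \<Longrightarrow> l1 d \<Longrightarrow> q (\<lambda>i. c i - d i) \<le> 2 * q c + 2 * q d"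
  using q_nonneg[of "\<lambda>i. c i + d i"] by (simp add: q_add_eq q_diff_eq)

text \<open>Expanding |G c - c|^2 >= 0 and using G^2 <= G leaves G <= 1, without any operator
  norm.\<close>

lemma q_le_ip:
  assumes "l1 c" shows "q c \<le> l1_ip c c"
proof -
  have "0 \<le> l1_ip (\<lambda>i. act G c i - c i) (\<lambda>i. act G c i - c i)" by (rule l1_ip_self_nonneg)
  also have "... = l1_ip (act G c) (act G c) - 2 * q c + l1_ip c c"
    using assms G_l1[OF assms] l1_ip_commute[of c "act G c"]
    by (simp add: l1_ip_diff_left l1_ip_diff_right q_def)
  finally show ?thesis using upper[OF assms] by (simp add: q_def)
qed

text \<open>\<open>s\<close> bounds the square of the operator seminorm, which is why the squares of
  rates such as 1 / 16 appear later.\<close>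

definition q_bounded :: "'i rmat \<Rightarrow> real \<Rightarrow> bool" where
  "q_bounded p s \<longleftrightarrow> p \<in> PG \<and> 0 \<le> s \<and> (\<forall>c. l1 c \<longrightarrow> q (act p c) \<le> s * q c)"

lemma q_bounded_mono: "q_bounded p s \<Longrightarrow> s \<le> t \<Longrightarrow> q_bounded p t"
  unfolding q_bounded_def by (meson mult_right_mono order_trans q_nonneg)

lemma q_bounded_one: "q_bounded 1 1"
  by (simp add: q_bounded_def act_one polys.intros)

lemma q_bounded_mult:
  assumes "q_bounded p s" "q_bounded p' t" shows "q_bounded (p * p') (s * t)"
  unfolding q_bounded_def
proof (intro conjI allI impI)
  show "p * p' \<in> PG" "0 \<le> s * t" using assms by (auto simp: q_bounded_def intro: polys.intros)
  fix c :: "'i \<Rightarrow> real" assume c: "l1 c"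
  have "q (act (p * p') c) = q (act p (act p' c))" by (simp add: act_mult[OF c])
  also have "... \<le> s * q (act p' c)" using assms c by (auto simp: q_bounded_def PG_l1)
  also have "... \<le> s * (t * q c)" using assms c by (intro mult_left_mono) (auto simp: q_bounded_def)
  finally show "q (act (p * p') c) \<le> s * t * q c" by (simp add: mult.assoc)
qed

lemma q_bounded_add:
  assumes "q_bounded p s" "q_bounded p' t" shows "q_bounded (p + p') (2 * s + 2 * t)"
  unfolding q_bounded_def
proof (intro conjI allI impI)
  show "p + p' \<in> PG" "0 \<le> 2 * s + 2 * t" using assms by (auto simp: q_bounded_def intro: polys.intros)
  fix c :: "'i \<Rightarrow> real" assume c: "l1 c"
  have "q (act (p + p') c) \<le> 2 * q (act p c) + 2 * q (act p' c)"
    using assms c by (simp add: act_add_mat q_add_le PG_l1 q_bounded_def)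
  also have "... \<le> 2 * (s * q c) + 2 * (t * q c)"
    using assms c by (intro add_mono mult_left_mono) (auto simp: q_bounded_def)
  finally show "q (act (p + p') c) \<le> (2 * s + 2 * t) * q c" by (simp add: algebra_simps)
qed

lemma q_bounded_diff:
  assumes "q_bounded p s" "q_bounded p' t" shows "q_bounded (p - p') (2 * s + 2 * t)"
  unfolding q_bounded_def
proof (intro conjI allI impI)
  show "p - p' \<in> PG" "0 \<le> 2 * s + 2 * t" using assms by (auto simp: q_bounded_def intro: polys.intros)
  fix c :: "'i \<Rightarrow> real" assume c: "l1 c"
  have "q (act (p - p') c) \<le> 2 * q (act p c) + 2 * q (act p' c)"
    using assms c by (simp add: act_diff_mat q_diff_le PG_l1 q_bounded_def)
  also have "... \<le> 2 * (s * q c) + 2 * (t * q c)"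
    using assms c by (intro add_mono mult_left_mono) (auto simp: q_bounded_def)
  finally show "q (act (p - p') c) \<le> (2 * s + 2 * t) * q c" by (simp add: algebra_simps)
qed

lemma q_bounded_power: "q_bounded p s \<Longrightarrow> q_bounded (p ^ k) (s ^ k)"
  by (induction k) (auto simp: q_bounded_one intro: q_bounded_mult)

text \<open>As operators, G (1 - G)^2 = G - 2 G^2 + G^3 <= G - G^2 <= (1 - A) G. The first
  inequality is G <= 1 tested on \<open>act G c\<close>, the second is \<open>lower\<close>.\<close>

lemma q_bounded_one_minus_G: "q_bounded (1 - G) (1 - A)"
  unfolding q_bounded_def
proof (intro conjI allI impI)
  show "1 - G \<in> PG" "0 \<le> 1 - A" using A_le by (auto intro: polys.intros)
  fix c :: "'i \<Rightarrow> real" assume c: "l1 c"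
  have "q (act (1 - G) c) = q c - 2 * l1_ip (act G c) (act G c) + q (act G c)"
    using c by (simp add: act_diff_mat act_one q_diff_eq G_l1)
  also have "q (act G c) \<le> l1_ip (act G c) (act G c)" by (rule q_le_ip[OF G_l1[OF c]])
  finally have "q (act (1 - G) c) \<le> q c - l1_ip (act G c) (act G c)" by simp
  then show "q (act (1 - G) c) \<le> (1 - A) * q c"
    using lower[OF c] by (simp add: q_def algebra_simps)
qed

text \<open>Any bound will do: it enters only the constant \<open>D\<close> of
  \<open>spectral_bound\<close>, not the rate. Writing the empty sum as 1 - 1 brings it under
  \<open>q_bounded_diff\<close>.\<close>

lemma q_bounded_geometric: "\<exists>S. q_bounded (\<Sum>i<m. (1 - G) ^ i) S"
proof (induction m)
  case 0
  have "q_bounded (1 - 1) (2 * 1 + 2 * 1)" by (intro q_bounded_diff q_bounded_one)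
  then show ?case by auto
next
  case (Suc m)
  then obtain S where "q_bounded (\<Sum>i<m. (1 - G) ^ i) S" by blast
  from q_bounded_add[OF this q_bounded_power[OF q_bounded_one_minus_G]] show ?case by auto
qed

text \<open>The row is \<open>G * p\<close> applied to a unit vector, by symmetry. The factor
  \<open>G\<close> is what converts the seminorm into an l2 norm, through |G c|^2 <= q c; a bound
  for \<open>q\<close> alone says nothing about components in the kernel.\<close>

lemma row_square_bound:
  assumes "q_bounded p S" shows "(LINT j|cs. (ent (G * p) i j)\<^sup>2) \<le> S"
proof -
  have p: "p \<in> PG" using assms by (simp add: q_bounded_def)
  have sy: "sym_rmat (G * p)" using p by (intro PG_symm polys.intros)
  have "(LINT j|cs. (ent (G * p) i j)\<^sup>2) = l1_ip (act (G * p) (uvec i)) (act (G * p) (uvec i))"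
    using sy by (simp add: l1_ip_def act_uv power2_eq_square sym_rmat_def)
  also have "... = l1_ip (act G (act p (uvec i))) (act G (act p (uvec i)))" by (simp add: act_mult l1_uv)
  also have "... \<le> q (act p (uvec i))" using upper[OF PG_l1[OF p l1_uv]] by (simp add: q_def)
  also have "... \<le> S * q (uvec i)" using assms l1_uv[of i] unfolding q_bounded_def by blast
  also have "... \<le> S * l1_ip (uvec i) (uvec i)"
    using assms by (intro mult_left_mono q_le_ip l1_uv) (simp add: q_bounded_def)
  also have "l1_ip (uvec i) (uvec i) = 1" by (simp add: l1_ip_uv) (simp add: uvec_def)
  finally show ?thesis by simp
qed

end

lemma row_bound_mono: "row_bound a s \<Longrightarrow> s \<le> t \<Longrightarrow> row_bound a t"
  unfolding row_bound_def by (meson ennreal_leI order_trans)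

lemma row_bound_ent_one: "row_bound (ent (1 :: 'i::countable rmat)) 1"
  unfolding one_rmat.rep_eq by (rule row_bound_1)

lemma row_bound_ent_mult:
  "row_bound (ent (a :: 'i::countable rmat)) s \<Longrightarrow> row_bound (ent b) t \<Longrightarrow> row_bound (ent (a * b)) (s * t)"
  unfolding times_rmat.rep_eq by (rule row_bound_mult)

lemma row_bound_ent_add:
  "row_bound (ent (a :: 'i::countable rmat)) s \<Longrightarrow> row_bound (ent b) t \<Longrightarrow> row_bound (ent (a + b)) (s + t)"
  unfolding plus_rmat.rep_eq by (rule row_bound_add)

lemma row_bound_ent_power: "row_bound (ent (a :: 'i::countable rmat)) s \<Longrightarrow> row_bound (ent (a ^ k)) (s ^ k)"
  by (induction k) (auto simp: row_bound_ent_one intro: row_bound_ent_mult)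

lemma row_bound_minus:
  assumes "row_bound b t" shows "row_bound (\<lambda>i j. - b i j) t"
proof -
  have "row_bound (\<lambda>i j. - b i j) (1 * t)" by (rule row_bound_scale[OF assms]) auto
  then show ?thesis by simp
qed

lemma row_bound_diff:
  assumes "row_bound a s" "row_bound b t" shows "row_bound (\<lambda>i j. a i j - b i j) (s + t)"
proof -
  have "row_bound (\<lambda>i j. a i j + - b i j) (s + t)"
    by (rule row_bound_add[OF assms(1) row_bound_minus[OF assms(2)]])
  then show ?thesis by simp
qed

text \<open>The exponent 2 n in \<open>count_card\<close> reflects a weight that is the square root
  of a distance in dimension n: weight at most L means distance at most L^2. \<open>I\<close>
  contains the indices that carry a point, since the index type may be larger than the set of
  points.\<close>

locale weighted_index =
  fixes \<omega> :: "'i::countable \<Rightarrow> 'i \<Rightarrow> real" and I :: "'i set" and K :: real and n :: nat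
  assumes w_nonneg: "0 \<le> \<omega> i j" and w_refl: "\<omega> i i = 0" and w_tri: "\<omega> i k \<le> \<omega> i j + \<omega> j k"
    and count_fin: "1 \<le> L \<Longrightarrow> finite {j \<in> I. \<omega> i j \<le> L}"
    and count_card: "1 \<le> L \<Longrightarrow> real (card {j \<in> I. \<omega> i j \<le> L}) \<le> K * L ^ (2 * n)"
begin

definition went :: "'i rmat \<Rightarrow> 'i \<Rightarrow> 'i \<Rightarrow> real" where "went a i j = ent a i j * \<omega> i j"

text \<open>The triangle inequality gives a Leibniz rule: in each of the two terms only one factor
  carries the weight, while the other contributes its plain row sum. Weighted norms of powers
  therefore grow at the rate of the plain norms.\<close>

lemma went_mult:
  assumes "row_bound (ent a) s" "row_bound (went a) s'" "row_bound (ent b) t" "row_bound (went b) t'"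
  shows "row_bound (went (a * b)) (s * t' + s' * t)"
  unfolding row_bound_def
proof (intro conjI allI)
  have nn: "0 \<le> s" "0 \<le> s'" "0 \<le> t" "0 \<le> t'" using assms row_bound_nonneg by blast+
  then show "0 \<le> s * t' + s' * t" by simp
  fix i
  have "nn_abs cs (\<lambda>j. went (a * b) i j)
     \<le> (\<integral>\<^sup>+j. (nn_abs cs (\<lambda>k. ent a i k * went b k j)) + nn_abs cs (\<lambda>k. went a i k * ent b k j) \<partial>cs)"
  proof (rule nn_integral_mono)
    fix j
    have "ennreal \<bar>went (a * b) i j\<bar> = ennreal \<bar>LINT k|cs. ent a i k * ent b k j * \<omega> i j\<bar>"
      by (simp add: went_def times_rmat.rep_eq)
    also have "... \<le> nn_abs cs (\<lambda>k. ent a i k * ent b k j * \<omega> i j)"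
      by (rule abs_lint_le)
    also have "... \<le> (\<integral>\<^sup>+k. ennreal \<bar>ent a i k * went b k j\<bar> + ennreal \<bar>went a i k * ent b k j\<bar> \<partial>cs)"
    proof (rule nn_integral_mono)
      fix k
      have "\<bar>ent a i k * ent b k j * \<omega> i j\<bar> = \<bar>ent a i k * ent b k j\<bar> * \<omega> i j"
        using w_nonneg by (simp add: abs_mult)
      also have "... \<le> \<bar>ent a i k * ent b k j\<bar> * (\<omega> i k + \<omega> k j)"
        by (intro mult_left_mono w_tri) auto
      also have "... = \<bar>ent a i k * went b k j\<bar> + \<bar>went a i k * ent b k j\<bar>"
        using w_nonneg by (simp add: abs_mult went_def algebra_simps)
      finally show "ennreal \<bar>ent a i k * ent b k j * \<omega> i j\<bar> \<le> ennreal \<bar>ent a i k * went b k j\<bar> + ennreal \<bar>went a i k * ent b k j\<bar>"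
        by (simp flip: ennreal_plus)
    qed
    also have "... = nn_abs cs (\<lambda>k. ent a i k * went b k j) + nn_abs cs (\<lambda>k. went a i k * ent b k j)"
      by (rule nn_integral_add) auto
    finally show "ennreal \<bar>went (a * b) i j\<bar> \<le> nn_abs cs (\<lambda>k. ent a i k * went b k j) + nn_abs cs (\<lambda>k. went a i k * ent b k j)" .
  qed
  also have "... = (\<integral>\<^sup>+j. (nn_abs cs (\<lambda>k. ent a i k * went b k j)) \<partial>cs) + (\<integral>\<^sup>+j. (nn_abs cs (\<lambda>k. went a i k * ent b k j)) \<partial>cs)"
    by (rule nn_integral_add) auto
  also have "... \<le> ennreal (s * t') + ennreal (s' * t)"
    by (intro add_mono nn_mult_bound assms)
  also have "... = ennreal (s * t' + s' * t)" using nn by simp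
  finally show "nn_abs cs (\<lambda>j. went (a * b) i j) \<le> ennreal (s * t' + s' * t)" .
qed

lemma went_add: "row_bound (went a) s \<Longrightarrow> row_bound (went b) t \<Longrightarrow> row_bound (went (a + b)) (s + t)"
  using row_bound_add[of "went a" s "went b" t] by (simp add: went_def[abs_def] plus_rmat.rep_eq distrib_right)

lemma went_diff: "row_bound (went a) s \<Longrightarrow> row_bound (went b) t \<Longrightarrow> row_bound (went (a - b)) (s + t)"
  using row_bound_diff[of "went a" s "went b" t] by (simp add: went_def[abs_def] minus_rmat.rep_eq left_diff_distrib)

lemma went_one: "row_bound (went 1) 0"
proof -
  have "went 1 = (\<lambda>i j. 0)" by (auto simp: went_def fun_eq_iff one_rmat.rep_eq w_refl)
  then show ?thesis using row_bound_0 by simp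
qed

lemma went_polys:
  assumes "row_bound (went g) w" "p \<in> polys g" shows "\<exists>t. row_bound (went p) t"
  using assms(2)
proof (induction rule: polys.induct)
  case polys_one show ?case using went_one by blast
next
  case polys_gen show ?case using assms(1) by blast
next
  case (polys_add p p')
  then obtain s t where "row_bound (went p) s" "row_bound (went p') t" by metis
  from went_add[OF this] show ?case by blast
next
  case (polys_diff p p')
  then obtain s t where "row_bound (went p) s" "row_bound (went p') t" by metis
  from went_diff[OF this] show ?case by blast
next
  case (polys_mult p p')
  then obtain s' t' where a: "row_bound (went p) s'" "row_bound (went p') t'" by metis
  obtain s t where "row_bound (ent p) s" "row_bound (ent p') t" using row_bound_ent_obtain by metis
  from went_mult[OF this(1) a(1) this(2) a(2)] show ?case by blast
qed

text \<open>Near the diagonal use Cauchy-Schwarz and the point count, away from it use the weight.\<close>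

lemma row_bound_interpolate:
  assumes supp: "\<And>i j. ent a i j \<noteq> 0 \<Longrightarrow> j \<in> I"
    and w: "row_bound (went a) b" and V: "0 \<le> V" "\<And>i. (LINT j|cs. (ent a i j)\<^sup>2) \<le> V\<^sup>2" and L: "1 \<le> L"
  shows "row_bound (ent a) (sqrt K * L ^ n * V + b / L)"
  unfolding row_bound_def
proof (intro conjI allI)
  have b: "0 \<le> b" using w row_bound_nonneg by blast
  have K: "0 \<le> K"
    using count_card[of 1 undefined] of_nat_0_le_iff[of "card {j \<in> I. \<omega> undefined j \<le> 1}"] by simp
  show "0 \<le> sqrt K * L ^ n * V + b / L" using L V K b by simp
  fix i
  define S where "S = {j \<in> I. \<omega> i j \<le> L}"
  have S: "finite S" "real (card S) \<le> K * L ^ (2 * n)" using count_fin[OF L] count_card[OF L] by (auto simp: S_def)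
  \<comment> \<open>The row is summable and bounded, hence square summable. Otherwise the integral
    in \<open>V\<close> could be 0 by convention and bound nothing.\<close>
  have i2: "integrable cs (\<lambda>j. (ent a i j)\<^sup>2)"
    unfolding power2_eq_square by (intro l1_mult integrable_ent)
  have "(\<Sum>j\<in>S. (ent a i j)\<^sup>2) = (LINT j|cs. indicator S j * (ent a i j)\<^sup>2)"
  proof -
    have "(LINT j|cs. indicator S j * (ent a i j)\<^sup>2) = (LINT j|count_space S. (ent a i j)\<^sup>2)"
      using integral_restrict_space[of S "cs" "\<lambda>j. (ent a i j)\<^sup>2"] by (simp add: restrict_count_space)
    then show ?thesis by (simp add: lebesgue_integral_count_space_finite[OF S(1)])
  qed
  also have "... \<le> (LINT j|cs. (ent a i j)\<^sup>2)"
  proof (rule integral_mono)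
    show "integrable cs (\<lambda>j. indicator S j * (ent a i j)\<^sup>2)"
      using l1_mult_bounded[OF i2, of "indicator S" 1] by (simp add: mult.commute indicator_def)
  qed (use i2 in \<open>auto simp: indicator_def\<close>)
  also have "... \<le> V\<^sup>2" by (rule V)
  finally have s2: "(\<Sum>j\<in>S. (ent a i j)\<^sup>2) \<le> V\<^sup>2" .
  have "(\<Sum>j\<in>S. \<bar>ent a i j\<bar>)\<^sup>2 \<le> (\<Sum>j\<in>S. 1\<^sup>2) * (\<Sum>j\<in>S. \<bar>ent a i j\<bar>\<^sup>2)"
    using Cauchy_Schwarz_ineq_sum[of "\<lambda>_. 1" "\<lambda>j. \<bar>ent a i j\<bar>" S] by simp
  also have "... \<le> (K * L ^ (2 * n)) * V\<^sup>2"
    using S s2 by (intro mult_mono) (auto intro: sum_nonneg)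
  also have "... = (sqrt K * L ^ n * V)\<^sup>2"
    using K by (simp add: power_mult_distrib power_mult power2_eq_square power_mult[symmetric] mult.commute[of n])
  finally have near: "(\<Sum>j\<in>S. \<bar>ent a i j\<bar>) \<le> sqrt K * L ^ n * V"
    by (rule power2_le_imp_le) (use L V K in auto)
  have "nn_abs cs (ent a i)
      \<le> (\<integral>\<^sup>+j. ennreal \<bar>ent a i j\<bar> * indicator S j + ennreal (1 / L) * ennreal \<bar>went a i j\<bar> \<partial>cs)"
  proof (rule nn_integral_mono)
    fix j
    show "ennreal \<bar>ent a i j\<bar> \<le> ennreal \<bar>ent a i j\<bar> * indicator S j + ennreal (1 / L) * ennreal \<bar>went a i j\<bar>"
    proof (cases "j \<in> S \<or> ent a i j = 0")
      case False
      then have "L \<le> \<omega> i j" using supp[of i j] by (auto simp: S_def)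
      then have "\<bar>ent a i j\<bar> * L \<le> \<bar>ent a i j\<bar> * \<omega> i j" by (intro mult_left_mono) auto
      then have "\<bar>ent a i j\<bar> \<le> 1 / L * \<bar>went a i j\<bar>" using L w_nonneg by (simp add: went_def abs_mult field_simps)
      then have "ennreal \<bar>ent a i j\<bar> \<le> ennreal (1 / L) * ennreal \<bar>went a i j\<bar>"
        using L by (simp flip: ennreal_mult)
      then show ?thesis using False by simp
    qed auto
  qed
  also have "... = (\<integral>\<^sup>+j. ennreal \<bar>ent a i j\<bar> * indicator S j \<partial>cs) + ennreal (1 / L) * nn_abs cs (went a i)"
    by (subst nn_integral_add) (auto simp: nn_integral_cmult)
  also have "(\<integral>\<^sup>+j. ennreal \<bar>ent a i j\<bar> * indicator S j \<partial>cs) = ennreal (\<Sum>j\<in>S. \<bar>ent a i j\<bar>)"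
  proof -
    have "(\<integral>\<^sup>+j. ennreal \<bar>ent a i j\<bar> * indicator S j \<partial>cs) = (\<integral>\<^sup>+j. ennreal \<bar>ent a i j\<bar> \<partial>count_space S)"
      by (simp add: nn_integral_count_space_indicator)
    then show ?thesis using S by (simp add: nn_integral_count_space_finite sum_ennreal)
  qed
  also have "ennreal (\<Sum>j\<in>S. \<bar>ent a i j\<bar>) + ennreal (1 / L) * nn_abs cs (went a i)
     \<le> ennreal (sqrt K * L ^ n * V) + ennreal (1 / L) * ennreal b"
    using near w by (intro add_mono mult_left_mono ennreal_leI) (auto simp: row_bound_def)
  also have "... = ennreal (sqrt K * L ^ n * V + b / L)"
    using K L V b by (simp flip: ennreal_mult ennreal_plus)
  finally show "nn_abs cs (ent a i) \<le> ennreal (sqrt K * L ^ n * V + b / L)" .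
qed

end

section \<open>Spectral invariance for polynomial weights\<close>

context weighted_index
begin

text \<open>One step of the bootstrap: the weighted rows of \<open>u ^ (2 k)\<close> gain a factor \<open>\<mu> ^ (- 2 k)\<close>
  since \<open>L = \<mu> ^ (2 k)\<close> can be taken in the interpolation inequality.\<close>

lemma bootstrap_step:
  assumes supp: "\<And>k i j. 1 \<le> k \<Longrightarrow> ent (u ^ k) i j \<noteq> 0 \<Longrightarrow> j \<in> I"
    and D: "0 \<le> D" "\<And>k i. 1 \<le> k \<Longrightarrow> (LINT j|cs. (ent (u ^ k) i j)\<^sup>2) \<le> (D * (1/16) ^ k)\<^sup>2"
    and \<mu>: "1 < \<mu>" "\<mu> ^ (2 * n + 2) \<le> 16 / 9"
    and \<beta>: "1 / 9 \<le> \<beta>"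
    and C: "\<And>j. row_bound (went (u ^ (2 ^ j))) (C * \<beta> ^ (2 ^ j))"
  shows "row_bound (ent (u ^ (2 ^ j))) ((sqrt K * D + C) * (\<beta> / \<mu>\<^sup>2) ^ (2 ^ j))"
    and "\<exists>C'. \<forall>j. row_bound (went (u ^ (2 ^ j))) (C' * (\<beta> / \<mu>) ^ (2 ^ j))"
proof -
  have K: "0 \<le> K"
    using count_card[of 1 undefined] of_nat_0_le_iff[of "card {j \<in> I. \<omega> undefined j \<le> 1}"] by simp
  have C0: "0 \<le> C" using row_bound_nonneg[OF C[of 0]] \<beta> by (simp add: zero_le_mult_iff)
  show a: "row_bound (ent (u ^ (2 ^ j))) ((sqrt K * D + C) * (\<beta> / \<mu>\<^sup>2) ^ (2 ^ j))" for j
  proof -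
    define k :: nat where "k = 2 ^ j"
    have k: "1 \<le> k" by (simp add: k_def)
    define L where "L = (\<mu>\<^sup>2) ^ k"
    have L: "1 \<le> L" unfolding L_def using \<mu> by (intro one_le_power) auto
    have r: "row_bound (ent (u ^ k)) (sqrt K * L ^ n * (D * (1/16) ^ k) + C * \<beta> ^ k / L)"
      using supp[OF k] C[of j] D k L by (intro row_bound_interpolate) (auto simp: k_def)
    \<comment> \<open>Here the constants meet: \<mu> ^ (2 n + 2) <= 16 / 9 <= 16 * \<beta>. The near
      part, which decays at the l2 rate 1 / 16 but pays \<open>L ^ n\<close>, thus decays at least
      as fast as the far part.\<close>
    have "(\<mu>\<^sup>2) ^ n / 16 \<le> \<beta> / \<mu>\<^sup>2"
    proof -
      have "(\<mu>\<^sup>2) ^ n * \<mu>\<^sup>2 \<le> 16 * \<beta>" using \<mu> \<beta> by (simp add: power_mult[symmetric] power_add[symmetric])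
      then show ?thesis using \<mu> by (simp add: field_simps)
    qed
    then have "((\<mu>\<^sup>2) ^ n / 16) ^ k \<le> (\<beta> / \<mu>\<^sup>2) ^ k" using \<mu> by (intro power_mono) auto
    moreover have "L ^ n * (1/16) ^ k = ((\<mu>\<^sup>2) ^ n / 16) ^ k"
      by (simp add: L_def power_mult[symmetric] mult_ac power_divide)
    ultimately have "sqrt K * D * (L ^ n * (1/16) ^ k) \<le> sqrt K * D * (\<beta> / \<mu>\<^sup>2) ^ k"
      using K D by (intro mult_left_mono) auto
    moreover have "C * \<beta> ^ k / L = C * (\<beta> / \<mu>\<^sup>2) ^ k" by (simp add: L_def power_divide)
    ultimately have "sqrt K * L ^ n * (D * (1/16) ^ k) + C * \<beta> ^ k / L \<le> (sqrt K * D + C) * (\<beta> / \<mu>\<^sup>2) ^ k"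
      by (simp add: algebra_simps)
    from row_bound_mono[OF r this] show ?thesis by (simp add: k_def)
  qed
  define C1 where "C1 = 2 * (sqrt K * D + C) * C"
  \<comment> \<open>\<open>C1\<close> comes from squaring, with a factor 2 for the two terms of the
    Leibniz rule; the other entry covers j = 0, where nothing is squared.\<close>
  define C' where "C' = max C1 (C * \<mu>)"
  have "row_bound (went (u ^ (2 ^ j))) (C' * (\<beta> / \<mu>) ^ (2 ^ j))" for j
  proof (cases j)
    case 0
    have "C * \<beta> = C * \<mu> * (\<beta> / \<mu>)" using \<mu> by simp
    also have "... \<le> C' * (\<beta> / \<mu>)" using \<mu> \<beta> by (intro mult_right_mono) (auto simp: C'_def)
    finally have "C * \<beta> \<le> C' * (\<beta> / \<mu>)" .
    then show ?thesis using row_bound_mono[OF C[of 0]] 0 by simp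
  next
    case (Suc j')
    define k :: nat where "k = 2 ^ j'"
    have e: "u ^ (2 ^ j) = u ^ k * u ^ k" by (simp add: k_def Suc power_add[symmetric] mult_2)
    have aa: "row_bound (ent (u ^ k)) ((sqrt K * D + C) * (\<beta> / \<mu>\<^sup>2) ^ k)" unfolding k_def by (rule a)
    have ww: "row_bound (went (u ^ k)) (C * \<beta> ^ k)" unfolding k_def by (rule C)
    \<comment> \<open>Only the unweighted factor gains \<mu> ^ (- 2 k), but the product is the power
      2 k, so the rate improves by one factor \<mu>.\<close>
    have "(\<beta> / \<mu>\<^sup>2) ^ k * \<beta> ^ k = (\<beta> / \<mu>) ^ (2 ^ j)"
      by (simp add: Suc k_def[symmetric] power_mult power_mult_distrib[symmetric] power2_eq_square)
    then have "(sqrt K * D + C) * (\<beta> / \<mu>\<^sup>2) ^ k * (C * \<beta> ^ k) + C * \<beta> ^ k * ((sqrt K * D + C) * (\<beta> / \<mu>\<^sup>2) ^ k)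
       = C1 * (\<beta> / \<mu>) ^ (2 ^ j)"
      by (simp add: C1_def) (simp add: algebra_simps)
    also have "... \<le> C' * (\<beta> / \<mu>) ^ (2 ^ j)" using \<beta> \<mu> by (intro mult_right_mono) (auto simp: C'_def)
    finally show ?thesis unfolding e using row_bound_mono[OF went_mult[OF aa ww aa ww]] by blast
  qed
  then show "\<exists>C'. \<forall>j. row_bound (went (u ^ (2 ^ j))) (C' * (\<beta> / \<mu>) ^ (2 ^ j))" by blast
qed

text \<open>The l2 rate is 1 / 16. The bootstrap divides a crude weighted rate by \<mu> again and
  again until it reaches 1 / 9; the gap between 1 / 9 and 1 / 8 absorbs the constants, and 1 / 8
  lies inside the radius of convergence of the Catalan series.\<close>

lemma spectral_bound:
  assumes supp: "\<And>k i j. 1 \<le> k \<Longrightarrow> ent (u ^ k) i j \<noteq> 0 \<Longrightarrow> j \<in> I"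
    and D: "0 \<le> D" "\<And>k i. 1 \<le> k \<Longrightarrow> (LINT j|cs. (ent (u ^ k) i j)\<^sup>2) \<le> (D * (1/16) ^ k)\<^sup>2"
    and w: "row_bound (went u) w"
  shows "\<exists>C0. \<forall>k. row_bound (ent (u ^ k)) (C0 * (1/8) ^ k)"
proof -
  define \<mu> :: real where "\<mu> = root (2 * n + 2) (16 / 9)"
  have \<mu>: "1 < \<mu>" "\<mu> ^ (2 * n + 2) \<le> 16 / 9"
    by (auto simp: \<mu>_def simp del: power_Suc add_2_eq_Suc')
  obtain M0 where M0: "row_bound (ent u) M0" by (rule row_bound_ent_obtain)
  define M where "M = max (max M0 w) 1"
  have M: "row_bound (ent u) M" "row_bound (went u) M" "1 \<le> M"
    using row_bound_mono[OF M0, of M] row_bound_mono[OF w, of M] by (auto simp: M_def)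
  have grow: "row_bound (went (u ^ k)) (real k * M ^ k)" for k
  proof (induction k)
    case 0 then show ?case using went_one by simp
  next
    case (Suc k)
    have "row_bound (went (u * u ^ k)) (M * (real k * M ^ k) + M * M ^ k)"
      by (intro went_mult Suc M row_bound_ent_power)
    then show ?case by (simp add: algebra_simps)
  qed
  define B where "B = (\<lambda>\<beta>. \<exists>C. \<forall>j. row_bound (went (u ^ (2 ^ j))) (C * \<beta> ^ (2 ^ j)))"
  have B0: "B (2 * M)" unfolding B_def
  proof (intro exI allI)
    fix j
    \<comment> \<open>The Leibniz rule makes weighted norms of k-th powers grow like k * M ^ k;
      absorbing k in 2 ^ k gives the starting rate 2 M.\<close>
    have "real (2 ^ j) \<le> 2 ^ (2 ^ j)" by (metis less_exp less_imp_le of_nat_le_iff of_nat_numeral of_nat_power)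
    then have "real (2 ^ j) * M ^ (2 ^ j) \<le> 1 * (2 * M) ^ (2 ^ j)"
      using M by (auto simp: power_mult_distrib intro!: mult_right_mono)
    from row_bound_mono[OF grow this] show "row_bound (went (u ^ (2 ^ j))) (1 * (2 * M) ^ (2 ^ j))" .
  qed
  have Bmono: "B \<beta>'" if "B \<beta>" "0 < \<beta>" "\<beta> \<le> \<beta>'" for \<beta> \<beta>'
  proof -
    from that(1) obtain C where C: "\<And>j. row_bound (went (u ^ (2 ^ j))) (C * \<beta> ^ (2 ^ j))" unfolding B_def by blast
    have C0: "0 \<le> C" using row_bound_nonneg[OF C[of 0]] that by (simp add: zero_le_mult_iff)
    have "C * \<beta> ^ (2 ^ j) \<le> C * \<beta>' ^ (2 ^ j)" for j
      using C0 that by (intro mult_left_mono power_mono) auto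
    then show ?thesis unfolding B_def using row_bound_mono[OF C] by blast
  qed
  \<comment> \<open>1 / 9 is the floor below which \<open>bootstrap_step\<close> does not apply;
    rates that fall beneath it are raised back by \<open>Bmono\<close>.\<close>
  have iter: "B (max (2 * M / \<mu> ^ N) (1 / 9))" for N
  proof (induction N)
    case 0
    have "2 * M \<le> max (2 * M / \<mu> ^ 0) (1 / 9)" by simp
    from Bmono[OF B0 _ this] show ?case using M by simp
  next
    case (Suc N)
    let ?\<beta> = "max (2 * M / \<mu> ^ N) (1 / 9)"
    obtain C where C: "\<And>j. row_bound (went (u ^ (2 ^ j))) (C * ?\<beta> ^ (2 ^ j))" using Suc unfolding B_def by blast
    have "B (?\<beta> / \<mu>)" unfolding B_def
      by (rule bootstrap_step(2)[OF supp D \<mu> _ C]) auto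
    moreover have "?\<beta> / \<mu> \<le> max (2 * M / \<mu> ^ Suc N) (1 / 9)"
    proof (cases "2 * M / \<mu> ^ N \<le> 1 / 9")
      case True
      then have "?\<beta> / \<mu> = 1 / 9 / \<mu>" by (simp add: max_def)
      also have "... \<le> 1 / 9" using \<mu> by (simp add: field_simps)
      finally show ?thesis by simp
    next
      case False
      then have "?\<beta> / \<mu> = 2 * M / \<mu> ^ Suc N" by (simp add: max_def mult.commute)
      then show ?thesis by simp
    qed
    moreover have "0 < ?\<beta> / \<mu>" using \<mu> by (simp add: less_max_iff_disj)
    ultimately show ?case using Bmono by blast
  qed
  obtain N where N: "18 * M < \<mu> ^ N" using real_arch_pow[OF \<mu>(1)] by blast
  have "max (2 * M / \<mu> ^ N) (1 / 9) = 1 / 9" using N \<mu> M by (simp add: max_def field_simps)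
  then have "B (1 / 9)" using iter[of N] by simp
  then obtain C where C: "\<And>j. row_bound (went (u ^ (2 ^ j))) (C * (1/9) ^ (2 ^ j))" unfolding B_def by blast
  define C2 where "C2 = sqrt K * D + C"
  have a: "row_bound (ent (u ^ (2 ^ j))) (C2 * (1 / 9 / \<mu>\<^sup>2) ^ (2 ^ j))" for j
    unfolding C2_def by (rule bootstrap_step(1)[OF supp D \<mu> _ C]) auto
  \<comment> \<open>Since (9/8) * (1/9) = 1/8, giving up a little of the rate pays for
    \<open>C2\<close>: the power m = 2 ^ j satisfies the bound (1/8) ^ m with constant 1, which can
    be iterated by submultiplicativity.\<close>
  obtain j where j: "C2 < (9/8) ^ j" using real_arch_pow[of "9/8" C2] by auto
  define m :: nat where "m = 2 ^ j"
  have m: "1 \<le> m" by (simp add: m_def)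
  have "0 \<le> C2 * (1 / 9 / \<mu>\<^sup>2) ^ (2 ^ 0)" by (rule row_bound_nonneg[OF a[of 0]])
  moreover have "0 < (1 / 9 / \<mu>\<^sup>2) ^ (2 ^ 0)" using \<mu> by simp
  ultimately have C20: "0 \<le> C2" using zero_le_mult_iff by (metis less_le_not_le)
  have am: "row_bound (ent (u ^ m)) ((1/8) ^ m)"
  proof -
    have "(9/8 :: real) ^ j \<le> (9/8) ^ m" unfolding m_def by (intro power_increasing) (auto intro: less_imp_le less_exp)
    then have "C2 \<le> (9/8) ^ m" using j by linarith
    moreover have "(1 / 9 / \<mu>\<^sup>2) ^ m \<le> (1/9) ^ m" using \<mu> by (intro power_mono) (auto simp: field_simps)
    ultimately have "C2 * (1 / 9 / \<mu>\<^sup>2) ^ m \<le> (9/8) ^ m * (1/9) ^ m"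
      using C20 by (intro mult_mono) auto
    also have "... = (1/8) ^ m" by (simp add: power_mult_distrib[symmetric])
    finally show ?thesis using row_bound_mono[OF a[of j]] by (simp add: m_def)
  qed
  have "row_bound (ent (u ^ k)) ((8 * M) ^ m * (1/8) ^ k)" for k
  proof -
    \<comment> \<open>Whole blocks of length \<open>m\<close> use the bound with constant 1; the
      remainder, shorter than \<open>m\<close>, costs at most (8 M) ^ m.\<close>
    define q r where "q = k div m" and "r = k mod m"
    have kqr: "k = m * q + r" "r < m" using m by (auto simp: q_def r_def)
    have uk: "u ^ k = (u ^ m) ^ q * u ^ r"
      by (subst kqr(1), subst power_add, subst power_mult, rule refl)
    have rb: "row_bound (ent (u ^ k)) (((1/8) ^ m) ^ q * M ^ r)"
      unfolding uk by (intro row_bound_ent_mult row_bound_ent_power am M)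
    have pk: "x ^ k = (x ^ m) ^ q * x ^ r" for x :: real
      by (subst kqr(1), subst power_add, subst power_mult, rule refl)
    have "M ^ r = (8 * M) ^ r * (1/8) ^ r" by (subst power_mult_distrib[symmetric]) simp
    then have "((1/8) ^ m) ^ q * M ^ r = ((1/8) ^ m) ^ q * ((8 * M) ^ r * (1/8) ^ r)" by (rule arg_cong)
    also have "... = (8 * M) ^ r * (1/8) ^ k" unfolding pk by (rule mult.left_commute)
    also have "... \<le> (8 * M) ^ m * (1/8) ^ k"
      using kqr M by (intro mult_right_mono power_increasing) auto
    finally show ?thesis by (rule row_bound_mono[OF rb])
  qed
  then show ?thesis by blast
qed

end

text \<open>Fixed-point iterates for the Catalan series: \<open>x = u * catalan u\<close> solves \<open>x = u + x\<^sup>2\<close> in the limit, and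
  \<open>catalan_bd\<close> is its scalar majorant at \<open>u = 1/8\<close>, inside the radius of convergence \<open>1/4\<close>.\<close>

fun catalan_bd :: "nat \<Rightarrow> real" where
  "catalan_bd 0 = 0" | "catalan_bd (Suc j) = 1 + (1/8) * (catalan_bd j)\<^sup>2"

fun catalan :: "'a::ring_1 \<Rightarrow> nat \<Rightarrow> 'a" where
  "catalan u 0 = 0" | "catalan u (Suc j) = 1 + u * (catalan u j)\<^sup>2"

text \<open>The interval from 0 to 2 is invariant because 1 + 2^2 / 8 <= 2; together with
  monotonicity this makes the scalar iteration converge.\<close>

lemma catalan_bd_bound: "0 \<le> catalan_bd j \<and> catalan_bd j \<le> 2"
proof (induction j)
  case (Suc j)
  have "(catalan_bd j)\<^sup>2 \<le> 2\<^sup>2" using Suc by (intro power_mono) auto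
  then show ?case by simp
qed auto

lemma catalan_bd_mono: "catalan_bd j \<le> catalan_bd (Suc j)"
proof (induction j)
  case (Suc j)
  have "(catalan_bd j)\<^sup>2 \<le> (catalan_bd (Suc j))\<^sup>2" using Suc catalan_bd_bound by (intro power_mono) auto
  then show ?case by simp
qed auto

lemma catalan_polys: "u \<in> polys g \<Longrightarrow> catalan u j \<in> polys g"
  by (induction j) (auto intro!: polys.intros polys_power intro: polys_diff[of 1 g 1, simplified])

text \<open>Bounding each factor \<open>u\<close> separately would cost \<open>C0\<close> every time
  and destroy the comparison with the scalar iteration. Controlling a matrix times all powers of
  \<open>u\<close> at once makes multiplication by \<open>u\<close> a mere shift of the exponent,
  and \<open>C0\<close> is paid only once.\<close>

lemma catalan_diff_bound:
  fixes u :: "'i::countable rmat"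
  assumes C0: "\<And>k. row_bound (ent (u ^ k)) (C0 * (1/8) ^ k)" and ij: "j \<le> i"
  shows "row_bound (ent (catalan u i - catalan u j)) (C0 * (catalan_bd i - catalan_bd j))"
proof -
  define nb where "nb = (\<lambda>(a :: 'i rmat) s. \<forall>k. row_bound (ent (a * u ^ k)) (s * (1/8) ^ k))"
  \<comment> \<open>\<open>good x X\<close>: multiplication by \<open>X\<close> on the right acts on
    such bounds like the number \<open>x\<close>. This is preserved by sums and products and assigns
    1 / 8 to \<open>u\<close>, so the matrix recursion inherits the scalar one.\<close>
  define good where "good = (\<lambda>x X. \<forall>a s. nb a s \<longrightarrow> nb (a * X) (s * x))"
  have nb_nonneg: "0 \<le> s" if "nb a s" for a s
    using that[unfolded nb_def, rule_format, of 0] row_bound_nonneg by simp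
  have nb_add: "nb (a + b) (s + t)" if "nb a s" "nb b t" for a b s t
    using that row_bound_ent_add[of "a * u ^ _" "s * (1/8) ^ _" "b * u ^ _" "t * (1/8) ^ _"]
    unfolding nb_def by (simp add: distrib_right)
  have nb0: "nb 0 0" by (simp add: nb_def zero_rmat.rep_eq row_bound_0)
  have good0: "good 0 0" using nb0 by (simp add: good_def)
  have good1: "good 1 1" by (simp add: good_def)
  have goodu: "good (1/8) u" unfolding good_def nb_def
  proof (intro allI impI)
    fix a s k assume *: "\<forall>k. row_bound (ent (a * u ^ k)) (s * (1 / 8) ^ k)"
    show "row_bound (ent (a * u * u ^ k)) (s * (1 / 8) * (1 / 8) ^ k)"
      using *[rule_format, of "Suc k"] by (simp add: mult.assoc)
  qed
  have good_add: "good (x + y) (X + Y)" if "good x X" "good y Y" for x X y Y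
    unfolding good_def
  proof (intro allI impI)
    fix a s assume "nb a s"
    with that have "nb (a * X) (s * x)" "nb (a * Y) (s * y)" by (auto simp: good_def)
    from nb_add[OF this] show "nb (a * (X + Y)) (s * (x + y))" by (simp add: distrib_left)
  qed
  have good_mult: "good (x * y) (X * Y)" if "good x X" "good y Y" for x X y Y
    unfolding good_def
  proof (intro allI impI)
    fix a s assume "nb a s"
    with that(1) have "nb (a * X) (s * x)" by (auto simp: good_def)
    with that(2) have "nb (a * X * Y) (s * x * y)" by (auto simp: good_def)
    then show "nb (a * (X * Y)) (s * (x * y))" by (simp add: mult.assoc)
  qed
  have goodY: "good (catalan_bd j) (catalan u j)" for j
    by (induction j) (auto simp: power2_eq_square intro!: good0 good_add good1 good_mult goodu
        simp del: times_divide_eq_left mult_1)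
  have upoly: "u \<in> polys u" by (rule polys_gen)
  have good_step: "good (catalan_bd (Suc j) - catalan_bd j) (catalan u (Suc j) - catalan u j)" for j
  proof (induction j)
    case 0 then show ?case using good1 by simp
  next
    case (Suc j)
    \<comment> \<open>The difference of squares factors only for commuting matrices; both iterates
      are polynomials in \<open>u\<close>.\<close>
    have c: "catalan u (Suc j) * catalan u j = catalan u j * catalan u (Suc j)"
      by (intro polys_commute[of _ u] catalan_polys upoly)
    have "catalan u (Suc (Suc j)) - catalan u (Suc j) = u * ((catalan u (Suc j))\<^sup>2 - (catalan u j)\<^sup>2)"
      by (simp add: right_diff_distrib)
    also have "... = u * ((catalan u (Suc j) - catalan u j) * (catalan u (Suc j) + catalan u j))"
    proof -
      have "(catalan u (Suc j))\<^sup>2 - (catalan u j)\<^sup>2 = (catalan u (Suc j) - catalan u j) * (catalan u (Suc j) + catalan u j)"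
        unfolding power2_eq_square distrib_left left_diff_distrib c by simp
      then show ?thesis by simp
    qed
    finally have e: "catalan u (Suc (Suc j)) - catalan u (Suc j) = u * ((catalan u (Suc j) - catalan u j) * (catalan u (Suc j) + catalan u j))" .
    have e2: "catalan_bd (Suc (Suc j)) - catalan_bd (Suc j) = 1/8 * ((catalan_bd (Suc j) - catalan_bd j) * (catalan_bd (Suc j) + catalan_bd j))"
      by (simp add: power2_eq_square algebra_simps)
    show ?case unfolding e e2 by (intro good_mult goodu Suc good_add goodY)
  qed
  have goodd: "good (catalan_bd i - catalan_bd j) (catalan u i - catalan u j)"
    using ij
  proof (induction rule: dec_induct)
    case base then show ?case using good0 by simp
  next
    case (step i)
    from good_add[OF good_step[of i] step(3)] show ?case by (simp del: catalan.simps catalan_bd.simps)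
  qed
  have "nb 1 C0" unfolding nb_def using C0 by simp
  from goodd[unfolded good_def, rule_format, OF this]
  have "nb (1 * (catalan u i - catalan u j)) (C0 * (catalan_bd i - catalan_bd j))" .
  then show ?thesis unfolding nb_def by (metis mult.right_neutral mult_1 power_0)
qed

lemma one_minus_power: "1 - (1 - g) ^ m = g * (\<Sum>i<m. (1 - g) ^ i)" for g :: "'a::ring_1"
  by (induction m) (auto simp: algebra_simps)

locale localized_psd = psd_rmat G A + weighted_index \<omega> I K n
  for G :: "'i::countable rmat" and A and \<omega> :: "'i \<Rightarrow> 'i \<Rightarrow> real" and I :: "'i set" and K n +
  fixes w :: real
  assumes supp: "ent G i j \<noteq> 0 \<Longrightarrow> j \<in> I" and weighted: "row_bound (went G) w"
begin

text \<open>\<open>R\<close> is small for the seminorm \<open>q\<close>, and \<open>1 - R\<close> is divisible by \<open>G\<close>. The Catalan series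
  \<open>X = U + X\<^sup>2\<close> in \<open>U = R - R\<^sup>2\<close> reproduces \<open>R\<close> modulo the kernel of \<open>q\<close>, and each of its terms is
  divisible by \<open>G\<close> too.\<close>

theorem approximate_inverse:
  "\<exists>Z \<delta>. (\<forall>j. Z j \<in> PG) \<and> \<delta> \<longlonglongrightarrow> (0::real) \<and> (\<forall>i j. j \<le> i \<longrightarrow> row_bound (ent (Z i - Z j)) (\<delta> j)) \<and>
     (\<forall>j c. l1 c \<longrightarrow> q (act (1 - Z j * G) c) \<le> (1/4) ^ j * q c)"
proof -
  \<comment> \<open>1 / 1024 makes 4 r < 1 / 256 = (1 / 16)^2, the squared l2 rate that
    \<open>spectral_bound\<close> expects of \<open>U\<close>.\<close>
  obtain m where m: "(1 - A) ^ m < 1 / 1024"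
  proof (cases "A = 1")
    case True
    then show ?thesis using that[of 1] by simp
  next
    case False
    then show ?thesis using that real_arch_pow_inv[of "1/1024" "1 - A"] A_pos A_le by auto
  qed
  define r where "r = (1 - A) ^ m"
  have r: "0 \<le> r" "r < 1 / 1024" using m A_le by (auto simp: r_def)
  define R where "R = (1 - G) ^ m"
  define s where "s = (\<Sum>i<m. (1 - G) ^ i)"
  define U where "U = R - R * R"
  have one_G: "1 - G \<in> PG" by (intro polys.intros)
  have R: "R \<in> PG" unfolding R_def by (intro polys_power one_G)
  obtain S where S: "q_bounded s S" using q_bounded_geometric unfolding s_def by blast
  have s: "s \<in> PG" using S by (simp add: q_bounded_def)
  have U: "U \<in> PG" unfolding U_def by (intro polys.intros R)
  have R1: "1 - R = G * s" unfolding R_def s_def by (rule one_minus_power)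
  have UG: "U = G * (s * R)"
  proof -
    have "U = (1 - R) * R" by (simp add: U_def algebra_simps)
    then show ?thesis by (simp add: R1 mult.assoc)
  qed
  have qR: "q_bounded R r" unfolding R_def r_def by (intro q_bounded_power q_bounded_one_minus_G)
  have qU: "q_bounded U (4 * r)"
  proof (rule q_bounded_mono)
    show "q_bounded U (2 * r + 2 * (r * r))" unfolding U_def by (intro q_bounded_diff q_bounded_mult qR)
    have "r * r \<le> r * 1" using r by (intro mult_left_mono) auto
    then show "2 * r + 2 * (r * r) \<le> 4 * r" by simp
  qed
  define D where "D = sqrt S"
  have S0: "0 \<le> S" using S by (simp add: q_bounded_def)
  have rows: "(LINT j|cs. (ent (U ^ k) i j)\<^sup>2) \<le> (D * (1/16) ^ k)\<^sup>2" if k: "1 \<le> k" for k i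
  proof -
    obtain k' where k': "k = Suc k'" using k by (cases k) auto
    \<comment> \<open>One factor U = G (s R) is opened to expose the \<open>G\<close> required by
      \<open>row_square_bound\<close>; the bound for \<open>s\<close> goes into
      \<open>D\<close>.\<close>
    have "U ^ k = G * (s * R * U ^ k')" using k' UG by (simp add: mult.assoc)
    moreover have "q_bounded (s * R * U ^ k') (S * r * (4 * r) ^ k')" by (intro q_bounded_mult q_bounded_power S qR qU)
    ultimately have "(LINT j|cs. (ent (U ^ k) i j)\<^sup>2) \<le> S * r * (4 * r) ^ k'"
      using row_square_bound by metis
    also have "... \<le> S * (1/256) * (1/256) ^ k'"
      using r S0 by (intro mult_mono power_mono) auto
    also have "... = S * ((1/16) ^ k * (1/16) ^ k)"
      by (simp add: k' power_mult_distrib[symmetric])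
    also have "... = (D * (1/16) ^ k)\<^sup>2"
      using S0 by (simp add: D_def power2_eq_square)
    finally show ?thesis .
  qed
  have Usupp: "j \<in> I" if k: "1 \<le> k" and nz: "ent (U ^ k) i j \<noteq> 0" for k i j
  proof (rule ccontr)
    assume "j \<notin> I"
    then have z: "ent G l j = 0" for l using supp by blast
    obtain k' where k': "k = Suc k'" using k by (cases k) auto
    \<comment> \<open>With \<open>G\<close> moved to the right end, the zero columns of
      \<open>G\<close> are zero columns of the product.\<close>
    have "U ^ k = (s * R * U ^ k') * G"
    proof -
      have "s * R * U ^ k' \<in> PG" by (intro polys.intros polys_power s R U)
      from polys_commute_gen[OF this] show ?thesis using k' UG by (simp add: mult.assoc)
    qed
    then have "ent (U ^ k) i j = 0" by (simp add: times_rmat.rep_eq z)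
    then show False using nz by simp
  qed
  obtain wU where wU: "row_bound (went U) wU" using went_polys[OF weighted U] by blast
  have D0: "0 \<le> D" using S0 by (simp add: D_def)
  have "\<exists>C0. \<forall>k. row_bound (ent (U ^ k)) (C0 * (1/8) ^ k)"
    by (rule spectral_bound[OF Usupp D0 rows wU])
  then obtain C0 where C0: "\<And>k. row_bound (ent (U ^ k)) (C0 * (1/8) ^ k)" by blast
  define Y where "Y = catalan U"
  \<comment> \<open>\<open>s\<close> inverts \<open>G\<close> up to the error R, since G s = 1 - R.
    The correction satisfies G (s R Y j) = U Y j, the j-th Catalan iterate, which tends to R with
    respect to \<open>q\<close> and so cancels that error.\<close>
  define Z where "Z = (\<lambda>j. s + s * R * Y j)"
  have Y: "Y j \<in> PG" for j unfolding Y_def by (intro catalan_polys U)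
  have Z: "Z j \<in> PG" for j unfolding Z_def by (intro polys.intros s R Y)
  obtain M where M: "row_bound (ent (s * R)) M" by (rule row_bound_ent_obtain)
  have conv: "convergent catalan_bd"
    by (rule Bseq_mono_convergent[OF BseqI'[of _ 2]])
       (use catalan_bd_bound in \<open>auto intro: lift_Suc_mono_le[of catalan_bd, OF catalan_bd_mono]\<close>)
  define yl where "yl = lim catalan_bd"
  have yl: "catalan_bd \<longlonglongrightarrow> yl" using conv by (simp add: yl_def convergent_LIMSEQ_iff)
  have yle: "catalan_bd i \<le> yl" for i
    by (rule incseq_le[OF _ yl]) (auto simp: incseq_def intro: lift_Suc_mono_le[of catalan_bd, OF catalan_bd_mono])
  \<comment> \<open>The tail of the scalar majorant, times the row sum of
    \<open>s * R\<close>.\<close>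
  define \<delta> where "\<delta> = (\<lambda>j. M * (C0 * (yl - catalan_bd j)))"
  have "(\<lambda>j. M * (C0 * (yl - catalan_bd j))) \<longlonglongrightarrow> M * (C0 * (yl - yl))"
    by (intro tendsto_intros yl)
  then have \<delta>: "\<delta> \<longlonglongrightarrow> 0" by (simp add: \<delta>_def)
  have C0n: "0 \<le> C0" using row_bound_nonneg[OF C0[of 0]] by simp
  have diff: "row_bound (ent (Z i - Z j)) (\<delta> j)" if "j \<le> i" for i j
  proof (rule row_bound_mono)
    have "Z i - Z j = s * R * (Y i - Y j)" by (simp add: Z_def right_diff_distrib)
    moreover have "row_bound (ent (s * R * (Y i - Y j))) (M * (C0 * (catalan_bd i - catalan_bd j)))"
      unfolding Y_def by (intro row_bound_ent_mult M catalan_diff_bound C0 that)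
    ultimately show "row_bound (ent (Z i - Z j)) (M * (C0 * (catalan_bd i - catalan_bd j)))" by simp
    show "M * (C0 * (catalan_bd i - catalan_bd j)) \<le> \<delta> j"
      unfolding \<delta>_def using row_bound_nonneg[OF M] C0n yle by (intro mult_left_mono) auto
  qed
  define X where "X = (\<lambda>j. U * Y j)"
  have X: "X j \<in> PG" for j unfolding X_def by (intro polys.intros U Y)
  have X_Suc: "X (Suc j) = U + X j * X j" for j
  proof -
    have c: "U * Y j = Y j * U" by (rule polys_commute[OF U Y])
    have "U * (U * (Y j * Y j)) = U * Y j * (U * Y j)"
      by (metis c mult.assoc)
    then show ?thesis by (simp add: X_def Y_def distrib_left power2_eq_square)
  qed
  \<comment> \<open>1 / 16 survives the recursion: 2 * 4 r + 2 / 256 < 1 / 64.\<close>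
  have qX: "q_bounded (X j) (1/16)" for j
  proof (induction j)
    case 0
    have "q_bounded 0 0" using q_bounded_one by (auto simp: q_bounded_def act_def zero_rmat.rep_eq q_def l1_ip_def intro: polys_diff[of 1 G 1, simplified] polys.intros)
    then show ?case by (auto simp: X_def Y_def intro: q_bounded_mono)
  next
    case (Suc j)
    show ?case unfolding X_Suc
    proof (rule q_bounded_mono)
      show "q_bounded (U + X j * X j) (2 * (4 * r) + 2 * (1/16 * (1/16)))" by (intro q_bounded_add q_bounded_mult qU Suc)
    qed (use r in simp)
  qed
  have ZG: "1 - Z j * G = R - X j" for j
  proof -
    have "Z j * G = G * Z j" by (rule polys_commute_gen[OF Z])
    also have "... = (1 - R) + U * Y j" unfolding Z_def R1 UG by (simp add: distrib_left mult.assoc)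
    finally show ?thesis by (simp add: X_def)
  qed
  have "q_bounded (R - X j) ((1/4) ^ j)" for j
  proof (induction j)
    case 0
    have "q_bounded R 1" by (rule q_bounded_mono[OF qR]) (use r in simp)
    then show ?case by (simp add: X_def Y_def)
  next
    case (Suc j)
    have c: "R * X j = X j * R" by (rule polys_commute[OF R X])
    \<comment> \<open>R solves R = U + R^2 exactly, so one iteration multiplies the error by R + X
      j, whose bound 2 r + 2 / 16 is below 1 / 4.\<close>
    have "R - X (Suc j) = (R - X j) * (R + X j)"
      unfolding X_Suc U_def by (simp add: algebra_simps c)
    moreover have "q_bounded ((R - X j) * (R + X j)) ((1/4) ^ j * (2 * r + 2 * (1/16)))"
      by (intro q_bounded_mult q_bounded_add Suc qR qX)
    moreover have "(1/4) ^ j * (2 * r + 2 * (1/16)) \<le> (1/4 :: real) ^ j * (1/4)"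
      using r by (intro mult_left_mono) auto
    ultimately show ?case using q_bounded_mono by fastforce
  qed
  then have "\<forall>j c. l1 c \<longrightarrow> q (act (1 - Z j * G) c) \<le> (1/4) ^ j * q c"
    unfolding ZG by (simp add: q_bounded_def)
  then show ?thesis using Z \<delta> diff by blast
qed

end

section \<open>The Schur test\<close>

text \<open>Convexity is available on the open half line only; at h = 0 the claim is 0 <= (p - 1)
  l^p, checked by hand.\<close>

lemma powr_tangent:
  fixes h l p :: real
  assumes "1 \<le> p" "0 < l" "0 \<le> h"
  shows "l powr p + p * l powr (p - 1) * (h - l) \<le> h powr p"
proof (cases "h = 0")
  case True
  have "l powr p = l * l powr (p - 1)" using assms by (simp add: powr_diff)
  then have "l powr p + p * l powr (p - 1) * (h - l) = - ((p - 1) * l powr p)"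
    using True by (simp add: algebra_simps)
  then show ?thesis using True assms by simp
next
  case False
  have "convex_on {0<..} (\<lambda>x. x powr p)" by (rule powr_convex[OF assms(1)])
  moreover have "((\<lambda>x. x powr p) has_field_derivative p * l powr (p - 1)) (at l within {0<..})"
    using assms by (auto intro!: derivative_eq_intros simp: powr_diff)
  ultimately have "p * l powr (p - 1) * (h - l) \<le> h powr p - l powr p"
    using assms False by (intro convex_on_imp_above_tangent[where A = "{0<..}"]) (auto simp: interior_open)
  then show ?thesis by simp
qed

abbreviation powint :: "real \<Rightarrow> 'a measure \<Rightarrow> ('a \<Rightarrow> real) \<Rightarrow> ennreal" where
  "powint p M f \<equiv> \<integral>\<^sup>+x. ennreal (\<bar>f x\<bar> powr p) \<partial>M"

text \<open>Jensen's inequality for the measure |k| dN, obtained by integrating a tangent of t^p. No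
  dual exponent appears, so p = 1 is not a special case. The mass of |k| enters with a nonpositive
  coefficient, hence an upper bound \<kappa> may replace it.\<close>

lemma weighted_jensen:
  fixes k h :: "'b \<Rightarrow> real"
  assumes p: "1 \<le> p" and \<kappa>: "0 < \<kappa>" and k: "integrable N k" "(\<integral>\<^sup>+y. ennreal \<bar>k y\<bar> \<partial>N) \<le> ennreal \<kappa>"
    and h: "h \<in> borel_measurable N" "integrable N (\<lambda>y. k y * h y)"
  shows "ennreal (\<bar>LINT y|N. k y * h y\<bar> powr p) \<le> ennreal (\<kappa> powr (p - 1)) * (\<integral>\<^sup>+y. ennreal \<bar>k y\<bar> * ennreal (\<bar>h y\<bar> powr p) \<partial>N)"
proof -
  define J where "J = (LINT y|N. \<bar>k y\<bar> * \<bar>h y\<bar>)"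
  have iJ: "integrable N (\<lambda>y. \<bar>k y\<bar> * \<bar>h y\<bar>)" using integrable_abs[OF h(2)] by (simp add: abs_mult)
  have le: "\<bar>LINT y|N. k y * h y\<bar> \<le> J"
    unfolding J_def using integral_abs_bound[of N "\<lambda>y. k y * h y"] by (simp add: abs_mult)
  have J0: "0 \<le> J" using le by linarith
  define T where "T = (\<integral>\<^sup>+y. ennreal (\<bar>k y\<bar> * \<bar>h y\<bar> powr p) \<partial>N)"
  have main: "ennreal (J powr p) \<le> ennreal (\<kappa> powr (p - 1)) * T"
  \<comment> \<open>The tangent point must be positive and the right-hand integral finite; the two
    excluded cases are immediate.\<close>
  proof (cases "J = 0 \<or> T = \<infinity>")
    case True
    then show ?thesis using \<kappa> p by (auto simp: ennreal_mult_eq_top_iff ennreal_mult_top)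
  next
    case False
    then have J: "0 < J" using J0 by simp
    have [measurable]: "k \<in> borel_measurable N" using k by auto
    note h(1)[measurable]
    have iT: "integrable N (\<lambda>y. \<bar>k y\<bar> * \<bar>h y\<bar> powr p)"
    proof (rule integrableI_bounded)
      show "(\<integral>\<^sup>+ x. ennreal (norm (\<bar>k x\<bar> * \<bar>h x\<bar> powr p)) \<partial>N) < \<infinity>"
        using False by (simp add: T_def top.not_eq_extremum)
    qed measurable
    \<comment> \<open>The mean of |h| when |k| has mass exactly \<kappa>; touching the curve there
      gives the sharp constant.\<close>
    define l where "l = J / \<kappa>"
    have l: "0 < l" using J \<kappa> by (simp add: l_def)
    have ik: "integrable N (\<lambda>y. \<bar>k y\<bar>)" using k(1) by simp
    define c where "c = (LINT y|N. \<bar>k y\<bar>)"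
    have c: "c \<le> \<kappa>"
      using k(2) nn_integral_eq_integral[OF ik] \<kappa> by (simp add: c_def)
    have "p * l powr (p - 1) * J - (p - 1) * l powr p * \<kappa> \<le> p * l powr (p - 1) * J - (p - 1) * l powr p * c"
      using c p by (intro diff_left_mono mult_left_mono) auto
    also have "... = (LINT y|N. p * l powr (p - 1) * (\<bar>k y\<bar> * \<bar>h y\<bar>) - (p - 1) * l powr p * \<bar>k y\<bar>)"
      using iJ ik by (simp add: J_def c_def)
    also have "... \<le> (LINT y|N. \<bar>k y\<bar> * \<bar>h y\<bar> powr p)"
    proof (rule integral_mono)
      fix y
      have e: "l powr p = l * l powr (p - 1)" using l by (simp add: powr_diff)
      have "\<bar>k y\<bar> * (l powr p + p * l powr (p - 1) * (\<bar>h y\<bar> - l)) \<le> \<bar>k y\<bar> * \<bar>h y\<bar> powr p"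
        by (intro mult_left_mono powr_tangent p l) auto
      then show "p * l powr (p - 1) * (\<bar>k y\<bar> * \<bar>h y\<bar>) - (p - 1) * l powr p * \<bar>k y\<bar> \<le> \<bar>k y\<bar> * \<bar>h y\<bar> powr p"
        by (simp add: e algebra_simps)
    qed (use iJ ik iT in auto)
    finally have "p * l powr (p - 1) * J - (p - 1) * l powr p * \<kappa> \<le> (LINT y|N. \<bar>k y\<bar> * \<bar>h y\<bar> powr p)" .
    moreover have "l powr p * \<kappa> = l powr (p - 1) * J" using J \<kappa> by (simp add: powr_diff l_def)
    then have "p * l powr (p - 1) * J - (p - 1) * l powr p * \<kappa> = l powr (p - 1) * J"
      by (simp add: algebra_simps)
    ultimately have "l powr (p - 1) * J \<le> (LINT y|N. \<bar>k y\<bar> * \<bar>h y\<bar> powr p)" by simp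
    moreover have "J powr p = \<kappa> powr (p - 1) * (l powr (p - 1) * J)"
      using J \<kappa> by (simp add: l_def powr_divide powr_diff)
    ultimately have "J powr p \<le> \<kappa> powr (p - 1) * (LINT y|N. \<bar>k y\<bar> * \<bar>h y\<bar> powr p)"
      by (simp add: mult_left_mono)
    then have "ennreal (J powr p) \<le> ennreal (\<kappa> powr (p - 1)) * ennreal (LINT y|N. \<bar>k y\<bar> * \<bar>h y\<bar> powr p)"
      by (simp flip: ennreal_mult add: ennreal_leI)
    also have "ennreal (LINT y|N. \<bar>k y\<bar> * \<bar>h y\<bar> powr p) = T"
      unfolding T_def by (rule nn_integral_eq_integral[OF iT, symmetric]) auto
    finally show ?thesis .
  qed
  have "ennreal (\<bar>LINT y|N. k y * h y\<bar> powr p) \<le> ennreal (J powr p)"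
    using le p by (intro ennreal_leI powr_mono2) auto
  also note main
  finally show ?thesis by (simp add: T_def ennreal_mult)
qed

text \<open>Integrate \<open>weighted_jensen\<close> over x and interchange. Row and column bounds
  stay separate because the far part of the synthesis gains in its columns only.\<close>

lemma schur_test:
  fixes k :: "'a \<Rightarrow> 'b \<Rightarrow> real"
  assumes sf: "sigma_finite_measure M" "sigma_finite_measure N"
    and p: "1 \<le> p" and \<kappa>: "0 < \<kappa>\<^sub>1" "0 \<le> \<kappa>\<^sub>2"
    and km: "case_prod k \<in> borel_measurable (M \<Otimes>\<^sub>M N)"
    and rows: "\<And>x. x \<in> space M \<Longrightarrow> (\<integral>\<^sup>+y. ennreal \<bar>k x y\<bar> \<partial>N) \<le> ennreal \<kappa>\<^sub>1"
    and cols: "\<And>y. y \<in> space N \<Longrightarrow> (\<integral>\<^sup>+x. ennreal \<bar>k x y\<bar> \<partial>M) \<le> ennreal \<kappa>\<^sub>2"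
    and h: "h \<in> borel_measurable N" "\<And>x. x \<in> space M \<Longrightarrow> integrable N (\<lambda>y. k x y * h y)"
  shows "powint p M (\<lambda>x. LINT y|N. k x y * h y)
     \<le> ennreal (\<kappa>\<^sub>1 powr (p - 1) * \<kappa>\<^sub>2) * powint p N h"
proof -
  interpret pair_sigma_finite M N using sf by (simp add: pair_sigma_finite_def)
  note km[measurable] h(1)[measurable]
  have "powint p M (\<lambda>x. LINT y|N. k x y * h y)
    \<le> (\<integral>\<^sup>+x. ennreal (\<kappa>\<^sub>1 powr (p - 1)) * (\<integral>\<^sup>+y. ennreal \<bar>k x y\<bar> * ennreal (\<bar>h y\<bar> powr p) \<partial>N) \<partial>M)"
  proof (rule nn_integral_mono)
    fix x assume x: "x \<in> space M"
    have "integrable N (k x)"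
    proof (rule integrableI_bounded)
      show "k x \<in> borel_measurable N" using measurable_Pair2[OF km x] by simp
      show "(\<integral>\<^sup>+ y. ennreal (norm (k x y)) \<partial>N) < \<infinity>"
        using le_less_trans[OF rows[OF x] ennreal_less_top] by simp
    qed
    from weighted_jensen[OF p \<kappa>(1) this rows[OF x] h(1) h(2)[OF x]]
    show "ennreal (\<bar>LINT y|N. k x y * h y\<bar> powr p)
      \<le> ennreal (\<kappa>\<^sub>1 powr (p - 1)) * (\<integral>\<^sup>+y. ennreal \<bar>k x y\<bar> * ennreal (\<bar>h y\<bar> powr p) \<partial>N)" .
  qed
  also have "... = ennreal (\<kappa>\<^sub>1 powr (p - 1)) * (\<integral>\<^sup>+x. (\<integral>\<^sup>+y. ennreal \<bar>k x y\<bar> * ennreal (\<bar>h y\<bar> powr p) \<partial>N) \<partial>M)"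
    by (intro nn_integral_cmult) measurable
  also have "(\<integral>\<^sup>+x. (\<integral>\<^sup>+y. ennreal \<bar>k x y\<bar> * ennreal (\<bar>h y\<bar> powr p) \<partial>N) \<partial>M)
    = (\<integral>\<^sup>+y. (\<integral>\<^sup>+x. ennreal \<bar>k x y\<bar> * ennreal (\<bar>h y\<bar> powr p) \<partial>M) \<partial>N)"
    by (rule Fubini'[symmetric]) measurable
  also have "... = (\<integral>\<^sup>+y. (\<integral>\<^sup>+x. ennreal \<bar>k x y\<bar> \<partial>M) * ennreal (\<bar>h y\<bar> powr p) \<partial>N)"
  proof (rule nn_integral_cong)
    fix y assume "y \<in> space N"
    then have [measurable]: "(\<lambda>x. k x y) \<in> borel_measurable M" using measurable_Pair1[OF km] by simp
    show "(\<integral>\<^sup>+x. ennreal \<bar>k x y\<bar> * ennreal (\<bar>h y\<bar> powr p) \<partial>M) = (\<integral>\<^sup>+x. ennreal \<bar>k x y\<bar> \<partial>M) * ennreal (\<bar>h y\<bar> powr p)"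
      by (rule nn_integral_multc) measurable
  qed
  also have "... \<le> (\<integral>\<^sup>+y. ennreal \<kappa>\<^sub>2 * ennreal (\<bar>h y\<bar> powr p) \<partial>N)"
    by (intro nn_integral_mono mult_right_mono cols) auto
  also have "... = ennreal \<kappa>\<^sub>2 * powint p N h"
    by (rule nn_integral_cmult) measurable
  finally show ?thesis using \<kappa> by (simp add: ennreal_mult mult.assoc mult_left_mono)
qed

section \<open>The envelope of the generator\<close>

text \<open>Unordered sums become integrals, for which Fubini and monotone convergence are at hand.
  An enumeration of \<open>A\<close> supplies the increasing finite sets for the second
  inequality.\<close>

lemma infsum_ennreal_eq_nn_integral:
  fixes f :: "'a \<Rightarrow> ennreal"
  assumes "countable A"
  shows "(\<Sum>\<^sub>\<infinity>x\<in>A. f x) = (\<integral>\<^sup>+x. f x \<partial>count_space A)"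
proof (rule antisym)
  have e: "(\<Sum>\<^sub>\<infinity>x\<in>A. f x) = (SUP F\<in>{F. finite F \<and> F \<subseteq> A}. sum f F)"
    by (rule nonneg_infsum_complete) auto
  have fin: "sum f F = (\<integral>\<^sup>+x. f x * indicator F x \<partial>count_space A)" if "finite F" "F \<subseteq> A" for F
  proof -
    have "(\<integral>\<^sup>+x. f x * indicator F x \<partial>count_space A) = (\<integral>\<^sup>+x. f x * indicator F x * indicator A x \<partial>count_space UNIV)"
      by (rule nn_integral_count_space_indicator) simp
    also have "... = (\<integral>\<^sup>+x. f x * indicator F x \<partial>count_space UNIV)"
      using that by (intro nn_integral_cong) (auto simp: indicator_def)
    also have "... = (\<integral>\<^sup>+x. f x \<partial>count_space F)"
      by (rule nn_integral_count_space_indicator[symmetric]) simp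
    finally show ?thesis using that by (simp add: nn_integral_count_space_finite)
  qed
  show "(\<Sum>\<^sub>\<infinity>x\<in>A. f x) \<le> (\<integral>\<^sup>+x. f x \<partial>count_space A)"
    unfolding e
  proof (rule SUP_least)
    fix F assume "F \<in> {F. finite F \<and> F \<subseteq> A}"
    then show "sum f F \<le> (\<integral>\<^sup>+x. f x \<partial>count_space A)"
      using fin[of F] by (auto intro!: nn_integral_mono simp: indicator_def)
  qed
  define F where "F = (\<lambda>m. {x \<in> A. to_nat_on A x \<le> m})"
  have F: "finite (F m)" "F m \<subseteq> A" for m
  proof -
    have "inj_on (to_nat_on A) (F m)" using inj_on_to_nat_on[OF assms] by (rule inj_on_subset) (auto simp: F_def)
    moreover have "to_nat_on A ` F m \<subseteq> {..m}" by (auto simp: F_def)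
    ultimately show "finite (F m)" by (meson finite_atMost finite_imageD finite_subset)
  qed (auto simp: F_def)
  have "(\<integral>\<^sup>+x. f x \<partial>count_space A) = (\<integral>\<^sup>+x. (SUP m. f x * indicator (F m) x) \<partial>count_space A)"
  proof (rule nn_integral_cong)
    fix x assume x: "x \<in> space (count_space A)"
    show "f x = (SUP m. f x * indicator (F m) x)"
    proof (rule antisym)
      have "f x \<le> f x * indicator (F (to_nat_on A x)) x" using x by (simp add: F_def)
      also have "... \<le> (SUP m. f x * indicator (F m) x)" by (rule SUP_upper) simp
      finally show "f x \<le> (SUP m. f x * indicator (F m) x)" .
    qed (auto intro!: SUP_least simp: indicator_def)
  qed
  also have "... = (SUP m. \<integral>\<^sup>+x. f x * indicator (F m) x \<partial>count_space A)"
    by (rule nn_integral_monotone_convergence_SUP) (auto simp: incseq_def le_fun_def F_def indicator_def)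
  also have "... \<le> (\<Sum>\<^sub>\<infinity>x\<in>A. f x)"
  proof (rule SUP_least)
    fix m
    have "(\<integral>\<^sup>+x. f x * indicator (F m) x \<partial>count_space A) = sum f (F m)"
      by (rule fin[OF F, symmetric])
    also have "... \<le> (\<Sum>\<^sub>\<infinity>x\<in>A. f x)"
      unfolding e using F by (intro SUP_upper) auto
    finally show "(\<integral>\<^sup>+x. f x * indicator (F m) x \<partial>count_space A) \<le> (\<Sum>\<^sub>\<infinity>x\<in>A. f x)" .
  qed
  finally show "(\<integral>\<^sup>+x. f x \<partial>count_space A) \<le> (\<Sum>\<^sub>\<infinity>x\<in>A. f x)" .
qed

section \<open>Separated point sets and lattice cells\<close>

lemma infnorm_le_iff_cart: "infnorm (x :: real ^ 'n) \<le> b \<longleftrightarrow> (\<forall>i. \<bar>x $ i\<bar> \<le> b)"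
proof
  assume "infnorm x \<le> b"
  then show "\<forall>i. \<bar>x $ i\<bar> \<le> b" using component_le_infnorm_cart order_trans by blast
next
  assume "\<forall>i. \<bar>x $ i\<bar> \<le> b"
  then show "infnorm x \<le> b" unfolding infnorm_cart by (intro cSup_least) auto
qed

text \<open>The infimum may be infinite, when there is at most one point, so a finite positive
  number strictly below it is taken.\<close>

lemma relatively_separatedD:
  assumes "relatively_separated U"
  obtains r where "0 < r" "\<And>u v. u \<in> U \<Longrightarrow> v \<in> U \<Longrightarrow> u \<noteq> v \<Longrightarrow> r \<le> infnorm (u - v)"
proof -
  define D where "D = (INF (u, u') \<in> {(u, u'). u \<in> U \<and> u' \<in> U \<and> u \<noteq> u'}. ennreal (infnorm (u - u')))"
  have "0 < D" using assms by (simp add: relatively_separated_def D_def)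
  then obtain e where e: "0 < e" "e < D" using dense by blast
  obtain r where r: "0 < ennreal r" "ennreal r < D"
  proof (cases e)
    case (real r)
    then show ?thesis using that e by simp
  qed (use e in auto)
  show thesis
  proof (rule that[of r])
    show "0 < r" using r(1) by simp
    fix u v assume "u \<in> U" "v \<in> U" "u \<noteq> v"
    then have "D \<le> ennreal (infnorm (u - v))" unfolding D_def by (intro INF_lower2[of "(u, v)"]) auto
    then have "ennreal r \<le> ennreal (infnorm (u - v))" using r(2) by simp
    then show "r \<le> infnorm (u - v)" by (simp add: ennreal_le_iff infnorm_pos_le)
  qed
qed

text \<open>Pigeonhole with cells of side r / 2: two points in one cell would be at distance at most
  r / 2 < r. The map \<phi> sends a point to the coordinates of its cell.\<close>

lemma card_separated_cube:
  fixes X :: "(real ^ 'n) set"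
  assumes r: "0 < r" and sep: "\<And>u v. u \<in> X \<Longrightarrow> v \<in> X \<Longrightarrow> u \<noteq> v \<Longrightarrow> r \<le> infnorm (u - v)"
    and L: "0 \<le> L" and X: "\<And>u i. u \<in> X \<Longrightarrow> c $ i \<le> u $ i \<and> u $ i \<le> c $ i + L"
  shows "finite X \<and> real (card X) \<le> (2 * L / r + 2) ^ CARD('n)"
proof -
  define N where "N = nat \<lfloor>2 * L / r\<rfloor>"
  define \<phi> where "\<phi> = (\<lambda>u::real ^ 'n. \<lambda>i. nat \<lfloor>(u $ i - c $ i) * 2 / r\<rfloor>)"
  have inj: "inj_on \<phi> X"
  proof (rule inj_onI, rule ccontr)
    fix u v assume uvec: "u \<in> X" "v \<in> X" "\<phi> u = \<phi> v" "u \<noteq> v"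
    have "\<bar>(u - v) $ i\<bar> \<le> r / 2" for i
    proof -
      have "nat \<lfloor>(u $ i - c $ i) * 2 / r\<rfloor> = nat \<lfloor>(v $ i - c $ i) * 2 / r\<rfloor>"
        using uvec(3) by (auto simp: \<phi>_def fun_eq_iff)
      moreover have "0 \<le> (u $ i - c $ i) * 2 / r" "0 \<le> (v $ i - c $ i) * 2 / r"
        using X[OF uvec(1), of i] X[OF uvec(2), of i] r by auto
      ultimately have "\<lfloor>(u $ i - c $ i) * 2 / r\<rfloor> = \<lfloor>(v $ i - c $ i) * 2 / r\<rfloor>"
        by (simp add: nat_eq_iff)
      then have "\<bar>(u $ i - c $ i) * 2 / r - (v $ i - c $ i) * 2 / r\<bar> \<le> 1" by linarith
      also have "(u $ i - c $ i) * 2 / r - (v $ i - c $ i) * 2 / r = (u - v) $ i * 2 / r"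
        by (simp add: diff_divide_distrib[symmetric] algebra_simps)
      finally have "(u - v) $ i * 2 / r \<le> 1" "- ((u - v) $ i * 2 / r) \<le> 1" by linarith+
      then have "(u - v) $ i * 2 \<le> r" "- ((u - v) $ i * 2) \<le> r" using r by (auto simp: field_simps)
      then show ?thesis by linarith
    qed
    then have "infnorm (u - v) \<le> r / 2" unfolding infnorm_le_iff_cart by blast
    then show False using sep[OF uvec(1,2,4)] r by simp
  qed
  have sub: "\<phi> ` X \<subseteq> (\<Pi>\<^sub>E i\<in>UNIV. {..N})"
  proof -
    have "\<phi> u i \<le> N" if "u \<in> X" for u i
      unfolding \<phi>_def N_def using X[OF that, of i] r
      by (intro nat_mono floor_mono) (simp add: divide_right_mono)
    then show ?thesis by auto
  qed
  have fin: "finite (\<Pi>\<^sub>E i\<in>(UNIV::'n set). {..N})" by (intro finite_PiE) auto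
  have fX: "finite X" using finite_imageD[OF finite_subset[OF sub fin] inj] .
  have "card X = card (\<phi> ` X)" using card_image[OF inj] by simp
  also have "... \<le> card (\<Pi>\<^sub>E i\<in>(UNIV::'n set). {..N})" by (rule card_mono[OF fin sub])
  also have "... = (N + 1) ^ CARD('n)" by (subst card_PiE) auto
  finally have "real (card X) \<le> real ((N + 1) ^ CARD('n))" by (rule of_nat_mono)
  also have "... = (real N + 1) ^ CARD('n)" by (simp add: add.commute)
  also have "... \<le> (2 * L / r + 2) ^ CARD('n)"
  proof (rule power_mono)
    have "0 \<le> 2 * L / r" using L r by simp
    then show "real N + 1 \<le> 2 * L / r + 2" unfolding N_def by linarith
  qed simp
  finally show ?thesis using fX by blast
qed

definition vfloor :: "real ^ 'n \<Rightarrow> real ^ 'n" where "vfloor x = (\<chi> i. of_int \<lfloor>x $ i\<rfloor>)"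

lemma vfloor_lattice: "vfloor x \<in> int_lattice" by (simp add: vfloor_def int_lattice_def)

lemma frac_unit_cube: "x - vfloor x \<in> unit_cube"
proof -
  have "0 \<le> x $ i - of_int \<lfloor>x $ i\<rfloor> \<and> x $ i - of_int \<lfloor>x $ i\<rfloor> \<le> 1" for i
    by linarith
  then show ?thesis by (simp add: mem_box_cart vfloor_def)
qed

lemma countable_int_lattice: "countable (int_lattice :: (real ^ 'n) set)"
proof -
  have "int_lattice \<subseteq> range (\<lambda>v :: 'n \<Rightarrow> int. (\<chi> i. of_int (v i)) :: real ^ 'n)"
  proof
    fix k :: "real ^ 'n" assume "k \<in> int_lattice"
    then have "\<forall>i. \<exists>z. k $ i = of_int z" by (auto simp: int_lattice_def elim: Ints_cases)
    then obtain z where "\<forall>i. k $ i = of_int (z i)" by metis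
    then have "k = (\<chi> i. of_int (z i))" by (simp add: vec_eq_iff)
    then show "k \<in> range (\<lambda>v :: 'n \<Rightarrow> int. (\<chi> i. of_int (v i)) :: real ^ 'n)" by blast
  qed
  then show ?thesis by (rule countable_subset) simp
qed

lemma vfloor_measurable: "vfloor \<in> measurable borel (count_space int_lattice)"
proof (subst measurable_count_space_eq_countable[OF countable_int_lattice], intro conjI ballI)
  show "vfloor \<in> space borel \<rightarrow> int_lattice" using vfloor_lattice by auto
  fix k :: "real ^ 'n" assume "k \<in> int_lattice"
  have "vfloor -` {k} \<inter> space borel = {x. \<forall>i. of_int \<lfloor>x $ i\<rfloor> = k $ i}"
    by (auto simp: vfloor_def vec_eq_iff)
  also have "... = (\<Inter>i. {x. of_int \<lfloor>x $ i\<rfloor> = k $ i})" by auto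
  also have "... \<in> sets borel"
  proof (rule sets.countable_INT)
    have m: "(\<lambda>x :: real ^ 'n. x $ i) \<in> borel_measurable borel" for i
      by (intro borel_measurable_continuous_onI continuous_intros)
    have "(\<lambda>x :: real ^ 'n. of_int \<lfloor>x $ i\<rfloor> :: real) \<in> borel_measurable borel" for i
      using measurable_compose[OF m borel_measurable_real_floor] .
    from measurable_sets[OF this, of "{k $ _}"]
    show "range (\<lambda>i. {x :: real ^ 'n. real_of_int \<lfloor>x $ i\<rfloor> = k $ i}) \<subseteq> sets borel"
      by (auto simp: vimage_def)
  qed auto
  finally show "vfloor -` {k} \<inter> space borel \<in> sets borel" .
qed

lemma emeasure_fl_vimage: "emeasure lborel (vfloor -` {k :: real ^ 'n}) \<le> 1"
proof -
  have "vfloor -` {k} \<subseteq> cbox k (k + 1)"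
  proof
    fix x assume "x \<in> vfloor -` {k}"
    then have "k = vfloor x" by simp
    have "of_int \<lfloor>x $ i\<rfloor> \<le> x $ i \<and> x $ i \<le> of_int \<lfloor>x $ i\<rfloor> + 1" for i by linarith
    then show "x \<in> cbox k (k + 1)" unfolding \<open>k = vfloor x\<close> by (simp add: mem_box_cart vfloor_def)
  qed
  then have "emeasure lborel (vfloor -` {k}) \<le> emeasure lborel (cbox k (k + 1))"
    by (rule emeasure_mono) simp
  also have "... = 1"
  proof -
    have "k \<in> cbox k (k + 1)" by (simp add: mem_box_cart)
    then have "cbox k (k + 1) \<noteq> {}" by blast
    then have "measure lborel (cbox k (k + 1)) = 1" by (simp add: content_cbox_cart)
    then show ?thesis by (subst emeasure_eq_ennreal_measure) (auto simp: emeasure_lborel_cbox_eq)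
  qed
  finally show ?thesis .
qed

text \<open>One lattice sum is to bound both integrals in x and sums over separated points. This is
  the integral half, resting on cells of measure at most 1.\<close>

lemma nn_integral_fl_le:
  fixes g :: "real ^ 'n \<Rightarrow> ennreal"
  shows "(\<integral>\<^sup>+x. g (vfloor x) \<partial>lborel) \<le> (\<integral>\<^sup>+k. g k \<partial>count_space int_lattice)"
proof -
  have ms: "vfloor -` {k} \<in> sets lborel" if "k \<in> int_lattice" for k :: "real ^ 'n"
    using measurable_sets[OF vfloor_measurable, of "{k}"] that by simp
  have "(\<integral>\<^sup>+x. g (vfloor x) \<partial>lborel) = (\<integral>\<^sup>+x. (\<integral>\<^sup>+k. g k * indicator (vfloor -` {k}) x \<partial>count_space int_lattice) \<partial>lborel)"
  proof (rule nn_integral_cong)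
    fix x :: "real ^ 'n"
    have "(\<integral>\<^sup>+k. g k * indicator (vfloor -` {k}) x \<partial>count_space int_lattice)
        = (\<integral>\<^sup>+k. g (vfloor x) * indicator {vfloor x} k \<partial>count_space int_lattice)"
      by (intro nn_integral_cong) (auto simp: indicator_def)
    also have "... = g (vfloor x)"
      using vfloor_lattice[of x] by (subst nn_integral_cmult) auto
    finally show "g (vfloor x) = (\<integral>\<^sup>+k. g k * indicator (vfloor -` {k}) x \<partial>count_space int_lattice)" ..
  qed
  also have "... = (\<integral>\<^sup>+k. (\<integral>\<^sup>+x. g k * indicator (vfloor -` {k}) x \<partial>lborel) \<partial>count_space int_lattice)"
    using ms by (intro nn_integral_count_space_nn_integral countable_int_lattice) auto
  also have "... = (\<integral>\<^sup>+k. g k * emeasure lborel (vfloor -` {k}) \<partial>count_space int_lattice)"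
    using ms by (intro nn_integral_cong nn_integral_cmult_indicator) auto
  also have "... \<le> (\<integral>\<^sup>+k. g k * 1 \<partial>count_space int_lattice)"
    by (intro nn_integral_mono mult_left_mono emeasure_fl_vimage) auto
  finally show ?thesis by simp
qed

lemma finite_sum_le_nn_integral:
  fixes g :: "'a \<Rightarrow> ennreal"
  assumes "finite X" "X \<subseteq> A" shows "sum g X \<le> (\<integral>\<^sup>+k. g k \<partial>count_space A)"
proof -
  have "sum g X = (\<integral>\<^sup>+k. g k * indicator X k \<partial>count_space UNIV)"
    using assms by (simp add: nn_integral_count_space_finite flip: nn_integral_count_space_indicator)
  also have "... \<le> (\<integral>\<^sup>+k. g k * indicator A k \<partial>count_space UNIV)"
    using assms by (intro nn_integral_mono) (auto simp: indicator_def)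
  finally show ?thesis by (simp add: nn_integral_count_space_indicator)
qed

text \<open>The discrete half: the measure of a cell is replaced by the number of separated points
  in a unit cube.\<close>

lemma sum_fl_le:
  fixes g :: "real ^ 'n \<Rightarrow> ennreal" and X :: "(real ^ 'n) set"
  assumes r: "0 < r" and sep: "\<And>u v. u \<in> X \<Longrightarrow> v \<in> X \<Longrightarrow> u \<noteq> v \<Longrightarrow> r \<le> infnorm (u - v)"
    and fin: "finite X"
  shows "(\<Sum>u\<in>X. g (vfloor (x - u))) \<le> ennreal ((2 / r + 2) ^ CARD('n)) * (\<integral>\<^sup>+k. g k \<partial>count_space int_lattice)"
proof -
  let ?f = "\<lambda>u. vfloor (x - u)"
  have "(\<Sum>u\<in>X. g (?f u)) = (\<Sum>k\<in>?f ` X. \<Sum>u\<in>{u \<in> X. ?f u = k}. g (?f u))"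
    by (rule sum.image_gen[OF fin])
  also have "... \<le> (\<Sum>k\<in>?f ` X. ennreal ((2 / r + 2) ^ CARD('n)) * g k)"
  proof (rule sum_mono)
    fix k assume "k \<in> ?f ` X"
    have "(\<Sum>u\<in>{u \<in> X. ?f u = k}. g (?f u)) = of_nat (card {u \<in> X. ?f u = k}) * g k" by simp
    also have "... = ennreal (real (card {u \<in> X. ?f u = k})) * g k"
      by (simp add: ennreal_of_nat_eq_real_of_nat)
    also have "... \<le> ennreal ((2 / r + 2) ^ CARD('n)) * g k"
    proof (intro mult_right_mono ennreal_leI)
      have "real (card {u \<in> X. ?f u = k}) \<le> (2 * 1 / r + 2) ^ CARD('n)"
      proof (rule card_separated_cube[OF r, THEN conjunct2])
        fix u i assume "u \<in> {u \<in> X. ?f u = k}"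
        then have "k = vfloor (x - u)" by simp
        have "of_int \<lfloor>x $ i - u $ i\<rfloor> \<le> x $ i - u $ i \<and> x $ i - u $ i \<le> of_int \<lfloor>x $ i - u $ i\<rfloor> + 1" by linarith
        \<comment> \<open>\<open>vfloor (x - u) = k\<close> places \<open>u\<close> in the unit cube
          with lower corner x - k - 1.\<close>
        then show "(x - k - 1) $ i \<le> u $ i \<and> u $ i \<le> (x - k - 1) $ i + 1"
          unfolding \<open>k = vfloor (x - u)\<close> vfloor_def by simp linarith
      qed (use sep in auto)
      then show "real (card {u \<in> X. ?f u = k}) \<le> (2 / r + 2) ^ CARD('n)" by simp
    qed simp
    finally show "(\<Sum>u\<in>{u \<in> X. ?f u = k}. g (?f u)) \<le> ennreal ((2 / r + 2) ^ CARD('n)) * g k" .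
  qed
  also have "... = ennreal ((2 / r + 2) ^ CARD('n)) * (\<Sum>k\<in>?f ` X. g k)"
    by (simp add: sum_distrib_left)
  also have "... \<le> ennreal ((2 / r + 2) ^ CARD('n)) * (\<integral>\<^sup>+k. g k \<partial>count_space int_lattice)"
    using fin vfloor_lattice by (intro mult_left_mono finite_sum_le_nn_integral) auto
  finally show ?thesis .
qed


section \<open>The square-root weight and its moments\<close>

definition wgt :: "real ^ 'n \<Rightarrow> real" where "wgt x = sqrt (infnorm x)"

lemma wgt_nonneg: "0 \<le> wgt x" by (simp add: wgt_def infnorm_pos_le)

lemma wgt_zero: "wgt 0 = 0" by (simp add: wgt_def infnorm_0)

lemma wgt_triangle: "wgt (x + y) \<le> wgt x + wgt y"
proof -
  have "wgt (x + y) \<le> sqrt (infnorm x + infnorm y)" unfolding wgt_def by (intro real_sqrt_le_mono infnorm_triangle)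
  also have "... \<le> wgt x + wgt y" unfolding wgt_def by (intro sqrt_add_le_add_sqrt infnorm_pos_le)
  finally show ?thesis .
qed

lemma wgt_diff_commute: "wgt (x - y) = wgt (y - x)" by (simp add: wgt_def infnorm_sub)

lemma wgt_le_one_unit_cube: "x \<in> unit_cube \<Longrightarrow> wgt x \<le> 1"
proof -
  assume "x \<in> unit_cube"
  then have "infnorm x \<le> 1" by (simp add: infnorm_le_iff_cart mem_box_cart)
  then show ?thesis by (simp add: wgt_def)
qed

lemma wgt_measurable: "wgt \<in> borel_measurable borel"
proof -
  have "continuous_on UNIV (wgt :: real ^ 'n \<Rightarrow> real)"
    unfolding wgt_def[abs_def]
    by (intro continuous_intros)
  then show ?thesis by (rule borel_measurable_continuous_onI)
qed

text \<open>For m > 1 the least N with m <= 2 ^ N has 2 ^ N / 2 < m and sqrt m <= sqrt 2 ^ N, so one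
  term of the sum is enough; the summand 1 covers m <= 1. The thresholds 2 ^ j / 2 are the
  half-sides of the cubes in the tail hypothesis.\<close>

lemma sqrt_dyadic_le:
  fixes m :: real
  assumes "0 \<le> m"
  shows "ennreal (sqrt m) \<le> 1 + (\<integral>\<^sup>+j. ennreal (sqrt 2 ^ j) * of_bool (2 ^ j / 2 < m) \<partial>count_space UNIV)"
proof (cases "m \<le> 1")
  case True
  then have "ennreal (sqrt m) \<le> ennreal 1" by (intro ennreal_leI) simp
  also have "... \<le> 1 + (\<integral>\<^sup>+j. ennreal (sqrt 2 ^ j) * of_bool (2 ^ j / 2 < m) \<partial>count_space UNIV)" by simp
  finally show ?thesis .
next
  case False
  obtain N :: nat where "m < 2 ^ N" using real_arch_pow[of 2 m] by auto
  then have ex: "\<exists>N::nat. m \<le> 2 ^ N" using less_imp_le by blast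
  define N where "N = (LEAST N::nat. m \<le> 2 ^ N)"
  have N: "m \<le> 2 ^ N" unfolding N_def by (rule LeastI_ex[OF ex])
  have "N \<noteq> 0" using N False by (intro notI) simp
  then obtain N' where N': "N = Suc N'" by (cases N) auto
  have "\<not> m \<le> 2 ^ N'" using not_less_Least[of N' "\<lambda>N. m \<le> 2 ^ N"] N' by (simp add: N_def)
  then have lt: "2 ^ N / 2 < m" by (simp add: N')
  have "sqrt m \<le> sqrt 2 ^ N" using N by (metis real_sqrt_le_iff real_sqrt_power)
  then have "ennreal (sqrt m) \<le> ennreal (sqrt 2 ^ N) * of_bool (2 ^ N / 2 < m)" using lt by (simp add: ennreal_leI)
  also have "... \<le> (\<integral>\<^sup>+j. ennreal (sqrt 2 ^ j) * of_bool (2 ^ j / 2 < m) \<partial>count_space UNIV)"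
    using finite_sum_le_nn_integral[of "{N}" UNIV "\<lambda>j. ennreal (sqrt 2 ^ j) * of_bool (2 ^ j / 2 < m)"]
    by (simp only: finite.intros subset_UNIV sum.insert sum.empty empty_iff not_False_eq_True add_0_right)
  also have "... \<le> 1 + \<dots>" by simp
  finally show ?thesis .
qed

text \<open>After interchanging lattice points and dyadic scales, scale j contributes sqrt 2 ^ j * C
  / 2 ^ j, a geometric series. An unrooted weight would give the same bound C at every
  scale.\<close>

lemma weighted_lattice_sum_finite:
  fixes \<Theta> :: "real ^ 'n \<Rightarrow> real"
  assumes am: "amalgam_norm \<Theta> < \<infinity>" and C: "0 \<le> C"
    and tail: "\<And>j::nat. (\<Sum>\<^sub>\<infinity>k\<in>int_lattice - centered_cube (2 ^ j). SUP x\<in>unit_cube. ennreal \<bar>\<Theta> (x - k)\<bar>) \<le> ennreal (C / 2 ^ j)"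
  shows "(\<integral>\<^sup>+k. (SUP x\<in>unit_cube. ennreal \<bar>\<Theta> (x + k)\<bar>) * ennreal (2 + wgt k) \<partial>count_space int_lattice) < \<infinity>"
proof -
  define a where "a = (\<lambda>k. SUP x\<in>unit_cube. ennreal \<bar>\<Theta> (x + k)\<bar>)"
  have cl: "countable (int_lattice :: (real ^ 'n) set)" by (rule countable_int_lattice)
  have A: "(\<integral>\<^sup>+k. a k \<partial>count_space int_lattice) < \<infinity>"
    using am by (simp add: amalgam_norm_def infsum_ennreal_eq_nn_integral[OF cl] a_def)
  have T: "(\<integral>\<^sup>+k. a k * of_bool (2 ^ j / 2 < infnorm k) \<partial>count_space int_lattice) \<le> ennreal (C / 2 ^ j)" for j :: nat
  proof -
    let ?S = "int_lattice - centered_cube (2 ^ j) :: (real ^ 'n) set"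
    \<comment> \<open>The amalgam norm uses translations by k, the tail hypothesis translations by
      -k; the lattice is symmetric.\<close>
    have bij: "bij_betw uminus (int_lattice :: (real ^ 'n) set) int_lattice"
      by (rule bij_betwI[of _ _ _ uminus]) (auto simp: int_lattice_def)
    have "(\<integral>\<^sup>+k. a k * of_bool (2 ^ j / 2 < infnorm k) \<partial>count_space int_lattice)
      = (\<integral>\<^sup>+k. a (- k) * of_bool (2 ^ j / 2 < infnorm (- k)) \<partial>count_space int_lattice)"
      by (rule nn_integral_bij_count_space[OF bij, symmetric])
    also have "... \<le> (\<integral>\<^sup>+k. a (- k) * indicator ?S k \<partial>count_space int_lattice)"
    proof (rule nn_integral_mono)
      fix k :: "real ^ 'n" assume k: "k \<in> space (count_space int_lattice)"
      have "k \<in> ?S" if "2 ^ j / 2 < infnorm (- k)"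
      proof -
        have "k \<notin> centered_cube (2 ^ j)"
        proof
          assume "k \<in> centered_cube (2 ^ j)"
          then have *: "- (2 ^ j) / 2 \<le> k $ i \<and> k $ i \<le> 2 ^ j / 2" for i
            by (simp add: centered_cube_def mem_box_cart)
          have "\<bar>k $ i\<bar> \<le> 2 ^ j / 2" for i using *[of i] unfolding abs_le_iff by linarith
          then have "infnorm k \<le> 2 ^ j / 2" unfolding infnorm_le_iff_cart by blast
          then show False using that by (simp add: infnorm_neg)
        qed
        then show ?thesis using k by simp
      qed
      then show "a (- k) * of_bool (2 ^ j / 2 < infnorm (- k)) \<le> a (- k) * indicator ?S k"
        by (intro mult_left_mono) (auto simp: indicator_def)
    qed
    also have "... = (\<integral>\<^sup>+k. a (- k) \<partial>count_space ?S)"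
      by (subst (1 2) nn_integral_count_space_indicator) (auto intro!: nn_integral_cong simp: indicator_def)
    also have "... = (\<Sum>\<^sub>\<infinity>k\<in>?S. SUP x\<in>unit_cube. ennreal \<bar>\<Theta> (x - k)\<bar>)"
      using countable_subset[OF _ cl, of ?S] by (subst infsum_ennreal_eq_nn_integral) (auto simp: a_def)
    also have "... \<le> ennreal (C / 2 ^ j)" by (rule tail)
    finally show ?thesis .
  qed
  have "(\<integral>\<^sup>+k. a k * ennreal (2 + wgt k) \<partial>count_space int_lattice)
     \<le> (\<integral>\<^sup>+k. 3 * a k + (\<integral>\<^sup>+j. ennreal (sqrt 2 ^ j) * (a k * of_bool (2 ^ j / 2 < infnorm k)) \<partial>count_space UNIV) \<partial>count_space int_lattice)"
  proof (rule nn_integral_mono)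
    fix k :: "real ^ 'n"
    have "a k * ennreal (2 + wgt k) = a k * (2 + ennreal (sqrt (infnorm k)))"
      by (simp add: wgt_def infnorm_pos_le ennreal_plus[symmetric] del: ennreal_plus flip: ennreal_numeral)
    also have "... \<le> a k * (2 + (1 + (\<integral>\<^sup>+j. ennreal (sqrt 2 ^ j) * of_bool (2 ^ j / 2 < infnorm k) \<partial>count_space UNIV)))"
      by (intro mult_left_mono add_left_mono sqrt_dyadic_le infnorm_pos_le) auto
    also have "... = 3 * a k + a k * (\<integral>\<^sup>+j. ennreal (sqrt 2 ^ j) * of_bool (2 ^ j / 2 < infnorm k) \<partial>count_space UNIV)"
      by (simp add: distrib_left add.assoc[symmetric] mult.commute)
    also have "a k * (\<integral>\<^sup>+j. ennreal (sqrt 2 ^ j) * of_bool (2 ^ j / 2 < infnorm k) \<partial>count_space UNIV)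
        = (\<integral>\<^sup>+j. ennreal (sqrt 2 ^ j) * (a k * of_bool (2 ^ j / 2 < infnorm k)) \<partial>count_space UNIV)"
      by (subst nn_integral_cmult[symmetric]) (auto simp: mult_ac)
    finally show "a k * ennreal (2 + wgt k) \<le> 3 * a k + (\<integral>\<^sup>+j. ennreal (sqrt 2 ^ j) * (a k * of_bool (2 ^ j / 2 < infnorm k)) \<partial>count_space UNIV)" .
  qed
  also have "... = 3 * (\<integral>\<^sup>+k. a k \<partial>count_space int_lattice) +
     (\<integral>\<^sup>+k. (\<integral>\<^sup>+j. ennreal (sqrt 2 ^ j) * (a k * of_bool (2 ^ j / 2 < infnorm k)) \<partial>count_space UNIV) \<partial>count_space int_lattice)"
    by (simp add: nn_integral_add nn_integral_cmult)
  also have "(\<integral>\<^sup>+k. (\<integral>\<^sup>+j. ennreal (sqrt 2 ^ j) * (a k * of_bool (2 ^ j / 2 < infnorm k)) \<partial>count_space UNIV) \<partial>count_space int_lattice)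
    = (\<integral>\<^sup>+j. (\<integral>\<^sup>+k. ennreal (sqrt 2 ^ j) * (a k * of_bool (2 ^ j / 2 < infnorm k)) \<partial>count_space int_lattice) \<partial>count_space UNIV)"
    by (rule nn_integral_count_space_nn_integral) auto
  also have "... \<le> (\<integral>\<^sup>+j. ennreal (C * (sqrt 2 / 2) ^ j) \<partial>count_space UNIV)"
  proof (rule nn_integral_mono)
    fix j :: nat
    have "(\<integral>\<^sup>+k. ennreal (sqrt 2 ^ j) * (a k * of_bool (2 ^ j / 2 < infnorm k)) \<partial>count_space int_lattice)
      = ennreal (sqrt 2 ^ j) * (\<integral>\<^sup>+k. a k * of_bool (2 ^ j / 2 < infnorm k) \<partial>count_space int_lattice)"
      by (rule nn_integral_cmult) auto
    also have "... \<le> ennreal (sqrt 2 ^ j) * ennreal (C / 2 ^ j)" by (intro mult_left_mono T) auto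
    also have "... = ennreal (C * (sqrt 2 / 2) ^ j)" using C by (simp add: power_divide flip: ennreal_mult)
    finally show "(\<integral>\<^sup>+k. ennreal (sqrt 2 ^ j) * (a k * of_bool (2 ^ j / 2 < infnorm k)) \<partial>count_space int_lattice)
      \<le> ennreal (C * (sqrt 2 / 2) ^ j)" .
  qed
  also have "3 * (\<integral>\<^sup>+k. a k \<partial>count_space int_lattice) + (\<integral>\<^sup>+j. ennreal (C * (sqrt 2 / 2) ^ j) \<partial>count_space UNIV) < \<infinity>"
  proof -
    have "sqrt 2 / 2 < 1" using real_sqrt_less_mono[of 2 4] by simp
    then have sm: "summable (\<lambda>j. C * (sqrt 2 / 2) ^ j)" by (intro summable_mult summable_geometric) simp
    have "(\<integral>\<^sup>+j. ennreal (C * (sqrt 2 / 2) ^ j) \<partial>count_space UNIV) = (\<Sum>j. ennreal (C * (sqrt 2 / 2) ^ j))"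
      by (rule nn_integral_count_space_nat)
    also have "... = ennreal (\<Sum>j. C * (sqrt 2 / 2) ^ j)"
      using sm C by (intro suminf_ennreal2) auto
    also have "... < \<infinity>" by simp
    finally have "(\<integral>\<^sup>+j. ennreal (C * (sqrt 2 / 2) ^ j) \<partial>count_space UNIV) < \<infinity>" .
    then show ?thesis using A by (simp add: ennreal_mult_less_top)
  qed
  finally show ?thesis unfolding a_def by simp
qed

text \<open>Replacing \<Theta> by its suprema over lattice cells yields a Borel function, while
  \<Theta> is merely Lebesgue measurable, and one that can be summed over individual points. The
  weight varies by at most 1 over a cell, hence the passage from \<open>1 + wgt x\<close> to
  \<open>2 + wgt k\<close>.\<close>

lemma envelope_exists:
  fixes \<Theta> :: "real ^ 'n \<Rightarrow> real"
  assumes fin: "(\<integral>\<^sup>+k. (SUP x\<in>unit_cube. ennreal \<bar>\<Theta> (x + k)\<bar>) * ennreal (2 + wgt k) \<partial>count_space int_lattice) < \<infinity>"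
  obtains t :: "real ^ 'n \<Rightarrow> real" and B :: real
  where "t \<in> borel_measurable borel" "\<And>x. 0 \<le> t x" "\<And>x. \<bar>\<Theta> x\<bar> \<le> t x" "0 < B"
    "(\<integral>\<^sup>+x. ennreal (t x * (1 + wgt x)) \<partial>lborel) \<le> ennreal B"
    "\<And>r X x. 0 < r \<Longrightarrow> finite X \<Longrightarrow> (\<And>u v. u \<in> X \<Longrightarrow> v \<in> X \<Longrightarrow> u \<noteq> v \<Longrightarrow> r \<le> infnorm (u - v)) \<Longrightarrow>
       (\<Sum>u\<in>X. t (x - u) * (1 + wgt (x - u))) \<le> (2 / r + 2) ^ CARD('n) * B"
proof -
  define a where "a = (\<lambda>k. SUP x\<in>unit_cube. ennreal \<bar>\<Theta> (x + k)\<bar>)"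
  define I where "I = (\<integral>\<^sup>+k. a k * ennreal (2 + wgt k) \<partial>count_space (int_lattice :: (real ^ 'n) set))"
  have I: "I < \<infinity>" using fin by (simp add: I_def a_def)
  \<comment> \<open>Needed before \<open>enn2real\<close>, which would send an infinite supremum to
    0 and lose the domination of \<Theta>.\<close>
  have afin: "a k < \<infinity>" if "k \<in> int_lattice" for k
  proof -
    have "a k * 1 \<le> a k * ennreal (2 + wgt k)"
      using wgt_nonneg[of k] ennreal_leI[of 1 "2 + wgt k"] by (intro mult_left_mono) auto
    also have "... \<le> I" unfolding I_def using finite_sum_le_nn_integral[of "{k}" int_lattice "\<lambda>k. a k * ennreal (2 + wgt k)"] that by simp
    finally show ?thesis using I by simp
  qed
  define t where "t = (\<lambda>x. enn2real (a (vfloor x)))"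
  define g where "g = (\<lambda>k. a k * ennreal (2 + wgt k))"
  have te: "ennreal (t x) = a (vfloor x)" for x unfolding t_def using afin[OF vfloor_lattice] by simp
  have tg: "ennreal (t x * (1 + wgt x)) \<le> g (vfloor x)" for x
  proof -
    have "wgt x \<le> wgt (vfloor x) + wgt (x - vfloor x)" using wgt_triangle[of "vfloor x" "x - vfloor x"] by simp
    also have "wgt (x - vfloor x) \<le> 1" by (rule wgt_le_one_unit_cube[OF frac_unit_cube])
    finally have "t x * (1 + wgt x) \<le> t x * (2 + wgt (vfloor x))" by (intro mult_left_mono) (auto simp: t_def)
    then have "ennreal (t x * (1 + wgt x)) \<le> ennreal (t x * (2 + wgt (vfloor x)))" by (rule ennreal_leI)
    also have "... = ennreal (t x) * ennreal (2 + wgt (vfloor x))"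
      using wgt_nonneg[of "vfloor x"] by (intro ennreal_mult) (auto simp: t_def)
    finally have "ennreal (t x * (1 + wgt x)) \<le> ennreal (t x) * ennreal (2 + wgt (vfloor x))" .
    then show ?thesis by (simp add: te g_def)
  qed
  define B where "B = enn2real I + 1"
  have IB: "I \<le> ennreal B" using I by (simp add: B_def)
  have B0: "0 < B" by (simp add: B_def add_nonneg_pos)
  show thesis
  proof (rule that[of t B])
    have "(\<lambda>x. enn2real (a (vfloor x))) \<in> borel_measurable borel"
      by (rule measurable_compose[OF vfloor_measurable]) simp
    then show "t \<in> borel_measurable borel" by (simp add: t_def)
    show "0 \<le> t x" for x by (simp add: t_def)
    show "\<bar>\<Theta> x\<bar> \<le> t x" for x
    proof -
      have "ennreal \<bar>\<Theta> ((x - vfloor x) + vfloor x)\<bar> \<le> a (vfloor x)"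
        unfolding a_def by (rule SUP_upper[OF frac_unit_cube])
      then have "ennreal \<bar>\<Theta> x\<bar> \<le> ennreal (t x)" by (simp add: te)
      then show ?thesis by (simp add: t_def)
    qed
    show "0 < B" by (rule B0)
    have "(\<integral>\<^sup>+x. ennreal (t x * (1 + wgt x)) \<partial>lborel) \<le> (\<integral>\<^sup>+x. g (vfloor x) \<partial>lborel)"
      by (intro nn_integral_mono tg)
    also have "... \<le> I" unfolding I_def using nn_integral_fl_le[of g] by (simp add: g_def)
    also note IB
    finally show "(\<integral>\<^sup>+x. ennreal (t x * (1 + wgt x)) \<partial>lborel) \<le> ennreal B" .
    fix r :: real and X :: "(real ^ 'n) set" and x :: "real ^ 'n"
    assume X: "0 < r" "finite X" "\<And>u v. u \<in> X \<Longrightarrow> v \<in> X \<Longrightarrow> u \<noteq> v \<Longrightarrow> r \<le> infnorm (u - v)"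
    have "ennreal (\<Sum>u\<in>X. t (x - u) * (1 + wgt (x - u))) = (\<Sum>u\<in>X. ennreal (t (x - u) * (1 + wgt (x - u))))"
      by (rule sum_ennreal[symmetric]) (simp add: t_def wgt_nonneg)
    also have "... \<le> (\<Sum>u\<in>X. g (vfloor (x - u)))" by (intro sum_mono tg)
    also have "... \<le> ennreal ((2 / r + 2) ^ CARD('n)) * (\<integral>\<^sup>+k. g k \<partial>count_space int_lattice)"
      by (rule sum_fl_le[OF X(1) X(3) X(2)])
    also have "... \<le> ennreal ((2 / r + 2) ^ CARD('n)) * ennreal B"
      using IB unfolding I_def g_def by (intro mult_left_mono) auto
    also have "... = ennreal ((2 / r + 2) ^ CARD('n) * B)" using B0 X(1) by (simp add: ennreal_mult)
    finally show "(\<Sum>u\<in>X. t (x - u) * (1 + wgt (x - u))) \<le> (2 / r + 2) ^ CARD('n) * B"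
      using B0 X(1) by (subst (asm) ennreal_le_iff) auto
  qed
qed

section \<open>The Gram matrix of a localized frame\<close>

text \<open>The frame inequalities are used for finite combinations; dominated convergence extends
  their matrix form to summable coefficients.\<close>

lemma l1_ip_truncate:
  fixes c :: "'i::countable \<Rightarrow> real"
  assumes "sym_rmat a" "l1 c"
  shows "(\<lambda>m. l1_ip (act a (\<lambda>i. if to_nat i \<le> m then c i else 0)) (\<lambda>i. if to_nat i \<le> m then c i else 0)) \<longlonglongrightarrow> l1_ip (act a c) c"
proof -
  define cm where "cm = (\<lambda>m i. if to_nat i \<le> m then c i else 0 :: real)"
  obtain B where B: "row_bound (ent a) B" by (rule row_bound_ent_obtain)
  have B0: "0 \<le> B" by (rule row_bound_nonneg[OF B])
  have cm_le: "\<bar>cm m i\<bar> \<le> \<bar>c i\<bar>" for m i by (simp add: cm_def)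
  have ev: "eventually (\<lambda>m. cm m i = c i) sequentially" for i
    using eventually_ge_at_top[of "to_nat i"] by eventually_elim (simp add: cm_def)
  have cm_lim: "(\<lambda>m. cm m i) \<longlonglongrightarrow> c i" for i by (rule tendsto_eventually[OF ev])
  have act_lim: "(\<lambda>m. act a (cm m) i) \<longlonglongrightarrow> act a c i" for i
    unfolding act_def
  proof (rule integral_dominated_convergence[where w = "\<lambda>j. \<bar>ent a i j * c j\<bar>"])
    show "l1 (\<lambda>j. \<bar>ent a i j * c j\<bar>)" using l1_ent_mult[OF assms(2)] by (rule integrable_abs)
    show "AE j in cs. (\<lambda>m. ent a i j * cm m j) \<longlonglongrightarrow> ent a i j * c j"
      by (intro AE_I2 tendsto_intros cm_lim)
    show "AE j in cs. norm (ent a i j * cm m j) \<le> \<bar>ent a i j * c j\<bar>" for m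
      using cm_le by (intro AE_I2) (simp add: abs_mult mult_left_mono)
  qed auto
  define M where "M = B * (LINT i|cs. \<bar>c i\<bar>)"
  have act_le: "\<bar>act a (cm m) i\<bar> \<le> M" for m i
  proof -
    have "ennreal \<bar>act a (cm m) i\<bar> \<le> nn_abs cs (\<lambda>j. ent a i j * cm m j)"
      unfolding act_def by (rule abs_lint_le)
    also have "... \<le> (\<integral>\<^sup>+j. ennreal B * ennreal \<bar>c j\<bar> \<partial>cs)"
      using row_bound_entry[OF B] cm_le B0
      by (intro nn_integral_mono) (auto simp: abs_mult simp flip: ennreal_mult intro!: ennreal_leI mult_mono)
    also have "... = ennreal B * ennreal (LINT i|cs. \<bar>c i\<bar>)"
      by (simp add: nn_integral_cmult nn_l1[OF assms(2)])
    also have "... = ennreal M" using B0 by (simp add: M_def ennreal_mult')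
    finally show ?thesis using B0 by (simp add: M_def)
  qed
  have "(\<lambda>m. l1_ip (act a (cm m)) (cm m)) \<longlonglongrightarrow> l1_ip (act a c) c"
    unfolding l1_ip_def
  proof (rule integral_dominated_convergence[where w = "\<lambda>i. M * \<bar>c i\<bar>"])
    show "l1 (\<lambda>i. M * \<bar>c i\<bar>)" using assms(2) by simp
    show "AE i in cs. (\<lambda>m. act a (cm m) i * cm m i) \<longlonglongrightarrow> act a c i * c i"
      by (intro AE_I2 tendsto_intros cm_lim act_lim)
    have "0 \<le> M" using act_le[of 0 undefined] by linarith
    then show "AE i in cs. norm (act a (cm m) i * cm m i) \<le> M * \<bar>c i\<bar>" for m
      using cm_le act_le by (intro AE_I2) (auto simp: abs_mult intro!: mult_mono)
  qed auto
  then show ?thesis by (simp add: cm_def)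
qed

lemma finite_truncate: "finite {i :: 'i::countable. (if to_nat i \<le> m then c i else 0) \<noteq> (0::real)}"
proof (rule finite_subset)
  show "{i. (if to_nat i \<le> m then c i else 0) \<noteq> 0} \<subseteq> {i :: 'i. to_nat i \<le> m}" by auto
  have "to_nat ` {i :: 'i. to_nat i \<le> m} \<subseteq> {..m}" by auto
  then show "finite {i :: 'i. to_nat i \<le> m}"
    by (meson finite_atMost finite_imageD finite_subset inj_on_subset inj_to_nat subset_UNIV)
qed

lemma l1_finite_support:
  fixes c :: "'i \<Rightarrow> real"
  assumes "finite {i. c i \<noteq> 0}" shows "l1 c"
proof -
  have "nn_abs cs c = (\<integral>\<^sup>+i. ennreal \<bar>c i\<bar> * indicator {i. c i \<noteq> 0} i \<partial>cs)"
    by (intro nn_integral_cong) (auto simp: indicator_def)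
  also have "... = (\<integral>\<^sup>+i. ennreal \<bar>c i\<bar> \<partial>count_space {i. c i \<noteq> 0})"
    by (simp add: nn_integral_count_space_indicator)
  also have "... = ennreal (\<Sum>i | c i \<noteq> 0. \<bar>c i\<bar>)"
    by (simp add: nn_integral_count_space_finite[OF assms] sum_ennreal)
  finally show ?thesis using integrable_csI by (metis order_refl)
qed

text \<open>Envelopes \<open>e\<close> replace the generators in all size estimates. The factor
  \<open>1 + wgt\<close> lets \<open>rows\<close> and \<open>cols\<close> act both as plain Schur
  bounds and as weighted ones. Indices outside \<open>I\<close> carry the zero function.\<close>

locale localized_frame = weighted_index \<omega> I K n
  for \<omega> :: "'i::countable \<Rightarrow> 'i \<Rightarrow> real" and I K n +
  fixes \<Phi> :: "'i \<Rightarrow> real ^ 'n \<Rightarrow> real" and pos :: "'i \<Rightarrow> real ^ 'n"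
    and e :: "'i \<Rightarrow> real ^ 'n \<Rightarrow> real" and \<kappa> A B :: real
  assumes \<omega>_def: "\<omega> i j = wgt (pos i - pos j)"
    and meas: "\<Phi> i \<in> borel_measurable borel" and e_meas: "e i \<in> borel_measurable borel"
    and dom: "\<bar>\<Phi> i x\<bar> \<le> e i x" and supp: "i \<notin> I \<Longrightarrow> \<Phi> i x = 0"
    and rows: "(\<integral>\<^sup>+i. ennreal (e i x * (1 + wgt (x - pos i))) \<partial>cs) \<le> ennreal \<kappa>"
    and cols: "(\<integral>\<^sup>+x. ennreal (e i x * (1 + wgt (x - pos i))) \<partial>lborel) \<le> ennreal \<kappa>"
    and \<kappa>: "0 < \<kappa>" and A_pos: "0 < A" and A_le_B: "A \<le> B"
    and frame: "finite {i. c i \<noteq> 0} \<Longrightarrow>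
        A * (LINT x|lborel. (LINT i|cs. c i * \<Phi> i x)\<^sup>2)
          \<le> (LINT i|cs. (LINT x|lborel. (LINT j|cs. c j * \<Phi> j x) * \<Phi> i x)\<^sup>2) \<and>
        (LINT i|cs. (LINT x|lborel. (LINT j|cs. c j * \<Phi> j x) * \<Phi> i x)\<^sup>2)
          \<le> B * (LINT x|lborel. (LINT i|cs. c i * \<Phi> i x)\<^sup>2)"
begin

lemma B_pos: "0 < B" using A_pos A_le_B by simp

lemma e_nonneg: "0 \<le> e i x" using dom[of i x] by linarith

lemma e_le: "e i x \<le> e i x * (1 + wgt (x - pos i))"
  using mult_left_mono[of 1 "1 + wgt (x - pos i)" "e i x"] e_nonneg[of i x] wgt_nonneg[of "x - pos i"] by simp

text \<open>The synthesis operator. Dually, \<open>act G c\<close> is the sequence of inner products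
  of \<open>D c\<close> with the frame, divided by \<open>B\<close>.\<close>

definition D :: "('i \<Rightarrow> real) \<Rightarrow> real ^ 'n \<Rightarrow> real" where "D c x = (LINT i|cs. c i * \<Phi> i x)"

lemma rows_\<Phi>: "row_bound (\<lambda>x i. \<Phi> i x) \<kappa>"
  unfolding row_bound_def
proof (intro conjI allI)
  fix x
  have "nn_abs cs (\<lambda>i. \<Phi> i x) \<le> (\<integral>\<^sup>+i. ennreal (e i x * (1 + wgt (x - pos i))) \<partial>cs)"
    using dom e_le by (intro nn_integral_mono ennreal_leI) (meson order_trans)
  also note rows
  finally show "nn_abs cs (\<lambda>i. \<Phi> i x) \<le> ennreal \<kappa>" .
qed (use \<kappa> in simp)

lemma cols_\<Phi>: "nn_abs lborel (\<Phi> i) \<le> ennreal \<kappa>"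
proof -
  have "nn_abs lborel (\<Phi> i) \<le> (\<integral>\<^sup>+x. ennreal (e i x * (1 + wgt (x - pos i))) \<partial>lborel)"
    using dom e_le by (intro nn_integral_mono ennreal_leI) (meson order_trans)
  also note cols
  finally show ?thesis .
qed

lemma \<Phi>_le: "\<bar>\<Phi> i x\<bar> \<le> \<kappa>" using row_bound_entry[OF rows_\<Phi>] .

lemma \<Phi>_meas [measurable]: "\<Phi> i \<in> borel_measurable lborel" using meas by simp

lemma integrable_\<Phi>: "integrable lborel (\<Phi> i)"
proof (rule integrableI_bounded)
  show "(\<integral>\<^sup>+ x. ennreal (norm (\<Phi> i x)) \<partial>lborel) < \<infinity>"
    using le_less_trans[OF cols_\<Phi>[of i] ennreal_less_top] by simp
qed measurable

lemma \<Phi>_pair: "(\<lambda>(i, x). \<Phi> i x) \<in> borel_measurable (cs \<Otimes>\<^sub>M lborel)"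
  by (rule measurable_pair_measure_countable1) auto

lemma \<Phi>_pair': "(\<lambda>(x, i). \<Phi> i x) \<in> borel_measurable (lborel \<Otimes>\<^sub>M cs)"
  using measurable_pair_swap[OF \<Phi>_pair] by (simp add: case_prod_unfold)

lemma integrable_bounded_mult:
  fixes f h :: "real ^ 'n \<Rightarrow> real"
  assumes "integrable lborel f" "h \<in> borel_measurable lborel" "\<And>x. \<bar>h x\<bar> \<le> H"
  shows "integrable lborel (\<lambda>x. f x * h x)"
proof (rule Bochner_Integration.integrable_bound)
  show "integrable lborel (\<lambda>x. H * f x)" using assms(1) by simp
  show "(\<lambda>x. f x * h x) \<in> borel_measurable lborel" using assms(1,2) by measurable
  have "\<bar>f x\<bar> * \<bar>h x\<bar> \<le> \<bar>H\<bar> * \<bar>f x\<bar>" for x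
    using mult_left_mono[of "\<bar>h x\<bar>" "\<bar>H\<bar>" "\<bar>f x\<bar>"] assms(3)[of x] by (simp add: mult.commute)
  then show "AE x in lborel. norm (f x * h x) \<le> norm (H * f x)" by (auto simp: abs_mult)
qed

lemma D_integrable_row: "l1 c \<Longrightarrow> l1 (\<lambda>i. c i * \<Phi> i x)"
  using l1_mult_bounded[of c "\<lambda>i. \<Phi> i x" \<kappa>] \<Phi>_le by blast

lemma D_le:
  assumes "l1 c" shows "\<bar>D c x\<bar> \<le> \<kappa> * (LINT i|cs. \<bar>c i\<bar>)"
proof -
  have "ennreal \<bar>D c x\<bar> \<le> nn_abs cs (\<lambda>i. c i * \<Phi> i x)" unfolding D_def by (rule abs_lint_le)
  also have "... \<le> (\<integral>\<^sup>+i. ennreal \<kappa> * ennreal \<bar>c i\<bar> \<partial>cs)"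
  proof (rule nn_integral_mono)
    fix i
    have "\<bar>c i\<bar> * \<bar>\<Phi> i x\<bar> \<le> \<bar>c i\<bar> * \<kappa>" by (intro mult_left_mono \<Phi>_le) simp
    then show "ennreal \<bar>c i * \<Phi> i x\<bar> \<le> ennreal \<kappa> * ennreal \<bar>c i\<bar>"
      using \<kappa> by (simp add: abs_mult mult.commute ennreal_leI flip: ennreal_mult)
  qed
  also have "... = ennreal \<kappa> * ennreal (LINT i|cs. \<bar>c i\<bar>)" by (simp add: nn_integral_cmult nn_l1[OF assms])
  also have "... = ennreal (\<kappa> * (LINT i|cs. \<bar>c i\<bar>))" using \<kappa> by (simp add: ennreal_mult')
  finally show ?thesis using \<kappa> by simp
qed

lemma D_meas [measurable]: "D c \<in> borel_measurable lborel"
proof -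
  interpret sigma_finite_measure "cs :: 'i measure" by (rule sigma_finite_measure_count_space)
  have "(\<lambda>(x, i). c i * \<Phi> i x) \<in> borel_measurable (lborel \<Otimes>\<^sub>M cs)"
    using \<Phi>_pair' by (simp add: case_prod_unfold)
  from borel_measurable_lebesgue_integral[OF this] show ?thesis unfolding D_def[abs_def] by simp
qed

lemma fubini_integrable:
  assumes c: "l1 c" and h: "h \<in> borel_measurable lborel" "\<And>x. \<bar>h x\<bar> \<le> H"
  shows "integrable (cs \<Otimes>\<^sub>M lborel) (\<lambda>(i, x). c i * \<Phi> i x * h x)"
proof (rule integrableI_bounded)
  interpret pair_sigma_finite "cs :: 'i measure" "lborel :: (real ^ 'n) measure"
    by (intro pair_sigma_finite.intro sigma_finite_measure_count_space lborel.sigma_finite_measure_axioms)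
  show m: "(\<lambda>(i, x). c i * \<Phi> i x * h x) \<in> borel_measurable (cs \<Otimes>\<^sub>M lborel)"
    using h(1) by (intro measurable_pair_measure_countable1) auto
  have H: "0 \<le> H" using h(2)[of undefined] by linarith
  have "(\<integral>\<^sup>+ z. ennreal (norm (case z of (i, x) \<Rightarrow> c i * \<Phi> i x * h x)) \<partial>(cs \<Otimes>\<^sub>M lborel))
     = (\<integral>\<^sup>+i. (nn_abs lborel (\<lambda>x. c i * \<Phi> i x * h x)) \<partial>cs)"
    using m by (subst lborel.nn_integral_fst[symmetric]) auto
  also have "... \<le> (\<integral>\<^sup>+i. (\<integral>\<^sup>+x. ennreal (\<bar>c i\<bar> * H) * ennreal \<bar>\<Phi> i x\<bar> \<partial>lborel) \<partial>cs)"
  proof (intro nn_integral_mono)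
    fix i x
    have "\<bar>c i\<bar> * \<bar>\<Phi> i x\<bar> * \<bar>h x\<bar> \<le> \<bar>c i\<bar> * \<bar>\<Phi> i x\<bar> * H" using h(2) by (intro mult_left_mono) auto
    then show "ennreal \<bar>c i * \<Phi> i x * h x\<bar> \<le> ennreal (\<bar>c i\<bar> * H) * ennreal \<bar>\<Phi> i x\<bar>"
      using H by (simp add: abs_mult mult_ac ennreal_leI flip: ennreal_mult)
  qed
  also have "... = (\<integral>\<^sup>+i. ennreal (\<bar>c i\<bar> * H) * nn_abs lborel (\<Phi> i) \<partial>cs)"
    by (intro nn_integral_cong nn_integral_cmult) measurable
  also have "... \<le> (\<integral>\<^sup>+i. ennreal (\<bar>c i\<bar> * H) * ennreal \<kappa> \<partial>cs)"
    by (intro nn_integral_mono mult_left_mono cols_\<Phi>) auto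
  also have "... = (\<integral>\<^sup>+i. ennreal (H * \<kappa>) * ennreal \<bar>c i\<bar> \<partial>cs)"
    using H \<kappa> by (intro nn_integral_cong) (simp add: mult_ac flip: ennreal_mult)
  also have "... = ennreal (H * \<kappa>) * ennreal (LINT i|cs. \<bar>c i\<bar>)"
    by (simp add: nn_integral_cmult nn_l1[OF c])
  also have "... < \<infinity>" by (simp add: ennreal_mult_less_top)
  finally show "(\<integral>\<^sup>+ z. ennreal (norm (case z of (i, x) \<Rightarrow> c i * \<Phi> i x * h x)) \<partial>(cs \<Otimes>\<^sub>M lborel)) < \<infinity>" .
qed

text \<open>Applied with a frame function for \<open>h\<close> this computes \<open>act G c\<close>;
  applied with \<open>D c\<close> itself it computes the quadratic form of \<open>G\<close>.\<close>

lemma D_fubini: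
  assumes c: "l1 c" and h: "h \<in> borel_measurable lborel" "\<And>x. \<bar>h x\<bar> \<le> H"
  shows "integrable lborel (\<lambda>x. D c x * h x)" "(LINT x|lborel. D c x * h x) = (LINT i|cs. c i * (LINT x|lborel. \<Phi> i x * h x))"
proof -
  interpret pair_sigma_finite "cs :: 'i measure" "lborel :: (real ^ 'n) measure"
    by (intro pair_sigma_finite.intro sigma_finite_measure_count_space lborel.sigma_finite_measure_axioms)
  note int = fubini_integrable[OF c h]
  have e: "(LINT i|cs. c i * \<Phi> i x * h x) = D c x * h x" for x unfolding D_def by simp
  show "integrable lborel (\<lambda>x. D c x * h x)" using integrable_snd[OF int] unfolding e .
  have "(LINT x|lborel. (LINT i|cs. c i * \<Phi> i x * h x)) = (LINT i|cs. (LINT x|lborel. c i * \<Phi> i x * h x))"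
    using Fubini_integral[OF int] .
  then show "(LINT x|lborel. D c x * h x) = (LINT i|cs. c i * (LINT x|lborel. \<Phi> i x * h x))"
    unfolding e by (simp add: mult.assoc)
qed

section \<open>The Gram matrix and its weighted rows\<close>

definition gram :: "'i \<Rightarrow> 'i \<Rightarrow> real" where
  "gram i j = (LINT x|lborel. \<Phi> j x * \<Phi> i x) / B"

text \<open>Through every intermediate point x, 1 + \<omega> i j is at most the product of the
  factors \<open>1 + wgt\<close> belonging to i and j. The weight is thus shared by the two
  envelopes; the sum over j uses \<open>rows\<close>, the integral over x uses
  \<open>cols\<close>.\<close>

lemma gram_weighted: "row_bound (\<lambda>i j. gram i j * (1 + \<omega> i j)) (\<kappa> * \<kappa> / B)"
  unfolding row_bound_def
proof (intro conjI allI)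
  show "0 \<le> \<kappa> * \<kappa> / B" using \<kappa> B_pos by simp
  fix i
  let ?E = "\<lambda>i x. e i x * (1 + wgt (x - pos i))"
  have Em [measurable]: "?E j \<in> borel_measurable lborel" for j
  proof -
    have "(\<lambda>x. wgt (x - pos j)) \<in> borel_measurable borel"
      by (rule measurable_compose[OF _ wgt_measurable]) simp
    then show ?thesis using e_meas[of j] by simp
  qed
  have E0: "0 \<le> ?E j x" for j x using e_nonneg wgt_nonneg by (intro mult_nonneg_nonneg add_nonneg_nonneg) auto
  have "nn_abs cs (\<lambda>j. gram i j * (1 + \<omega> i j)) \<le> (\<integral>\<^sup>+j. (\<integral>\<^sup>+x. ennreal (?E i x / B) * ennreal (?E j x) \<partial>lborel) \<partial>cs)"
  proof (rule nn_integral_mono)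
    fix j
    have int: "integrable lborel (\<lambda>x. \<Phi> j x * \<Phi> i x)"
      by (rule integrable_bounded_mult[OF integrable_\<Phi> \<Phi>_meas \<Phi>_le])
    have w0: "0 \<le> \<omega> i j" by (rule w_nonneg)
    have "\<bar>gram i j * (1 + \<omega> i j)\<bar> = norm (LINT x|lborel. \<Phi> j x * \<Phi> i x * ((1 + \<omega> i j) / B))"
      using B_pos by (simp add: gram_def)
    also have "ennreal \<dots> \<le> (\<integral>\<^sup>+x. ennreal (norm (\<Phi> j x * \<Phi> i x * ((1 + \<omega> i j) / B))) \<partial>lborel)"
      using int by (intro integral_norm_bound_ennreal) auto
    also have "... \<le> (\<integral>\<^sup>+x. ennreal (?E i x / B) * ennreal (?E j x) \<partial>lborel)"
    proof (rule nn_integral_mono)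
      fix x
      have "\<omega> i j \<le> wgt (x - pos i) + wgt (x - pos j)"
        using wgt_triangle[of "pos i - x" "x - pos j"] wgt_diff_commute[of "pos i" x] by (simp add: \<omega>_def)
      then have "1 + \<omega> i j \<le> (1 + wgt (x - pos i)) * (1 + wgt (x - pos j))"
        using mult_nonneg_nonneg[OF wgt_nonneg[of "x - pos i"] wgt_nonneg[of "x - pos j"]] by (simp add: algebra_simps)
      then have "\<bar>\<Phi> j x\<bar> * \<bar>\<Phi> i x\<bar> * (1 + \<omega> i j) \<le> e j x * e i x * ((1 + wgt (x - pos i)) * (1 + wgt (x - pos j)))"
        using dom e_nonneg w0 by (intro mult_mono) auto
      also have "... = ?E i x * ?E j x" by (simp add: mult_ac)
      finally have "\<bar>\<Phi> j x\<bar> * \<bar>\<Phi> i x\<bar> * (1 + \<omega> i j) / B \<le> ?E i x * ?E j x / B"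
        using B_pos by (intro divide_right_mono) auto
      then have "norm (\<Phi> j x * \<Phi> i x * ((1 + \<omega> i j) / B)) \<le> ?E i x / B * ?E j x"
        using B_pos w0 by (simp add: abs_mult)
      then have "ennreal (norm (\<Phi> j x * \<Phi> i x * ((1 + \<omega> i j) / B))) \<le> ennreal (?E i x / B * ?E j x)" by (rule ennreal_leI)
      also have "... = ennreal (?E i x / B) * ennreal (?E j x)"
        using E0 B_pos by (intro ennreal_mult divide_nonneg_pos) auto
      finally show "ennreal (norm (\<Phi> j x * \<Phi> i x * ((1 + \<omega> i j) / B))) \<le> ennreal (?E i x / B) * ennreal (?E j x)" .
    qed
    finally show "ennreal \<bar>gram i j * (1 + \<omega> i j)\<bar> \<le> (\<integral>\<^sup>+x. ennreal (?E i x / B) * ennreal (?E j x) \<partial>lborel)" .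
  qed
  also have "... = (\<integral>\<^sup>+x. (\<integral>\<^sup>+j. ennreal (?E i x / B) * ennreal (?E j x) \<partial>cs) \<partial>lborel)"
    by (rule nn_integral_count_space_nn_integral[symmetric]) (auto intro!: borel_measurable_times_ennreal)
  also have "... = (\<integral>\<^sup>+x. ennreal (?E i x / B) * (\<integral>\<^sup>+j. ennreal (?E j x) \<partial>cs) \<partial>lborel)"
    by (intro nn_integral_cong nn_integral_cmult) auto
  also have "... \<le> (\<integral>\<^sup>+x. ennreal (?E i x / B) * ennreal \<kappa> \<partial>lborel)"
    by (intro nn_integral_mono mult_left_mono rows) auto
  also have "... = (\<integral>\<^sup>+x. ennreal (\<kappa> / B) * ennreal (?E i x) \<partial>lborel)"
    using E0 \<kappa> B_pos by (intro nn_integral_cong) (simp add: mult_ac flip: ennreal_mult)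
  also have "... = ennreal (\<kappa> / B) * (\<integral>\<^sup>+x. ennreal (?E i x) \<partial>lborel)"
    by (rule nn_integral_cmult) measurable
  also have "... \<le> ennreal (\<kappa> / B) * ennreal \<kappa>" by (intro mult_left_mono cols) auto
  also have "... = ennreal (\<kappa> * \<kappa> / B)" using \<kappa> B_pos by (simp flip: ennreal_mult)
  finally show "nn_abs cs (\<lambda>j. gram i j * (1 + \<omega> i j)) \<le> ennreal (\<kappa> * \<kappa> / B)" .
qed

lemma gram_row: "row_bound gram (\<kappa> * \<kappa> / B)" and gram_wrow: "row_bound (\<lambda>i j. gram i j * \<omega> i j) (\<kappa> * \<kappa> / B)"
proof -
  have "row_bound gram (1 * (\<kappa> * \<kappa> / B))"
  proof (rule row_bound_scale[OF gram_weighted])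
    show "\<bar>gram i j\<bar> \<le> 1 * \<bar>gram i j * (1 + \<omega> i j)\<bar>" for i j
      using w_nonneg[of i j] by (simp add: abs_mult mult_le_cancel_left1)
  qed simp
  then show "row_bound gram (\<kappa> * \<kappa> / B)" by simp
  have "row_bound (\<lambda>i j. gram i j * \<omega> i j) (1 * (\<kappa> * \<kappa> / B))"
  proof (rule row_bound_scale[OF gram_weighted])
    show "\<bar>gram i j * \<omega> i j\<bar> \<le> 1 * \<bar>gram i j * (1 + \<omega> i j)\<bar>" for i j
      using w_nonneg[of i j] by (simp add: abs_mult mult_left_mono)
  qed simp
  then show "row_bound (\<lambda>i j. gram i j * \<omega> i j) (\<kappa> * \<kappa> / B)" by simp
qed

definition G :: "'i rmat" where "G = Rmat gram"

lemma ent_G: "ent G = gram"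
  unfolding G_def using gram_row by (intro Rmat_inverse) blast

lemma sym_rmat_G: "sym_rmat G" by (simp add: sym_rmat_def ent_G gram_def mult.commute)

lemma act_G:
  assumes "l1 c" shows "act G c i = (LINT x|lborel. D c x * \<Phi> i x) / B"
proof -
  have "act G c i = (LINT j|cs. c j * (LINT x|lborel. \<Phi> j x * \<Phi> i x) / B)"
    by (simp add: act_def ent_G gram_def mult.commute)
  also have "... = (LINT j|cs. c j * (LINT x|lborel. \<Phi> j x * \<Phi> i x)) / B" by simp
  also have "(LINT j|cs. c j * (LINT x|lborel. \<Phi> j x * \<Phi> i x)) = (LINT x|lborel. D c x * \<Phi> i x)"
    by (rule D_fubini(2)[OF assms \<Phi>_meas \<Phi>_le, symmetric])
  finally show ?thesis .
qed

lemma D_square_integrable: "l1 c \<Longrightarrow> integrable lborel (\<lambda>x. (D c x)\<^sup>2)"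
  unfolding power2_eq_square by (rule D_fubini(1)[OF _ D_meas D_le])

lemma l1_ip_G:
  assumes "l1 c" shows "l1_ip (act G c) c = (LINT x|lborel. (D c x)\<^sup>2) / B"
proof -
  have "(LINT x|lborel. (D c x)\<^sup>2) = (LINT i|cs. c i * (LINT x|lborel. \<Phi> i x * D c x))"
    unfolding power2_eq_square by (rule D_fubini(2)[OF assms D_meas D_le[OF assms]])
  also have "... / B = l1_ip (act G c) c"
    by (simp add: l1_ip_def act_G[OF assms] mult.commute)
  finally show ?thesis ..
qed

text \<open>For f = D c the squared inner products sum to B^2 |G c|^2 and |f|^2 = B <G c, c>, so
  dividing the frame inequalities by B^2 gives the claim.\<close>

lemma frame_matrix_finite:
  assumes "finite {i. c i \<noteq> 0}"
  shows "A / B * l1_ip (act G c) c \<le> l1_ip (act G c) (act G c)" "l1_ip (act G c) (act G c) \<le> l1_ip (act G c) c"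
proof -
  have c: "l1 c" by (rule l1_finite_support[OF assms])
  have "l1_ip (act G c) (act G c) = (LINT i|cs. (LINT x|lborel. D c x * \<Phi> i x)\<^sup>2) / B\<^sup>2"
    by (simp add: l1_ip_def act_G[OF c] power2_eq_square)
  moreover define S P where "S = (LINT i|cs. (LINT x|lborel. D c x * \<Phi> i x)\<^sup>2)" and "P = (LINT x|lborel. (D c x)\<^sup>2)"
  ultimately have e: "l1_ip (act G c) (act G c) = S / B\<^sup>2" "l1_ip (act G c) c = P / B" using l1_ip_G[OF c] by simp_all
  have f: "A * P \<le> S" "S \<le> B * P" using frame[OF assms, folded D_def] by (auto simp: S_def P_def)
  have "A * P / B\<^sup>2 \<le> S / B\<^sup>2" "S / B\<^sup>2 \<le> B * P / B\<^sup>2" using f by (auto intro: divide_right_mono)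
  then show "A / B * l1_ip (act G c) c \<le> l1_ip (act G c) (act G c)" "l1_ip (act G c) (act G c) \<le> l1_ip (act G c) c"
    unfolding e using B_pos by (auto simp: power2_eq_square)
qed

lemma frame_matrix:
  fixes c :: "'i \<Rightarrow> real"
  assumes "l1 c"
  shows "A / B * l1_ip (act G c) c \<le> l1_ip (act G c) (act G c)" "l1_ip (act G c) (act G c) \<le> l1_ip (act G c) c"
proof -
  define cm where "cm = (\<lambda>m i. if to_nat i \<le> m then c i else 0 :: real)"
  have fin: "finite {i. cm m i \<noteq> 0}" for m unfolding cm_def by (rule finite_truncate)
  have l1m: "l1 (cm m)" for m by (rule l1_finite_support[OF fin])
  have sGG: "sym_rmat (G * G)" by (intro sym_rmat_mult sym_rmat_G refl)
  have lim: "(\<lambda>m. l1_ip (act a (cm m)) (cm m)) \<longlonglongrightarrow> l1_ip (act a c) c" if "sym_rmat a" for a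
    unfolding cm_def by (rule l1_ip_truncate[OF that assms])
  \<comment> \<open>As a quadratic form of \<open>G * G\<close>, the squared norm falls under the
    same truncation lemma.\<close>
  have sq: "l1_ip (act G d) (act G d) = l1_ip (act (G * G) d) d" if "l1 d" for d
    using that l1_ip_symm[OF sym_rmat_G act_l1[OF sym_rmat_G that] that] by (simp add: act_mult)
  have "A / B * l1_ip (act G (cm m)) (cm m) \<le> l1_ip (act (G * G) (cm m)) (cm m)" for m
    using frame_matrix_finite(1)[OF fin] sq[OF l1m] by simp
  then show "A / B * l1_ip (act G c) c \<le> l1_ip (act G c) (act G c)"
    unfolding sq[OF assms]
    by (intro LIMSEQ_le[OF tendsto_mult[OF tendsto_const lim[OF sym_rmat_G]] lim[OF sGG]]) auto
  have "l1_ip (act (G * G) (cm m)) (cm m) \<le> l1_ip (act G (cm m)) (cm m)" for m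
    using frame_matrix_finite(2)[OF fin] sq[OF l1m] by simp
  then show "l1_ip (act G c) (act G c) \<le> l1_ip (act G c) c"
    unfolding sq[OF assms]
    by (intro LIMSEQ_le[OF lim[OF sGG] lim[OF sym_rmat_G]]) auto
qed

lemma localized_psd_G: "localized_psd G (A / B) \<omega> I K n (\<kappa> * \<kappa> / B)"
proof unfold_locales
  show "sym_rmat G" by (rule sym_rmat_G)
  show "0 < A / B" "A / B \<le> 1" using A_pos A_le_B by auto
  show "A / B * l1_ip (act G c) c \<le> l1_ip (act G c) (act G c)" "l1_ip (act G c) (act G c) \<le> l1_ip (act G c) c" if "l1 c" for c
    using frame_matrix[OF that] by auto
  show "j \<in> I" if "ent G i j \<noteq> 0" for i j
  proof (rule ccontr)
    assume "j \<notin> I"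
    then have "gram i j = 0" using supp by (simp add: gram_def)
    then show False using that by (simp add: ent_G)
  qed
  show "row_bound (went G) (\<kappa> * \<kappa> / B)" using gram_wrow by (simp add: went_def[abs_def] ent_G)
qed

end

section \<open>Local approximation\<close>

lemma powr_sum_le:
  fixes a b p :: real
  assumes "0 \<le> p"
  shows "\<bar>a + b\<bar> powr p \<le> 2 powr p * (\<bar>a\<bar> powr p + \<bar>b\<bar> powr p)"
proof -
  have "\<bar>a + b\<bar> \<le> 2 * max \<bar>a\<bar> \<bar>b\<bar>" by linarith
  then have "\<bar>a + b\<bar> powr p \<le> (2 * max \<bar>a\<bar> \<bar>b\<bar>) powr p" using assms by (intro powr_mono2) auto
  also have "... = 2 powr p * (max \<bar>a\<bar> \<bar>b\<bar>) powr p" by (simp add: powr_mult)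
  also have "(max \<bar>a\<bar> \<bar>b\<bar>) powr p \<le> \<bar>a\<bar> powr p + \<bar>b\<bar> powr p" by (simp add: max_def)
  finally show ?thesis by simp
qed

lemma powr_pred_mult: "0 < x \<Longrightarrow> x powr (p - 1) * x = x powr (p :: real)"
  by (simp add: powr_diff)

lemma powint_add_le:
  assumes "f \<in> borel_measurable M" "g \<in> borel_measurable M" "0 \<le> p"
  shows "powint p M (\<lambda>x. f x + g x) \<le> ennreal (2 powr p) * (powint p M f + powint p M g)"
proof -
  note assms(1,2)[measurable]
  have "powint p M (\<lambda>x. f x + g x) \<le> (\<integral>\<^sup>+x. ennreal (2 powr p) * (ennreal (\<bar>f x\<bar> powr p) + ennreal (\<bar>g x\<bar> powr p)) \<partial>M)"
  proof (rule nn_integral_mono)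
    fix x
    have "ennreal (\<bar>f x + g x\<bar> powr p) \<le> ennreal (2 powr p * (\<bar>f x\<bar> powr p + \<bar>g x\<bar> powr p))"
      by (intro ennreal_leI powr_sum_le assms)
    then show "ennreal (\<bar>f x + g x\<bar> powr p) \<le> ennreal (2 powr p) * (ennreal (\<bar>f x\<bar> powr p) + ennreal (\<bar>g x\<bar> powr p))"
      by (simp add: ennreal_mult)
  qed
  also have "... = ennreal (2 powr p) * (powint p M f + powint p M g)"
    by (subst nn_integral_cmult, measurable, subst nn_integral_add, measurable)
  finally show ?thesis .
qed

lemma powint_restrict_le:
  "\<Omega> \<in> sets M \<Longrightarrow> powint p (restrict_space M \<Omega>) f \<le> powint p M f"
  by (subst nn_integral_restrict_space) (auto intro!: nn_integral_mono simp: indicator_def)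

lemma powint_lebesgue_on:
  "\<Omega> \<in> sets borel \<Longrightarrow> powint p (lebesgue_on \<Omega>) f = powint p (restrict_space lborel \<Omega>) f"
  by (simp add: nn_integral_restrict_space nn_integral_completion)

lemma powint_lebesgue: "powint p lebesgue f = powint p lborel f"
  by (rule nn_integral_completion)

context localized_frame
begin

lemma D_diff: "l1 c \<Longrightarrow> l1 d \<Longrightarrow> D (\<lambda>i. c i - d i) x = D c x - D d x"
  by (simp add: D_def left_diff_distrib D_integrable_row)

lemma D_add: "l1 c \<Longrightarrow> l1 d \<Longrightarrow> D (\<lambda>i. c i + d i) x = D c x + D d x"
  by (simp add: D_def distrib_right D_integrable_row)

text \<open>This is what allows estimates in terms of the function \<open>D c\<close> alone: its
  inner products with the frame are bounded by its norm, although \<open>c\<close> itself is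
  not.\<close>

lemma analysis_Lp:
  assumes p: "1 \<le> p" and c: "l1 c"
  shows "powint p cs (\<lambda>i. act G c i) \<le> ennreal ((\<kappa> / B) powr p) * powint p lborel (D c)"
proof -
  have kB: "0 < \<kappa> / B" using \<kappa> B_pos by simp
  have "powint p cs (\<lambda>i. LINT x|lborel. (\<Phi> i x / B) * D c x)
    \<le> ennreal ((\<kappa> / B) powr (p - 1) * (\<kappa> / B)) * powint p lborel (D c)"
  proof (rule schur_test[OF sigma_finite_measure_count_space lborel.sigma_finite_measure_axioms p kB])
    have sc: "ennreal \<bar>\<Phi> i x / B\<bar> = ennreal (1 / B) * ennreal \<bar>\<Phi> i x\<bar>" for i x
      using B_pos by (simp flip: ennreal_mult)
    have kB2: "ennreal (1 / B) * ennreal \<kappa> = ennreal (\<kappa> / B)"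
      using \<kappa> B_pos by (simp flip: ennreal_mult)
    show "(\<lambda>(i, x). \<Phi> i x / B) \<in> borel_measurable (cs \<Otimes>\<^sub>M lborel)"
      by (rule measurable_pair_measure_countable1) auto
    show "nn_abs lborel (\<lambda>x. \<Phi> i x / B) \<le> ennreal (\<kappa> / B)" for i
      unfolding sc kB2[symmetric] by (subst nn_integral_cmult) (auto intro!: mult_left_mono cols_\<Phi>)
    show "nn_abs cs (\<lambda>i. \<Phi> i x / B) \<le> ennreal (\<kappa> / B)" for x
      unfolding sc kB2[symmetric] using rows_\<Phi>
      by (subst nn_integral_cmult) (auto intro!: mult_left_mono simp: row_bound_def)
    show "integrable lborel (\<lambda>x. \<Phi> i x / B * D c x)" for i
      using integrable_bounded_mult[OF integrable_\<Phi> D_meas D_le[OF c], of i] by simp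
  qed (use kB in auto)
  moreover have "(LINT x|lborel. (\<Phi> i x / B) * D c x) = act G c i" for i
    by (simp add: act_G[OF c] mult.commute)
  ultimately show ?thesis by (simp only: powr_pred_mult[OF kB])
qed

lemma synthesis_Lp:
  assumes p: "1 \<le> p" and w: "l1 w"
  shows "powint p lborel (D w) \<le> ennreal (\<kappa> powr p) * powint p cs w"
proof -
  have "powint p lborel (\<lambda>x. LINT i|cs. \<Phi> i x * w i)
    \<le> ennreal (\<kappa> powr (p - 1) * \<kappa>) * powint p cs w"
  proof (rule schur_test[OF lborel.sigma_finite_measure_axioms sigma_finite_measure_count_space p \<kappa>])
    show "nn_abs cs (\<lambda>i. \<Phi> i x) \<le> ennreal \<kappa>" for x using rows_\<Phi> by (simp add: row_bound_def)
    show "l1 (\<lambda>i. \<Phi> i x * w i)" for x using D_integrable_row[OF w] by (simp add: mult.commute)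
  qed (use \<kappa> \<Phi>_pair' cols_\<Phi> in auto)
  then show ?thesis by (simp only: powr_pred_mult[OF \<kappa>] D_def mult.commute[of "w _"])
qed

text \<open>On \<Omega> the factor \<open>1 + wgt\<close> is at least R for the indices in
  \<open>J\<close>, so the weighted column bound leaves a gain 1 / R. The gain has to come from the
  columns: the row bound enters with exponent p - 1, which is 0 for p = 1.\<close>

lemma synthesis_far_Lp:
  assumes p: "1 \<le> p" and w: "l1 w" and R: "0 < R" and \<Omega>: "\<Omega> \<in> sets borel"
    and far: "\<And>i x. i \<in> J \<Longrightarrow> x \<in> \<Omega> \<Longrightarrow> R \<le> wgt (x - pos i)"
  shows "powint p (restrict_space lborel \<Omega>) (D (\<lambda>i. if i \<in> J then w i else 0))
     \<le> ennreal (\<kappa> powr (p - 1) * (\<kappa> / R)) * powint p cs w"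
proof -
  define k where "k = (\<lambda>x i. if i \<in> J then \<Phi> i x else 0)"
  have k_le: "\<bar>k x i\<bar> \<le> \<bar>\<Phi> i x\<bar>" for x i by (auto simp: k_def)
  have "powint p (restrict_space lborel \<Omega>) (\<lambda>x. LINT i|cs. k x i * w i)
    \<le> ennreal (\<kappa> powr (p - 1) * (\<kappa> / R)) * powint p cs w"
  proof (rule schur_test[OF _ sigma_finite_measure_count_space p \<kappa>])
    show "sigma_finite_measure (restrict_space lborel \<Omega>)"
      using \<Omega> by (intro sigma_finite_measure_restrict_space lborel.sigma_finite_measure_axioms) simp
    have "(\<lambda>(i, x). k x i) \<in> borel_measurable (cs \<Otimes>\<^sub>M restrict_space lborel \<Omega>)"
      by (intro measurable_pair_measure_countable1) (auto simp: k_def intro!: measurable_restrict_space1)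
    from measurable_pair_swap[OF this]
    show "(\<lambda>(x, i). k x i) \<in> borel_measurable (restrict_space lborel \<Omega> \<Otimes>\<^sub>M cs)" by (simp add: case_prod_unfold)
    show "nn_abs cs (k x) \<le> ennreal \<kappa>" for x
    proof -
      have "nn_abs cs (k x) \<le> nn_abs cs (\<lambda>i. \<Phi> i x)" by (intro nn_integral_mono ennreal_leI k_le)
      then show ?thesis using rows_\<Phi> by (auto simp: row_bound_def intro: order_trans)
    qed
    show "nn_abs (restrict_space lborel \<Omega>) (\<lambda>x. k x i) \<le> ennreal (\<kappa> / R)" for i
    proof -
      let ?E = "\<lambda>x. e i x * (1 + wgt (x - pos i))"
      have "nn_abs (restrict_space lborel \<Omega>) (\<lambda>x. k x i) = (\<integral>\<^sup>+x. ennreal \<bar>k x i\<bar> * indicator \<Omega> x \<partial>lborel)"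
        using \<Omega> by (simp add: nn_integral_restrict_space)
      also have "... \<le> (\<integral>\<^sup>+x. ennreal (1 / R) * ennreal (?E x) \<partial>lborel)"
      proof (rule nn_integral_mono)
        fix x
        have E0: "0 \<le> ?E x" using e_le[of i x] e_nonneg[of i x] by linarith
        have "\<bar>k x i\<bar> \<le> 1 / R * ?E x" if "x \<in> \<Omega>"
        proof (cases "i \<in> J")
          case True
          then have "R \<le> 1 + wgt (x - pos i)" using far[of i x] that by simp
          then have "e i x * R \<le> ?E x" using e_nonneg by (intro mult_left_mono)
          then have "e i x \<le> 1 / R * ?E x" using R by (simp add: field_simps)
          then show ?thesis using k_le[of x i] dom[of i x] by linarith
        qed (use E0 R in \<open>simp add: k_def\<close>)
        then have "ennreal \<bar>k x i\<bar> * indicator \<Omega> x \<le> ennreal (1 / R * ?E x)"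
          by (auto simp: indicator_def intro!: ennreal_leI)
        also have "... = ennreal (1 / R) * ennreal (?E x)" using R E0 by (intro ennreal_mult) auto
        finally show "ennreal \<bar>k x i\<bar> * indicator \<Omega> x \<le> ennreal (1 / R) * ennreal (?E x)" .
      qed
      also have "... = ennreal (1 / R) * (\<integral>\<^sup>+x. ennreal (?E x) \<partial>lborel)"
      proof (rule nn_integral_cmult)
        have "(\<lambda>x. wgt (x - pos i)) \<in> borel_measurable borel"
          by (rule measurable_compose[OF _ wgt_measurable]) simp
        then show "(\<lambda>x. ennreal (?E x)) \<in> borel_measurable lborel" using e_meas[of i] by simp
      qed
      also have "... \<le> ennreal (1 / R) * ennreal \<kappa>" by (intro mult_left_mono cols) auto
      also have "... = ennreal (\<kappa> / R)" using R \<kappa> by (simp flip: ennreal_mult)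
      finally show ?thesis .
    qed
    show "l1 (\<lambda>i. k x i * w i)" for x
    proof (rule Bochner_Integration.integrable_bound[OF D_integrable_row[OF w, of x]])
      show "AE i in cs. norm (k x i * w i) \<le> norm (w i * \<Phi> i x)"
        using k_le by (intro AE_I2) (simp add: abs_mult mult.commute mult_left_mono)
    qed auto
  qed (use \<kappa> R in auto)
  moreover have "(LINT i|cs. k x i * w i) = D (\<lambda>i. if i \<in> J then w i else 0) x" for x
    unfolding D_def k_def by (intro Bochner_Integration.integral_cong) auto
  ultimately show ?thesis by simp
qed

end

lemma act_Lp:
  fixes w :: "'i::countable \<Rightarrow> real"
  assumes p: "1 \<le> p" and w: "l1 w" and a: "sym_rmat a" "row_bound (ent a) m" "0 < m"
  shows "powint p cs (\<lambda>i. act a w i) \<le> ennreal (m powr p) * powint p cs w"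
proof -
  have "powint p cs (\<lambda>i. LINT j|cs. ent a i j * w j)
    \<le> ennreal (m powr (p - 1) * m) * powint p cs w"
  proof (rule schur_test[OF sigma_finite_measure_count_space sigma_finite_measure_count_space p a(3)])
    show "(\<lambda>(i, j). ent a i j) \<in> borel_measurable (cs \<Otimes>\<^sub>M cs)" by (simp add: pair_measure_countable)
    show rows: "nn_abs cs (ent a i) \<le> ennreal m" for i using a(2) by (simp add: row_bound_def)
    show "nn_abs cs (\<lambda>i. ent a i j) \<le> ennreal m" for j
    proof -
      have "nn_abs cs (\<lambda>i. ent a i j) = nn_abs cs (ent a j)"
        using a(1) by (intro nn_integral_cong) (simp add: sym_rmat_def)
      then show ?thesis using rows[of j] by simp
    qed
    show "l1 (\<lambda>j. ent a i j * w j)" for i by (rule l1_ent_mult[OF w])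
  qed (use a in auto)
  then show ?thesis by (simp only: powr_pred_mult[OF a(3)] act_def)
qed

context localized_frame
begin

text \<open>The quadratic form identifies the limit: the errors \<open>D (d i)\<close> tend to 0
  almost everywhere. The bound in L^p then follows from Fatou's lemma, since the differences with
  index \<open>j\<close> are controlled in row-sum norm uniformly in i.\<close>

lemma reconstruction_Lp:
  assumes p: "1 \<le> p"
    and Z: "\<And>j. Z j \<in> polys G" and Zd: "\<And>i. j \<le> i \<Longrightarrow> row_bound (ent (Z i - Z j)) \<eta>" and \<eta>: "0 < \<eta>"
    and Zq: "\<And>i c. l1 c \<Longrightarrow> l1_ip (act G (act (1 - Z i * G) c)) (act (1 - Z i * G) c) \<le> (1/4) ^ i * l1_ip (act G c) c"
    and c: "l1 c"
  shows "powint p lborel (\<lambda>x. D c x - D (act (Z j) (act G c)) x)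
    \<le> ennreal (\<kappa> powr p * (\<eta> powr p * (\<kappa> / B) powr p)) * powint p lborel (D c)" (is "_ \<le> ?bd")
proof -
  define w where "w = (\<lambda>i. act (Z i) (act G c))"
  have symZ: "sym_rmat (Z i)" for i by (rule polys_symm[OF Z sym_rmat_G])
  have symd: "sym_rmat (Z i - Z j)" for i by (intro sym_rmat_diff symZ)
  have b: "l1 (act G c)" by (rule act_l1[OF sym_rmat_G c])
  have w: "l1 (w i)" for i unfolding w_def by (rule act_l1[OF symZ b])
  define d where "d = (\<lambda>i. act (1 - Z i * G) c)"
  have d: "d i = (\<lambda>k. c k - w i k)" for i
    unfolding d_def w_def by (simp add: act_diff_mat c act_one act_mult)
  have ld: "l1 (d i)" for i unfolding d using c w by simp
  have Dd: "D (d i) x = D c x - D (w i) x" for i x unfolding d by (rule D_diff[OF c w])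
  have sq: "(\<integral>\<^sup>+x. ennreal ((D (d i) x)\<^sup>2) \<partial>lborel) \<le> ennreal (B * l1_ip (act G c) c * (1/4) ^ i)" for i
  proof -
    have "(\<integral>\<^sup>+x. ennreal ((D (d i) x)\<^sup>2) \<partial>lborel) = ennreal (LINT x|lborel. (D (d i) x)\<^sup>2)"
      by (rule nn_integral_eq_integral[OF D_square_integrable[OF ld]]) auto
    also have "(LINT x|lborel. (D (d i) x)\<^sup>2) = B * l1_ip (act G (d i)) (d i)"
      using l1_ip_G[OF ld] B_pos by simp
    also have "... \<le> B * ((1/4) ^ i * l1_ip (act G c) c)"
      unfolding d_def using B_pos by (intro mult_left_mono Zq c) auto
    finally show ?thesis by (simp add: mult_ac ennreal_leI)
  qed
  \<comment> \<open>The L2 errors decay geometrically, so their squares are summable at almost every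
    point and the whole sequence converges there, not just a subsequence.\<close>
  have "(\<integral>\<^sup>+x. (\<Sum>i. ennreal ((D (d i) x)\<^sup>2)) \<partial>lborel) = (\<Sum>i. \<integral>\<^sup>+x. ennreal ((D (d i) x)\<^sup>2) \<partial>lborel)"
    by (rule nn_integral_suminf) measurable
  also have "... \<le> (\<Sum>i. ennreal (B * l1_ip (act G c) c * (1/4) ^ i))"
    by (intro suminf_le sq) auto
  also have "... = ennreal (\<Sum>i. B * l1_ip (act G c) c * (1/4) ^ i)"
  proof (rule suminf_ennreal2)
    show "0 \<le> B * l1_ip (act G c) c * (1 / 4) ^ i" for i
      using B_pos l1_ip_G[OF c] by (intro mult_nonneg_nonneg) auto
    show "summable (\<lambda>i. B * l1_ip (act G c) c * (1 / 4) ^ i)" by (intro summable_mult summable_geometric) simp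
  qed
  also have "... < \<infinity>" by simp
  finally have "(\<integral>\<^sup>+x. (\<Sum>i. ennreal ((D (d i) x)\<^sup>2)) \<partial>lborel) \<noteq> \<infinity>" by simp
  then have "AE x in lborel. (\<Sum>i. ennreal ((D (d i) x)\<^sup>2)) \<noteq> \<infinity>"
    by (intro nn_integral_PInf_AE) measurable
  then have lim: "AE x in lborel. (\<lambda>i. D (w i) x) \<longlonglongrightarrow> D c x"
  proof eventually_elim
    case (elim x)
    have "summable (\<lambda>i. (D (d i) x)\<^sup>2)" using elim by (intro summable_suminf_not_top) auto
    then have "(\<lambda>i. (D (d i) x)\<^sup>2) \<longlonglongrightarrow> 0" by (rule summable_LIMSEQ_zero)
    then have "(\<lambda>i. sqrt ((D (d i) x)\<^sup>2)) \<longlonglongrightarrow> sqrt 0" by (intro tendsto_intros)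
    then have "(\<lambda>i. \<bar>D (d i) x\<bar>) \<longlonglongrightarrow> 0" by simp
    then have "(\<lambda>i. D (d i) x) \<longlonglongrightarrow> 0" by (rule tendsto_rabs_zero_cancel)
    then have "(\<lambda>i. D c x - D (d i) x) \<longlonglongrightarrow> D c x - 0" by (intro tendsto_intros)
    then show ?case by (simp add: Dd)
  qed
  have "powint p lborel (\<lambda>x. D c x - D (w j) x)
    = (\<integral>\<^sup>+x. liminf (\<lambda>i. ennreal (\<bar>D (w i) x - D (w j) x\<bar> powr p)) \<partial>lborel)"
  proof (rule nn_integral_cong_AE, use lim in eventually_elim)
    case (elim x)
    have "(\<lambda>i. \<bar>D (w i) x - D (w j) x\<bar> powr p) \<longlonglongrightarrow> \<bar>D c x - D (w j) x\<bar> powr p"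
      using elim p by (intro tendsto_powr' tendsto_intros) auto
    then have "(\<lambda>i. ennreal (\<bar>D (w i) x - D (w j) x\<bar> powr p)) \<longlonglongrightarrow> ennreal (\<bar>D c x - D (w j) x\<bar> powr p)"
      by (rule tendsto_ennrealI)
    from lim_imp_Liminf[OF _ this] show ?case by simp
  qed
  also have "... \<le> liminf (\<lambda>i. \<integral>\<^sup>+x. ennreal (\<bar>D (w i) x - D (w j) x\<bar> powr p) \<partial>lborel)"
    by (rule nn_integral_liminf) measurable
  also have "... \<le> ?bd"
  proof (rule Liminf_le)
    show "\<forall>\<^sub>F i in sequentially. (powint p lborel (\<lambda>x. D (w i) x - D (w j) x)) \<le> ?bd"
      using eventually_ge_at_top[of j]
    proof eventually_elim
      case (elim i)
      have wd: "(\<lambda>k. w i k - w j k) = act (Z i - Z j) (act G c)"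
        unfolding w_def by (simp add: act_diff_mat b)
      have lwd: "l1 (act (Z i - Z j) (act G c))" by (rule act_l1[OF symd b])
      have "powint p lborel (\<lambda>x. D (w i) x - D (w j) x) = powint p lborel (\<lambda>x. D (act (Z i - Z j) (act G c)) x)"
        by (simp add: wd[symmetric] D_diff w)
      also have "... \<le> ennreal (\<kappa> powr p) * powint p cs (\<lambda>k. act (Z i - Z j) (act G c) k)"
        by (rule synthesis_Lp[OF p lwd])
      also have "... \<le> ennreal (\<kappa> powr p) * (ennreal (\<eta> powr p) * powint p cs (\<lambda>k. act G c k))"
        by (intro mult_left_mono act_Lp[OF p b symd Zd[OF elim] \<eta>]) auto
      also have "... \<le> ennreal (\<kappa> powr p) * (ennreal (\<eta> powr p) * (ennreal ((\<kappa> / B) powr p) * powint p lborel (D c)))"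
        by (intro mult_left_mono analysis_Lp[OF p c]) auto
      also have "... = ?bd" by (simp add: ennreal_mult mult.assoc)
      finally show ?case .
    qed
  qed simp
  finally show ?thesis by (simp add: w_def)
qed

text \<open>Truncating \<open>c\<close> itself would be useless, as its far terms may be large and
  cancel. The coefficients \<open>Z j\<close> applied to the inner products are bounded in l^p by
  the norm of \<open>D c\<close>, so their far terms can be discarded. \<open>R\<close> depends on
  no coefficients.\<close>

theorem local_approximation:
  assumes p: "1 \<le> p" and \<Omega>: "\<Omega> \<in> sets borel" "\<And>x. x \<in> \<Omega> \<Longrightarrow> infnorm x \<le> \<rho>" and \<epsilon>: "0 < \<epsilon>"
  shows "\<exists>R. \<forall>c. l1 c \<longrightarrow> (\<exists>w. powint p (restrict_space lborel \<Omega>) (\<lambda>x. D c x - D (\<lambda>i. if infnorm (pos i) \<le> R then w i else 0) x)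
     \<le> ennreal \<epsilon> * powint p lborel (D c))"
proof -
  interpret P: localized_psd G "A / B" \<omega> I K n "\<kappa> * \<kappa> / B" by (rule localized_psd_G)
  obtain Z \<delta> where Z: "\<And>j. Z j \<in> polys G" and \<delta>: "\<delta> \<longlonglongrightarrow> (0::real)"
    and Zd: "\<And>i j. j \<le> i \<Longrightarrow> row_bound (ent (Z i - Z j)) (\<delta> j)"
    and Zq: "\<And>j c. l1 c \<Longrightarrow> l1_ip (act G (act (1 - Z j * G) c)) (act (1 - Z j * G) c) \<le> (1/4) ^ j * l1_ip (act G c) c"
    using P.approximate_inverse unfolding P.q_def by blast
  have kB: "0 < \<kappa> / B" using \<kappa> B_pos by simp
  define c1 where "c1 = 2 powr p * (\<kappa> powr p * (\<kappa> / B) powr p)"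
  have c1: "0 < c1" unfolding c1_def using \<kappa> B_pos by (intro mult_pos_pos) auto
  \<comment> \<open>\<eta> solves c1 * \<eta>^p = \<epsilon> / 2, and \<open>r\<close> below solves
    c2 / r = \<epsilon> / 2: reconstruction error and far part get equal shares.\<close>
  define \<eta> where "\<eta> = (\<epsilon> / (2 * c1)) powr (1 / p)"
  have \<eta>: "0 < \<eta>" using \<epsilon> c1 by (simp add: \<eta>_def)
  have \<eta>p: "\<eta> powr p = \<epsilon> / (2 * c1)" using p \<epsilon> c1 by (simp add: \<eta>_def powr_powr)
  obtain j where j: "\<delta> j < \<eta>"
    using order_tendstoD(2)[OF \<delta> \<eta>] by (auto dest: eventually_happens)
  have Zd': "row_bound (ent (Z i - Z j)) \<eta>" if "j \<le> i" for i
    using row_bound_mono[OF Zd[OF that]] j by simp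
  \<comment> \<open>The row sums of the chosen \<open>Z j\<close> enter the far part, so the radius
    is fixed only after \<open>j\<close>. Adding 1 makes the bound positive, as
    \<open>act_Lp\<close> requires.\<close>
  obtain m0 where m0: "row_bound (ent (Z j)) m0" by (rule row_bound_ent_obtain)
  define m where "m = m0 + 1"
  have m: "row_bound (ent (Z j)) m" "0 < m"
    using row_bound_mono[OF m0, of m] row_bound_nonneg[OF m0] by (auto simp: m_def)
  define c2 where "c2 = 2 powr p * (\<kappa> powr (p - 1) * \<kappa> * (m powr p * (\<kappa> / B) powr p))"
  have c2: "0 < c2" unfolding c2_def using \<kappa> B_pos m by (intro mult_pos_pos) auto
  define r where "r = 2 * c2 / \<epsilon>"
  have r: "0 < r" using c2 \<epsilon> by (simp add: r_def)
  \<comment> \<open>The square undoes the root in \<open>wgt\<close>: beyond radius \<open>R\<close>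
    every index has weight at least \<open>r\<close> from all of \<Omega>.\<close>
  define R where "R = \<rho> + r\<^sup>2"
  have "\<exists>w. powint p (restrict_space lborel \<Omega>) (\<lambda>x. D c x - D (\<lambda>i. if infnorm (pos i) \<le> R then w i else 0) x)
     \<le> ennreal \<epsilon> * powint p lborel (D c)" if c: "l1 c" for c
  proof -
    define w where "w = act (Z j) (act G c)"
    have symZ: "sym_rmat (Z j)" by (rule polys_symm[OF Z sym_rmat_G])
    have b: "l1 (act G c)" by (rule act_l1[OF sym_rmat_G c])
    have w: "l1 w" unfolding w_def by (rule act_l1[OF symZ b])
    define J where "J = {i. R < infnorm (pos i)}"
    let ?\<Omega> = "restrict_space lborel \<Omega>"
    let ?near = "\<lambda>i. if infnorm (pos i) \<le> R then w i else 0" and ?far = "\<lambda>i. if i \<in> J then w i else 0"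
    have near: "l1 ?near" and far: "l1 ?far"
      by (rule Bochner_Integration.integrable_bound[OF w]; simp)+
    have split: "D w x = D ?near x + D ?far x" for x
    proof -
      have "w = (\<lambda>i. ?near i + ?far i)" by (auto simp: J_def)
      then show ?thesis using D_add[OF near far, of x] by simp
    qed
    define N where "N = powint p lborel (D c)"
    have farR: "r \<le> wgt (x - pos i)" if "i \<in> J" "x \<in> \<Omega>" for i x
    proof -
      have "infnorm (pos i) \<le> infnorm x + infnorm (x - pos i)"
        using infnorm_triangle[of x "- (x - pos i)"] by (simp add: infnorm_neg infnorm_sub)
      then have "r\<^sup>2 \<le> infnorm (x - pos i)" using that \<Omega>(2)[of x] by (simp add: J_def R_def)
      then show ?thesis unfolding wgt_def by (rule real_le_rsqrt)
    qed
    have I1: "powint p lborel (\<lambda>x. D c x - D w x) \<le> ennreal (\<kappa> powr p * (\<eta> powr p * (\<kappa> / B) powr p)) * N"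
      unfolding w_def N_def by (rule reconstruction_Lp[OF p Z Zd' \<eta> Zq c])
    have "powint p ?\<Omega> (D ?far)
      \<le> ennreal (\<kappa> powr (p - 1) * (\<kappa> / r)) * powint p cs w"
      by (rule synthesis_far_Lp[OF p w r \<Omega>(1) farR])
    also have "... \<le> ennreal (\<kappa> powr (p - 1) * (\<kappa> / r)) * (ennreal (m powr p) * powint p cs (\<lambda>i. act G c i))"
      unfolding w_def by (intro mult_left_mono act_Lp[OF p b symZ m]) auto
    also have "... \<le> ennreal (\<kappa> powr (p - 1) * (\<kappa> / r)) * (ennreal (m powr p) * (ennreal ((\<kappa> / B) powr p) * N))"
      unfolding N_def by (intro mult_left_mono analysis_Lp[OF p c]) auto
    also have "... = ennreal (\<kappa> powr (p - 1) * (\<kappa> / r) * (m powr p * (\<kappa> / B) powr p)) * N"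
    proof -
      have "ennreal s * (ennreal t * (ennreal u * N)) = ennreal (s * (t * u)) * N" if "0 \<le> s" "0 \<le> t" "0 \<le> u" for s t u
        using that by (simp add: ennreal_mult mult.assoc)
      from this[of "\<kappa> powr (p - 1) * (\<kappa> / r)" "m powr p" "(\<kappa> / B) powr p"] show ?thesis using \<kappa> r by simp
    qed
    finally have I2: "powint p ?\<Omega> (D ?far)
      \<le> ennreal (\<kappa> powr (p - 1) * (\<kappa> / r) * (m powr p * (\<kappa> / B) powr p)) * N" .
    have "powint p ?\<Omega> (\<lambda>x. D c x - D ?near x) = powint p ?\<Omega> (\<lambda>x. (D c x - D w x) + D ?far x)"
      by (simp add: split)
    also have "... \<le> ennreal (2 powr p) * (powint p ?\<Omega> (\<lambda>x. D c x - D w x) + powint p ?\<Omega> (D ?far))"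
      using p by (intro powint_add_le measurable_restrict_space1 borel_measurable_diff D_meas) auto
    also have "... \<le> ennreal (2 powr p) * (powint p lborel (\<lambda>x. D c x - D w x) + powint p ?\<Omega> (D ?far))"
      using \<Omega>(1) by (intro mult_left_mono add_mono powint_restrict_le) auto
    also have "... \<le> ennreal (2 powr p) * (ennreal (\<kappa> powr p * (\<eta> powr p * (\<kappa> / B) powr p)) * N + ennreal (\<kappa> powr (p - 1) * (\<kappa> / r) * (m powr p * (\<kappa> / B) powr p)) * N)"
      by (intro mult_left_mono add_mono I1 I2) auto
    also have "... = ennreal (2 powr p * (\<kappa> powr p * (\<eta> powr p * (\<kappa> / B) powr p) + \<kappa> powr (p - 1) * (\<kappa> / r) * (m powr p * (\<kappa> / B) powr p))) * N"
    proof -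
      have "0 \<le> \<kappa> powr p * (\<eta> powr p * (\<kappa> / B) powr p)" "0 \<le> \<kappa> powr (p - 1) * (\<kappa> / r) * (m powr p * (\<kappa> / B) powr p)"
        using \<kappa> r by auto
      moreover have "ennreal s * (ennreal t * N + ennreal u * N) = ennreal (s * (t + u)) * N" if "0 \<le> s" "0 \<le> t" "0 \<le> u" for s t u
        using that by (simp add: ennreal_mult distrib_right mult.assoc)
      ultimately show ?thesis by simp
    qed
    also have "2 powr p * (\<kappa> powr p * (\<eta> powr p * (\<kappa> / B) powr p) + \<kappa> powr (p - 1) * (\<kappa> / r) * (m powr p * (\<kappa> / B) powr p)) = c1 * \<eta> powr p + c2 / r"
      using r by (simp add: c1_def c2_def field_simps)
    also have "c1 * \<eta> powr p + c2 / r = \<epsilon>" using c1 c2 \<epsilon> by (simp add: \<eta>p r_def)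
    finally show ?thesis unfolding N_def by blast
  qed
  then show ?thesis by blast
qed

end

section \<open>Reduction to sequences indexed by the naturals\<close>

lemma lint_finite:
  fixes h :: "'i \<Rightarrow> real"
  assumes "finite S" "\<And>i. i \<notin> S \<Longrightarrow> h i = 0"
  shows "(LINT i|cs. h i) = sum h S"
proof -
  have "(LINT i|cs. h i) = (LINT i|cs. indicator S i *\<^sub>R h i)"
    using assms(2) by (intro Bochner_Integration.integral_cong) (auto simp: indicator_def)
  also have "... = (LINT i|count_space S. h i)"
    using integral_restrict_space[of S cs h] by (simp add: restrict_count_space)
  finally show ?thesis by (simp add: lebesgue_integral_count_space_finite[OF assms(1)])
qed

lemma Lp_norm_leI:
  assumes "0 < p" "0 \<le> s" "powint p M h \<le> ennreal (s powr p)"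
  shows "Lp_norm p M h \<le> ennreal s"
proof -
  let ?I = "\<integral>\<^sup>+x. ennreal (\<bar>h x\<bar> powr p) \<partial>M"
  have fin: "?I \<noteq> \<infinity>" using le_less_trans[OF assms(3) ennreal_less_top] by simp
  have "enn2real ?I \<le> s powr p" using assms(3) by (intro enn2real_leI) auto
  then have "enn2real ?I powr (1 / p) \<le> (s powr p) powr (1 / p)" using assms(1) by (intro powr_mono2) auto
  also have "... = s" using assms by (simp add: powr_powr)
  finally show ?thesis using fin by (simp add: Lp_norm_def ennreal_leI)
qed

lemma Lp_norm_lessD:
  assumes "0 < p" "0 \<le> s" "Lp_norm p M h < ennreal s"
  shows "powint p M h \<le> ennreal (s powr p)"
proof -
  let ?I = "\<integral>\<^sup>+x. ennreal (\<bar>h x\<bar> powr p) \<partial>M"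
  have fin: "?I \<noteq> \<infinity>" using assms(3) by (auto simp: Lp_norm_def)
  then have "ennreal (enn2real ?I powr (1 / p)) < ennreal s" using assms(3) by (simp add: Lp_norm_def)
  then have "enn2real ?I powr (1 / p) \<le> s" using assms(2) by (simp add: ennreal_less_iff)
  then have "(enn2real ?I powr (1 / p)) powr p \<le> s powr p" using assms(1) by (intro powr_mono2) auto
  then have "enn2real ?I \<le> s powr p" using assms(1) by (simp add: powr_powr)
  then have "ennreal (enn2real ?I) \<le> ennreal (s powr p)" by (rule ennreal_leI)
  moreover have "ennreal (enn2real ?I) = ?I" using fin by (intro ennreal_enn2real) (simp add: top.not_eq_extremum)
  ultimately show ?thesis by (simp only:)
qed

lemma Lp_norm_eq:
  assumes "Lp_norm p M h < \<infinity>"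
  shows "powint p M h < \<infinity>"
    "Lp_norm p M h = ennreal (enn2real (powint p M h) powr (1 / p))"
  using assms by (auto simp: Lp_norm_def Let_def top.not_eq_extremum split: if_splits)

lemma Lp_norm_2_square:
  assumes "Lp_norm 2 M h < \<infinity>"
  shows "(Lp_norm 2 M h)\<^sup>2 = (\<integral>\<^sup>+x. ennreal ((h x)\<^sup>2) \<partial>M)"
proof -
  let ?I = "\<integral>\<^sup>+x. ennreal (\<bar>h x\<bar> powr 2) \<partial>M"
  have sq: "\<bar>h x\<bar> powr 2 = (h x)\<^sup>2" for x by simp
  have fin: "?I < \<infinity>" by (rule Lp_norm_eq(1)[OF assms])
  have "(Lp_norm 2 M h)\<^sup>2 = ennreal ((enn2real ?I powr (1 / 2))\<^sup>2)"
    using Lp_norm_eq(2)[OF assms] by (simp add: ennreal_power)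
  also have "(enn2real ?I powr (1 / 2))\<^sup>2 = enn2real ?I"
    by (simp add: powr_half_sqrt)
  also have "ennreal (enn2real ?I) = ?I" using fin by simp
  finally show ?thesis by (simp only: sq)
qed

lemma closed_subspace_L2_sum:
  assumes W: "closed_subspace_L2 W" and S: "finite S" "\<And>i. i \<in> S \<Longrightarrow> f i \<in> W"
  shows "(\<lambda>x. \<Sum>i\<in>S. c i * f i x) \<in> W"
  using S
proof (induction S rule: finite_induct)
  case empty
  then show ?case using W by (simp add: closed_subspace_L2_def)
next
  case (insert i S)
  have "(\<lambda>x. c i * f i x) \<in> W" using W insert by (simp add: closed_subspace_L2_def)
  moreover have "(\<lambda>x. \<Sum>i\<in>S. c i * f i x) \<in> W" using insert by auto
  ultimately have "(\<lambda>x. c i * f i x + (\<Sum>i\<in>S. c i * f i x)) \<in> W" using W by (simp add: closed_subspace_L2_def)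
  then show ?case using insert by simp
qed

lemma nn_integral_lborel_translate:
  fixes h :: "real ^ 'n \<Rightarrow> ennreal"
  assumes "h \<in> borel_measurable borel"
  shows "(\<integral>\<^sup>+x. h (x - a) \<partial>lborel) = (\<integral>\<^sup>+x. h x \<partial>lborel)"
proof -
  have "(\<integral>\<^sup>+x. h x \<partial>lborel) = (\<integral>\<^sup>+x. h x \<partial>distr lborel borel ((+) (- a)))"
    by (simp add: lborel_distr_plus)
  also have "... = (\<integral>\<^sup>+x. h (- a + x) \<partial>lborel)"
    using assms by (intro nn_integral_distr) auto
  finally show ?thesis by simp
qed

lemma countable_separated:
  fixes U :: "(real ^ 'n) set"
  assumes r: "0 < r" and sep: "\<And>u v. u \<in> U \<Longrightarrow> v \<in> U \<Longrightarrow> u \<noteq> v \<Longrightarrow> r \<le> infnorm (u - v)"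
  shows "finite {u \<in> U. infnorm u \<le> b}" "countable U"
proof -
  show fin: "finite {u \<in> U. infnorm u \<le> b}" for b
  proof -
    have "finite {u \<in> U. infnorm u \<le> \<bar>b\<bar>}"
    proof (rule card_separated_cube[OF r, THEN conjunct1])
      fix u i assume "u \<in> {u \<in> U. infnorm u \<le> \<bar>b\<bar>}"
      then have "\<bar>u $ i\<bar> \<le> \<bar>b\<bar>" by (auto simp: infnorm_le_iff_cart)
      then show "(\<chi> i. - \<bar>b\<bar>) $ i \<le> u $ i \<and> u $ i \<le> (\<chi> i. - \<bar>b\<bar>) $ i + 2 * \<bar>b\<bar>"
        by (simp add: abs_le_iff)
    qed (use sep in auto)
    then show ?thesis by (rule rev_finite_subset) (auto intro: order_trans[OF _ abs_ge_self])
  qed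
  have "U = (\<Union>m. {u \<in> U. infnorm u \<le> real m})" using real_arch_simple by auto
  moreover have "countable (\<Union>m. {u \<in> U. infnorm u \<le> real m})"
    by (rule countable_UN) (auto intro: countable_finite fin)
  ultimately show "countable U" by simp
qed

text \<open>A ball of radius \<open>L\<close> for the weight lies in a cube of side 2 L^2, and L >=
  1 absorbs the additive 2 of the count.\<close>

lemma count_separated_ball:
  fixes U :: "(real ^ 'n) set"
  assumes r: "0 < r" and sep: "\<And>u v. u \<in> U \<Longrightarrow> v \<in> U \<Longrightarrow> u \<noteq> v \<Longrightarrow> r \<le> infnorm (u - v)" and L: "1 \<le> L"
  shows "finite {u \<in> U. wgt (a - u) \<le> L} \<and> real (card {u \<in> U. wgt (a - u) \<le> L}) \<le> (4 / r + 2) ^ CARD('n) * L ^ (2 * CARD('n))"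
proof -
  have *: "finite {u \<in> U. wgt (a - u) \<le> L} \<and> real (card {u \<in> U. wgt (a - u) \<le> L}) \<le> (2 * (2 * L\<^sup>2) / r + 2) ^ CARD('n)"
  proof (rule card_separated_cube[OF r])
    fix u i assume "u \<in> {u \<in> U. wgt (a - u) \<le> L}"
    then have "infnorm (a - u) \<le> L\<^sup>2" using L by (simp add: wgt_def sqrt_le_D)
    then have "\<bar>(a - u) $ i\<bar> \<le> L\<^sup>2" by (simp add: infnorm_le_iff_cart)
    then show "(a - (\<chi> i. L\<^sup>2)) $ i \<le> u $ i \<and> u $ i \<le> (a - (\<chi> i. L\<^sup>2)) $ i + 2 * L\<^sup>2"
      by (simp add: abs_le_iff)
  qed (use sep in auto)
  have "2 * (2 * L\<^sup>2) / r + 2 \<le> (4 / r + 2) * L\<^sup>2"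
    using L r one_le_power[OF L, of 2] by (simp add: distrib_right)
  then have "(2 * (2 * L\<^sup>2) / r + 2) ^ CARD('n) \<le> ((4 / r + 2) * L\<^sup>2) ^ CARD('n)"
    using r by (intro power_mono) auto
  then show ?thesis using * by (simp add: power_mult_distrib power_mult)
qed

text \<open>The upper inequality makes the sum finite, so passing from \<open>ennreal\<close> to
  real numbers is faithful; a divergent sum would become 0. Borel measurability allows
  \<open>lborel\<close> in place of \<open>lebesgue\<close>.\<close>

lemma frame_inequality_real:
  fixes F :: "'g \<Rightarrow> 'a::euclidean_space \<Rightarrow> real"
  assumes f: "f \<in> borel_measurable borel" "Lp_norm 2 lebesgue f < \<infinity>" and c: "countable \<Gamma>"
    and F: "\<And>\<gamma>. \<gamma> \<in> \<Gamma> \<Longrightarrow> F \<gamma> \<in> borel_measurable borel"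
    and lo: "ennreal A * (Lp_norm 2 lebesgue f)\<^sup>2 \<le> (\<Sum>\<^sub>\<infinity>\<gamma>\<in>\<Gamma>. ennreal ((LINT x|lebesgue. f x * F \<gamma> x)\<^sup>2))"
    and hi: "(\<Sum>\<^sub>\<infinity>\<gamma>\<in>\<Gamma>. ennreal ((LINT x|lebesgue. f x * F \<gamma> x)\<^sup>2)) \<le> ennreal B * (Lp_norm 2 lebesgue f)\<^sup>2"
    and AB: "0 \<le> A" "0 \<le> B"
  shows "A * (LINT x|lborel. (f x)\<^sup>2) \<le> (LINT \<gamma>|count_space \<Gamma>. (LINT x|lborel. f x * F \<gamma> x)\<^sup>2)"
    "(LINT \<gamma>|count_space \<Gamma>. (LINT x|lborel. f x * F \<gamma> x)\<^sup>2) \<le> B * (LINT x|lborel. (f x)\<^sup>2)"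
proof -
  define P where "P = (LINT x|lborel. (f x)\<^sup>2)"
  have nnP: "(Lp_norm 2 lebesgue f)\<^sup>2 = (\<integral>\<^sup>+x. ennreal ((f x)\<^sup>2) \<partial>lborel)"
    using Lp_norm_2_square[OF f(2)] by (simp add: nn_integral_completion)
  have fin: "(Lp_norm 2 lebesgue f)\<^sup>2 < \<infinity>" using f(2) by (simp add: power_less_top_ennreal)
  have "integrable lborel (\<lambda>x. (f x)\<^sup>2)"
    using fin f(1) unfolding nnP by (intro integrableI_bounded) auto
  then have P: "(Lp_norm 2 lebesgue f)\<^sup>2 = ennreal P"
    unfolding nnP P_def by (intro nn_integral_eq_integral) auto
  have P0: "0 \<le> P" by (simp add: P_def)
  have inner: "(LINT x|lebesgue. f x * F \<gamma> x) = (LINT x|lborel. f x * F \<gamma> x)" if "\<gamma> \<in> \<Gamma>" for \<gamma>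
    using f(1) F[OF that] by (intro integral_completion) simp
  define S where "S = (LINT \<gamma>|count_space \<Gamma>. (LINT x|lborel. f x * F \<gamma> x)\<^sup>2)"
  have sum: "(\<Sum>\<^sub>\<infinity>\<gamma>\<in>\<Gamma>. ennreal ((LINT x|lebesgue. f x * F \<gamma> x)\<^sup>2)) = (\<integral>\<^sup>+\<gamma>. ennreal ((LINT x|lborel. f x * F \<gamma> x)\<^sup>2) \<partial>count_space \<Gamma>)"
    unfolding infsum_ennreal_eq_nn_integral[OF c] by (intro nn_integral_cong) (simp add: inner)
  have "(\<integral>\<^sup>+\<gamma>. ennreal ((LINT x|lborel. f x * F \<gamma> x)\<^sup>2) \<partial>count_space \<Gamma>) < \<infinity>"
    using le_less_trans[OF hi[unfolded sum P]] by (simp add: ennreal_mult_less_top)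
  then have "integrable (count_space \<Gamma>) (\<lambda>\<gamma>. (LINT x|lborel. f x * F \<gamma> x)\<^sup>2)"
    by (intro integrableI_bounded) auto
  then have S: "(\<Sum>\<^sub>\<infinity>\<gamma>\<in>\<Gamma>. ennreal ((LINT x|lebesgue. f x * F \<gamma> x)\<^sup>2)) = ennreal S"
    unfolding sum S_def by (intro nn_integral_eq_integral) auto
  have S0: "0 \<le> S" by (simp add: S_def)
  have "ennreal (A * P) \<le> ennreal S" using lo unfolding S P using AB P0 by (simp add: ennreal_mult)
  then show "A * (LINT x|lborel. (f x)\<^sup>2) \<le> (LINT \<gamma>|count_space \<Gamma>. (LINT x|lborel. f x * F \<gamma> x)\<^sup>2)"
    using S0 by (simp add: P_def[symmetric] S_def[symmetric])
  have "ennreal S \<le> ennreal (B * P)" using hi unfolding S P using AB P0 by (simp add: ennreal_mult)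
  then show "(LINT \<gamma>|count_space \<Gamma>. (LINT x|lborel. f x * F \<gamma> x)\<^sup>2) \<le> B * (LINT x|lborel. (f x)\<^sup>2)"
    using AB P0 by (simp add: P_def[symmetric] S_def[symmetric] ennreal_le_iff)
qed

text \<open>Both cases of the condition on \<alpha> imply \<alpha> >= 1, hence an exponent at least
  1 over a base at least 1.\<close>

lemma tail_dyadic:
  fixes p \<alpha> C T :: real and n :: nat
  assumes "1 \<le> p" "if p = 1 then 1 \<le> \<alpha> else p / (p - 1) \<le> \<alpha>" "0 < C" "1 \<le> n"
  shows "C / (2 ^ j) powr (real n * \<alpha>) \<le> C / 2 ^ j"
proof -
  have "1 \<le> \<alpha>"
  proof (cases "p = 1")
    case False
    then have "1 \<le> p / (p - 1)" using assms(1) by simp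
    then show ?thesis using assms(2) False by simp
  qed (use assms in simp)
  then have "1 * 1 \<le> real n * \<alpha>" using assms(4) by (intro mult_mono) auto
  then have "(2 ^ j) powr 1 \<le> (2 ^ j :: real) powr (real n * \<alpha>)" by (intro powr_mono) auto
  then show ?thesis using assms(3) by (intro divide_left_mono) auto
qed

text \<open>For \<open>f\<close> of norm 0 the right-hand side is 0 and no strict inequality can
  hold, hence the side condition on the norm. \<open>M\<close> can precede \<open>f\<close> because
  the radius in \<open>local_approximation\<close> is uniform in the coefficients.\<close>

theorem lemma2p4:
  fixes p \<alpha> C C\<^sub>\<Gamma> :: real
    and W :: "(real ^ 'n \<Rightarrow> real) set"
    and \<Gamma> \<Omega> :: "(real ^ 'n) set"
    and \<Theta> :: "real ^ 'n \<Rightarrow> real"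
    and F :: "real ^ 'n \<Rightarrow> real ^ 'n \<Rightarrow> real"
    and d :: nat
  assumes "1 \<le> p"
    and "localizable_by W \<Gamma> \<Theta> F"
    and "compact \<Omega>" and "1 \<le> measure lebesgue \<Omega>"
    and "d = card {m \<in> int_lattice. ((+) m ` unit_cube) \<inter> frontier \<Omega> \<noteq> {}}"
    and "0 < C\<^sub>\<Gamma>" and "real (card (\<Gamma> \<inter> \<Omega>)) \<le> C\<^sub>\<Gamma> * measure lebesgue \<Omega>"
    and "0 < C"
    and "if p = 1 then 1 \<le> \<alpha> else p / (p - 1) \<le> \<alpha>"
    and "\<And>N::real. 0 < N \<Longrightarrow>
           (\<Sum>\<^sub>\<infinity>k\<in>int_lattice - centered_cube N. SUP x\<in>unit_cube. ennreal \<bar>\<Theta> (x - k)\<bar>)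
             < ennreal (C / N powr (real CARD('n) * \<alpha>))"
  shows "\<forall>\<epsilon>>0. \<exists>M. compact M \<and>
           (\<forall>f\<in>V_space p \<Gamma> F. Lp_norm p lebesgue f \<noteq> 0 \<longrightarrow>
              (\<exists>g\<in>V_local \<Gamma> F M.
                 Lp_norm p (lebesgue_on \<Omega>) (\<lambda>x. f x - g x)
                   < ennreal \<epsilon> * Lp_norm p lebesgue f))"
proof (intro allI impI)
  fix \<epsilon> :: real assume \<epsilon>: "0 < \<epsilon>"
  note p = \<open>1 \<le> p\<close>
  have W: "closed_subspace_L2 W" and sepG: "relatively_separated \<Gamma>" and \<Theta>: "\<Theta> \<in> amalgam_space"
    and cont: "\<And>\<gamma>. \<gamma> \<in> \<Gamma> \<Longrightarrow> continuous_on UNIV (F \<gamma>)" and fr: "is_frame_for W \<Gamma> F"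
    and FT: "\<And>\<gamma> x. \<gamma> \<in> \<Gamma> \<Longrightarrow> \<bar>F \<gamma> x\<bar> \<le> \<Theta> (x - \<gamma>)"
    using assms(2) by (auto simp: localizable_by_def)
  obtain r where r: "0 < r" and sep: "\<And>u v. u \<in> \<Gamma> \<Longrightarrow> v \<in> \<Gamma> \<Longrightarrow> u \<noteq> v \<Longrightarrow> r \<le> infnorm (u - v)"
    using relatively_separatedD[OF sepG] by metis
  have cG: "countable \<Gamma>" by (rule countable_separated(2)[OF r sep])
  have "(\<integral>\<^sup>+k. (SUP x\<in>unit_cube. ennreal \<bar>\<Theta> (x + k)\<bar>) * ennreal (2 + wgt k) \<partial>count_space int_lattice) < \<infinity>"
  proof (rule weighted_lattice_sum_finite)
    show "amalgam_norm \<Theta> < \<infinity>" using \<Theta> by (simp add: amalgam_space_def)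
    show "0 \<le> C" using \<open>0 < C\<close> by simp
    fix j :: nat
    have "(\<Sum>\<^sub>\<infinity>k\<in>int_lattice - centered_cube (2 ^ j). SUP x\<in>unit_cube. ennreal \<bar>\<Theta> (x - k)\<bar>)
        < ennreal (C / (2 ^ j) powr (real CARD('n) * \<alpha>))" by (rule assms(10)) simp
    also have "... \<le> ennreal (C / 2 ^ j)"
      by (intro ennreal_leI tail_dyadic[OF assms(1,9,8)]) (simp add: Suc_le_eq)
    finally show "(\<Sum>\<^sub>\<infinity>k\<in>int_lattice - centered_cube (2 ^ j). SUP x\<in>unit_cube. ennreal \<bar>\<Theta> (x - k)\<bar>) \<le> ennreal (C / 2 ^ j)"
      by (rule less_imp_le)
  qed
  then obtain t :: "real ^ 'n \<Rightarrow> real" and T :: real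
    where t: "t \<in> borel_measurable borel" "\<And>x. 0 \<le> t x" "\<And>x. \<bar>\<Theta> x\<bar> \<le> t x" and T: "0 < T"
    and tcol: "(\<integral>\<^sup>+x. ennreal (t x * (1 + wgt x)) \<partial>lborel) \<le> ennreal T"
    and trow: "\<And>r X x. 0 < r \<Longrightarrow> finite X \<Longrightarrow> (\<And>u v. u \<in> X \<Longrightarrow> v \<in> X \<Longrightarrow> u \<noteq> v \<Longrightarrow> r \<le> infnorm (u - v)) \<Longrightarrow>
       (\<Sum>u\<in>X. t (x - u) * (1 + wgt (x - u))) \<le> (2 / r + 2) ^ CARD('n) * T"
    by (rule envelope_exists) blast
  \<comment> \<open>Numbering \<Gamma> gives one countable index type in all dimensions. When
    \<Gamma> is finite, \<open>I\<close> is a proper subset of the naturals and the remaining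
    indices get zero functions.\<close>
  define I where "I = to_nat_on \<Gamma> ` \<Gamma>"
  define pos where "pos = from_nat_into \<Gamma>"
  have pos: "pos (to_nat_on \<Gamma> \<gamma>) = \<gamma>" if "\<gamma> \<in> \<Gamma>" for \<gamma> unfolding pos_def using cG that by simp
  have pos_I: "pos i \<in> \<Gamma>" "to_nat_on \<Gamma> (pos i) = i" if "i \<in> I" for i using that pos by (auto simp: I_def)
  have inj_pos: "inj_on pos I" by (rule inj_on_inverseI[of _ "to_nat_on \<Gamma>"]) (rule pos_I(2))
  have bij_pos: "bij_betw pos I \<Gamma>"
    by (rule bij_betwI[of _ _ _ "to_nat_on \<Gamma>"]) (use pos_I pos in \<open>auto simp: I_def\<close>)
  have injG: "inj_on (to_nat_on \<Gamma>) \<Gamma>" by (rule inj_on_to_nat_on[OF cG])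
  define \<Phi> where "\<Phi> = (\<lambda>i x. if i \<in> I then F (pos i) x else 0)"
  define e where "e = (\<lambda>i x. if i \<in> I then t (x - pos i) else 0)"
  define \<omega> where "\<omega> = (\<lambda>i j. wgt (pos i - pos j))"
  \<comment> \<open>The sum of the row constant and the column constant, so that it dominates
    both.\<close>
  define \<kappa> where "\<kappa> = ((2 / r + 2) ^ CARD('n) + 1) * T"
  have \<kappa>: "0 < \<kappa>" "T \<le> \<kappa>" "(2 / r + 2) ^ CARD('n) * T \<le> \<kappa>"
    using T r by (auto simp: \<kappa>_def distrib_right add_pos_pos)
  obtain A B where AB: "0 < A" "A \<le> B"
    and frame_lo: "\<And>f. f \<in> W \<Longrightarrow> ennreal A * (Lp_norm 2 lebesgue f)\<^sup>2 \<le> (\<Sum>\<^sub>\<infinity>\<gamma>\<in>\<Gamma>. ennreal ((LINT x|lebesgue. f x * F \<gamma> x)\<^sup>2))"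
    and frame_hi: "\<And>f. f \<in> W \<Longrightarrow> (\<Sum>\<^sub>\<infinity>\<gamma>\<in>\<Gamma>. ennreal ((LINT x|lebesgue. f x * F \<gamma> x)\<^sup>2)) \<le> ennreal B * (Lp_norm 2 lebesgue f)\<^sup>2"
    using fr unfolding is_frame_for_def by blast
  have FW: "F \<gamma> \<in> W" if "\<gamma> \<in> \<Gamma>" for \<gamma> using fr that by (simp add: is_frame_for_def)
  have Fm: "F \<gamma> \<in> borel_measurable borel" if "\<gamma> \<in> \<Gamma>" for \<gamma>
    by (rule borel_measurable_continuous_onI[OF cont[OF that]])
  have sum_\<Phi>: "(LINT i|cs. c i * \<Phi> i x) = (\<Sum>\<gamma>\<in>X. c (to_nat_on \<Gamma> \<gamma>) * F \<gamma> x)"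
    if X: "finite X" "X \<subseteq> \<Gamma>" "\<And>i. i \<in> I \<Longrightarrow> c i \<noteq> 0 \<Longrightarrow> pos i \<in> X" for c X x
  proof -
    have "(LINT i|cs. c i * \<Phi> i x) = (\<Sum>i\<in>to_nat_on \<Gamma> ` X. c i * \<Phi> i x)"
    proof (rule lint_finite)
      fix i assume i: "i \<notin> to_nat_on \<Gamma> ` X"
      show "c i * \<Phi> i x = 0"
      proof (rule ccontr)
        assume "c i * \<Phi> i x \<noteq> 0"
        then have "i \<in> I" "c i \<noteq> 0" by (auto simp: \<Phi>_def split: if_splits)
        then have "to_nat_on \<Gamma> (pos i) \<in> to_nat_on \<Gamma> ` X" using X(3) by blast
        then show False using i pos_I(2)[OF \<open>i \<in> I\<close>] by simp
      qed
    qed (use X in simp)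
    also have "... = (\<Sum>\<gamma>\<in>X. c (to_nat_on \<Gamma> \<gamma>) * \<Phi> (to_nat_on \<Gamma> \<gamma>) x)"
      by (rule sum.reindex_cong[OF inj_on_subset[OF injG X(2)] refl refl])
    also have "... = (\<Sum>\<gamma>\<in>X. c (to_nat_on \<Gamma> \<gamma>) * F \<gamma> x)"
    proof (rule sum.cong)
      fix \<gamma> assume "\<gamma> \<in> X"
      then have "\<gamma> \<in> \<Gamma>" using X(2) by blast
      then have "to_nat_on \<Gamma> \<gamma> \<in> I" by (simp add: I_def)
      then show "c (to_nat_on \<Gamma> \<gamma>) * \<Phi> (to_nat_on \<Gamma> \<gamma>) x = c (to_nat_on \<Gamma> \<gamma>) * F \<gamma> x"
        using pos[OF \<open>\<gamma> \<in> \<Gamma>\<close>] by (simp add: \<Phi>_def)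
    qed simp
    finally show ?thesis .
  qed
  have "localized_frame \<omega> I ((4 / r + 2) ^ CARD('n)) CARD('n) \<Phi> pos e \<kappa> A B"
  proof unfold_locales
    fix i j k :: nat and L :: real and x :: "real ^ 'n"
    show "0 \<le> \<omega> i j" by (simp add: \<omega>_def wgt_nonneg)
    show "\<omega> i i = 0" by (simp add: \<omega>_def wgt_zero)
    show "\<omega> i k \<le> \<omega> i j + \<omega> j k" using wgt_triangle[of "pos i - pos j" "pos j - pos k"] by (simp add: \<omega>_def)
    show "finite {j \<in> I. \<omega> i j \<le> L}" "real (card {j \<in> I. \<omega> i j \<le> L}) \<le> (4 / r + 2) ^ CARD('n) * L ^ (2 * CARD('n))"
      if L: "1 \<le> L"
    proof -
      let ?S = "{j \<in> I. \<omega> i j \<le> L}" and ?B = "{u \<in> \<Gamma>. wgt (pos i - u) \<le> L}"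
      have B: "finite ?B" "real (card ?B) \<le> (4 / r + 2) ^ CARD('n) * L ^ (2 * CARD('n))"
        using count_separated_ball[OF r sep L, where a = "pos i"] by auto
      have sub: "pos ` ?S \<subseteq> ?B" using pos_I by (auto simp: \<omega>_def)
      have inj: "inj_on pos ?S" using inj_pos by (rule inj_on_subset) auto
      show "finite ?S" using finite_imageD[OF finite_subset[OF sub B(1)] inj] .
      have "card ?S \<le> card ?B" by (rule card_inj_on_le[OF inj sub B(1)])
      then show "real (card ?S) \<le> (4 / r + 2) ^ CARD('n) * L ^ (2 * CARD('n))" using B(2) by linarith
    qed
    show "\<omega> i j = wgt (pos i - pos j)" by (simp add: \<omega>_def)
    show "\<Phi> i \<in> borel_measurable borel" using Fm pos_I by (cases "i \<in> I") (auto simp: \<Phi>_def)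
    have tm: "(\<lambda>x. t (x - pos i)) \<in> borel_measurable borel" by (rule measurable_compose[OF _ t(1)]) simp
    show "e i \<in> borel_measurable borel" using tm by (cases "i \<in> I") (auto simp: e_def)
    show "\<bar>\<Phi> i x\<bar> \<le> e i x"
    proof (cases "i \<in> I")
      case True
      have "\<bar>F (pos i) x\<bar> \<le> \<Theta> (x - pos i)" by (rule FT[OF pos_I(1)[OF True]])
      also have "... \<le> t (x - pos i)" using t(3)[of "x - pos i"] by linarith
      finally show ?thesis using True by (simp add: \<Phi>_def e_def)
    qed (simp add: \<Phi>_def e_def)
    show "\<Phi> i x = 0" if "i \<notin> I" using that by (simp add: \<Phi>_def)
    show "(\<integral>\<^sup>+i. ennreal (e i x * (1 + wgt (x - pos i))) \<partial>cs) \<le> ennreal \<kappa>"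
    proof -
      have "(\<Sum>\<^sub>\<infinity>i\<in>UNIV. ennreal (e i x * (1 + wgt (x - pos i)))) \<le> ennreal \<kappa>"
      \<comment> \<open>An unordered sum is the supremum of its finite partial sums, and the row
        estimate \<open>trow\<close> speaks about finite separated sets.\<close>
      proof (subst nonneg_infsum_complete, simp, rule SUP_least)
        fix X :: "nat set" assume "X \<in> {X. finite X \<and> X \<subseteq> UNIV}"
        then have X: "finite X" by simp
        have e0: "0 \<le> e i x * (1 + wgt (x - pos i))" for i
          using t(2) wgt_nonneg by (auto simp: e_def intro!: mult_nonneg_nonneg add_nonneg_nonneg)
        have "(\<Sum>i\<in>X. e i x * (1 + wgt (x - pos i))) = (\<Sum>i\<in>X \<inter> I. t (x - pos i) * (1 + wgt (x - pos i)))"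
          using X by (intro sum.mono_neutral_cong_right) (auto simp: e_def)
        also have "... = (\<Sum>u\<in>pos ` (X \<inter> I). t (x - u) * (1 + wgt (x - u)))"
          by (rule sum.reindex_cong[symmetric, OF inj_on_subset[OF inj_pos] refl refl]) auto
        also have "... \<le> (2 / r + 2) ^ CARD('n) * T"
          by (rule trow[OF r]) (use X pos_I sep in auto)
        also note \<kappa>(3)
        finally have "(\<Sum>i\<in>X. e i x * (1 + wgt (x - pos i))) \<le> \<kappa>" .
        then show "(\<Sum>i\<in>X. ennreal (e i x * (1 + wgt (x - pos i)))) \<le> ennreal \<kappa>"
          using e0 by (simp add: sum_ennreal ennreal_leI)
      qed
      then show ?thesis by (subst (asm) infsum_ennreal_eq_nn_integral) auto
    qed
    show "(\<integral>\<^sup>+x. ennreal (e i x * (1 + wgt (x - pos i))) \<partial>lborel) \<le> ennreal \<kappa>"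
    proof -
      have "(\<integral>\<^sup>+x. ennreal (e i x * (1 + wgt (x - pos i))) \<partial>lborel) \<le> (\<integral>\<^sup>+x. ennreal (t (x - pos i) * (1 + wgt (x - pos i))) \<partial>lborel)"
        using t(2) wgt_nonneg by (intro nn_integral_mono ennreal_leI) (auto simp: e_def intro!: mult_nonneg_nonneg add_nonneg_nonneg)
      also have "... = (\<integral>\<^sup>+x. ennreal (t x * (1 + wgt x)) \<partial>lborel)"
      proof (rule nn_integral_lborel_translate)
        note t(1)[measurable] wgt_measurable[measurable]
        show "(\<lambda>x. ennreal (t x * (1 + wgt x))) \<in> borel_measurable borel" by measurable
      qed
      also note tcol
      also have "ennreal T \<le> ennreal \<kappa>" using \<kappa> by (intro ennreal_leI)
      finally show ?thesis .
    qed
    show "0 < \<kappa>" "0 < A" "A \<le> B" by (rule \<kappa> AB)+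
  next
    fix c :: "nat \<Rightarrow> real" assume fin: "finite {i. c i \<noteq> 0}"
    define X where "X = pos ` ({i. c i \<noteq> 0} \<inter> I)"
    have X: "finite X" "X \<subseteq> \<Gamma>" using fin pos_I by (auto simp: X_def)
    define f where "f = (\<lambda>x. \<Sum>\<gamma>\<in>X. c (to_nat_on \<Gamma> \<gamma>) * F \<gamma> x)"
    have Df: "(LINT i|cs. c i * \<Phi> i x) = f x" for x
      unfolding f_def by (rule sum_\<Phi>[OF X]) (auto simp: X_def)
    have fW: "f \<in> W" unfolding f_def using X FW by (intro closed_subspace_L2_sum[OF W]) auto
    have fm: "f \<in> borel_measurable borel" unfolding f_def using X Fm by (intro borel_measurable_sum borel_measurable_times) auto
    have fL: "Lp_norm 2 lebesgue f < \<infinity>" using fW W by (auto simp: closed_subspace_L2_def Lp_space_def)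
    have sumI: "(LINT i|cs. (LINT x|lborel. f x * \<Phi> i x)\<^sup>2) = (LINT \<gamma>|count_space \<Gamma>. (LINT x|lborel. f x * F \<gamma> x)\<^sup>2)"
    proof -
      have "(LINT i|cs. (LINT x|lborel. f x * \<Phi> i x)\<^sup>2) = (LINT i|cs. indicator I i *\<^sub>R (LINT x|lborel. f x * F (pos i) x)\<^sup>2)"
      proof (rule Bochner_Integration.integral_cong)
        show "(LINT x|lborel. f x * \<Phi> i x)\<^sup>2 = indicator I i *\<^sub>R (LINT x|lborel. f x * F (pos i) x)\<^sup>2" for i
          by (cases "i \<in> I") (auto simp: \<Phi>_def)
      qed simp
      also have "... = (LINT i|count_space I. (LINT x|lborel. f x * F (pos i) x)\<^sup>2)"
        using integral_restrict_space[of I cs "\<lambda>i. (LINT x|lborel. f x * F (pos i) x)\<^sup>2"] by (simp add: restrict_count_space)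
      also have "... = (LINT \<gamma>|count_space \<Gamma>. (LINT x|lborel. f x * F \<gamma> x)\<^sup>2)"
        by (rule integral_bij_count_space[OF bij_pos])
      finally show ?thesis .
    qed
    have B0: "0 \<le> A" "0 \<le> B" using AB by auto
    show "A * (LINT x|lborel. (LINT i|cs. c i * \<Phi> i x)\<^sup>2)
          \<le> (LINT i|cs. (LINT x|lborel. (LINT j|cs. c j * \<Phi> j x) * \<Phi> i x)\<^sup>2) \<and>
        (LINT i|cs. (LINT x|lborel. (LINT j|cs. c j * \<Phi> j x) * \<Phi> i x)\<^sup>2)
          \<le> B * (LINT x|lborel. (LINT i|cs. c i * \<Phi> i x)\<^sup>2)"
      unfolding Df sumI
      using frame_inequality_real[OF fm fL cG Fm frame_lo[OF fW] frame_hi[OF fW] B0] by simp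
  qed
  then interpret LF: localized_frame \<omega> I "(4 / r + 2) ^ CARD('n)" "CARD('n)" \<Phi> pos e \<kappa> A B .
  obtain \<rho> where \<rho>: "\<And>x. x \<in> \<Omega> \<Longrightarrow> infnorm x \<le> \<rho>"
    using compact_imp_bounded[OF assms(3)] unfolding bounded_iff by (meson infnorm_le_norm order_trans)
  have \<Omega>: "\<Omega> \<in> sets borel" using assms(3) by (simp add: borel_compact)
  \<comment> \<open>Taking \<epsilon> / 2 leaves room for the strict inequality. \<open>c3\<close>
    is paid twice, once for splitting f - g and once for bounding the partial sum \<open>h\<close>
    by \<open>f\<close>; \<eta> and \<epsilon>' are chosen so that each error is at most E / 2, and
    \<eta> <= 1 gives the factor 2 in the bound for \<open>h\<close>.\<close>
  define E where "E = (\<epsilon> / 2) powr p"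
  have E: "0 < E" using \<epsilon> by (simp add: E_def)
  define c3 where "c3 = (2::real) powr p"
  have c3: "0 < c3" by (simp add: c3_def)
  define \<eta> where "\<eta> = min 1 (E / (2 * c3))"
  have \<eta>: "0 < \<eta>" "\<eta> \<le> 1" "c3 * \<eta> \<le> E / 2" using E c3 by (auto simp: \<eta>_def min_def field_simps)
  define \<epsilon>' where "\<epsilon>' = E / (4 * c3 * c3)"
  have \<epsilon>': "0 < \<epsilon>'" "c3 * (\<epsilon>' * (c3 * 2)) = E / 2" using E c3 by (auto simp: \<epsilon>'_def)
  obtain R where R: "\<And>c. l1 c \<Longrightarrow> \<exists>w. powint p (restrict_space lborel \<Omega>) (\<lambda>x. LF.D c x - LF.D (\<lambda>i. if infnorm (pos i) \<le> R then w i else 0) x)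
     \<le> ennreal \<epsilon>' * powint p lborel (LF.D c)"
    using LF.local_approximation[OF p \<Omega> \<rho> \<epsilon>'(1)] by blast
  define M where "M = (cbox (\<chi> i. - R) (\<chi> i. R) :: (real ^ 'n) set)"
  have M: "x \<in> M \<longleftrightarrow> infnorm x \<le> R" for x
    by (auto simp: M_def mem_box_cart infnorm_le_iff_cart abs_le_iff minus_le_iff)
  show "\<exists>M. compact M \<and> (\<forall>f\<in>V_space p \<Gamma> F. Lp_norm p lebesgue f \<noteq> 0 \<longrightarrow>
              (\<exists>g\<in>V_local \<Gamma> F M. Lp_norm p (lebesgue_on \<Omega>) (\<lambda>x. f x - g x) < ennreal \<epsilon> * Lp_norm p lebesgue f))"
  proof (intro exI[of _ M] conjI ballI impI)
    show "compact M" by (simp add: M_def)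
    fix f assume f: "f \<in> V_space p \<Gamma> F" and f0: "Lp_norm p lebesgue f \<noteq> 0"
    define P where "P = enn2real (powint p lebesgue f)"
    have fm: "f \<in> borel_measurable lebesgue" and fL: "Lp_norm p lebesgue f < \<infinity>"
      using f by (auto simp: V_space_def Lp_space_def)
    have IP: "powint p lebesgue f = ennreal P"
      using Lp_norm_eq(1)[OF fL] by (simp add: P_def)
    have LP: "Lp_norm p lebesgue f = ennreal (P powr (1 / p))" using Lp_norm_eq(2)[OF fL] by (simp add: P_def)
    have P: "0 < P"
    proof -
      have "P \<noteq> 0" using f0 LP by (auto)
      moreover have "0 \<le> P" by (simp add: P_def)
      ultimately show ?thesis by simp
    qed
    obtain c where lim: "((\<lambda>X. Lp_norm p lebesgue (\<lambda>x. f x - (\<Sum>\<gamma>\<in>X. c \<gamma> * F \<gamma> x))) \<longlongrightarrow> 0) (finite_subsets_at_top \<Gamma>)"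
      using f by (auto simp: V_space_def)
    \<comment> \<open>The partial sum may depend on \<open>f\<close>, so its accuracy can be taken
      relative to the norm of \<open>f\<close>, which is positive.\<close>
    define s where "s = (\<eta> * P) powr (1 / p)"
    have s: "0 < s" "s powr p = \<eta> * P" using \<eta> P p by (auto simp: s_def powr_powr)
    have "\<forall>\<^sub>F X in finite_subsets_at_top \<Gamma>. Lp_norm p lebesgue (\<lambda>x. f x - (\<Sum>\<gamma>\<in>X. c \<gamma> * F \<gamma> x)) < ennreal s"
      using order_tendstoD(2)[OF lim, of "ennreal s"] s by simp
    then obtain X where X: "finite X" "X \<subseteq> \<Gamma>" and Xl: "Lp_norm p lebesgue (\<lambda>x. f x - (\<Sum>\<gamma>\<in>X. c \<gamma> * F \<gamma> x)) < ennreal s"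
      unfolding eventually_finite_subsets_at_top by blast
    define h where "h = (\<lambda>x. \<Sum>\<gamma>\<in>X. c \<gamma> * F \<gamma> x)"
    have hm: "h \<in> borel_measurable borel" unfolding h_def using X Fm by (intro borel_measurable_sum borel_measurable_times) auto
    have hml: "h \<in> borel_measurable lebesgue" using measurable_completion[of h lborel borel] hm by simp
    have I1: "powint p lebesgue (\<lambda>x. f x - h x) \<le> ennreal (\<eta> * P)"
      using Lp_norm_lessD[OF _ _ Xl] p s by (simp add: h_def)
    have I2: "powint p lebesgue h \<le> ennreal (c3 * 2 * P)"
    proof -
      have "powint p lebesgue h = powint p lebesgue (\<lambda>x. f x + (h x - f x))" by simp
      also have "... \<le> ennreal c3 * (powint p lebesgue f + powint p lebesgue (\<lambda>x. h x - f x))"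
        unfolding c3_def using fm hml p by (intro powint_add_le borel_measurable_diff) auto
      also have "... = ennreal c3 * (ennreal P + powint p lebesgue (\<lambda>x. f x - h x))"
        by (simp add: IP abs_minus_commute)
      also have "... \<le> ennreal c3 * (ennreal P + ennreal (\<eta> * P))" by (intro mult_left_mono add_mono I1) auto
      also have "... = ennreal (c3 * (P + \<eta> * P))" using c3 P \<eta> by (simp add: ennreal_mult)
      also have "... \<le> ennreal (c3 * 2 * P)"
      proof (rule ennreal_leI)
        have "\<eta> * P \<le> 1 * P" using \<eta> P by (intro mult_right_mono) auto
        then have "c3 * (P + \<eta> * P) \<le> c3 * (2 * P)" using c3 by (intro mult_left_mono) auto
        then show "c3 * (P + \<eta> * P) \<le> c3 * 2 * P" by simp
      qed
      finally show ?thesis .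
    qed
    define c' where "c' = (\<lambda>i. if i \<in> to_nat_on \<Gamma> ` X then c (pos i) else 0)"
    have lc': "l1 c'"
    proof (rule l1_finite_support)
      show "finite {i. c' i \<noteq> 0}" by (rule finite_subset[of _ "to_nat_on \<Gamma> ` X"]) (use X in \<open>auto simp: c'_def\<close>)
    qed
    have Dh: "LF.D c' x = h x" for x
    proof -
      have "LF.D c' x = (\<Sum>\<gamma>\<in>X. c' (to_nat_on \<Gamma> \<gamma>) * F \<gamma> x)"
        unfolding LF.D_def
      proof (rule sum_\<Phi>[OF X])
        fix i assume "i \<in> I" "c' i \<noteq> 0"
        then show "pos i \<in> X" using pos X(2) by (auto simp: c'_def split: if_splits)
      qed
      also have "... = h x" unfolding h_def using X(2) by (intro sum.cong) (auto simp: c'_def pos)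
      finally show ?thesis .
    qed
    obtain w where w: "powint p (restrict_space lborel \<Omega>) (\<lambda>x. LF.D c' x - LF.D (\<lambda>i. if infnorm (pos i) \<le> R then w i else 0) x)
     \<le> ennreal \<epsilon>' * powint p lborel (LF.D c')" using R[OF lc'] by blast
    define g where "g = (\<lambda>x. \<Sum>\<gamma>\<in>\<Gamma> \<inter> M. w (to_nat_on \<Gamma> \<gamma>) * F \<gamma> x)"
    have finM: "finite (\<Gamma> \<inter> M)"
      using countable_separated(1)[OF r sep, where b = R] by (simp add: M Int_def)
    have Dg: "LF.D (\<lambda>i. if infnorm (pos i) \<le> R then w i else 0) x = g x" for x
    proof -
      have "LF.D (\<lambda>i. if infnorm (pos i) \<le> R then w i else 0) x
        = (\<Sum>\<gamma>\<in>\<Gamma> \<inter> M. (if infnorm (pos (to_nat_on \<Gamma> \<gamma>)) \<le> R then w (to_nat_on \<Gamma> \<gamma>) else 0) * F \<gamma> x)"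
        unfolding LF.D_def
        by (rule sum_\<Phi>[OF finM]) (use pos_I in \<open>auto simp: M split: if_splits\<close>)
      also have "... = g x" unfolding g_def by (intro sum.cong) (auto simp: pos M)
      finally show ?thesis .
    qed
    have gm: "g \<in> borel_measurable borel" unfolding g_def using Fm by (intro borel_measurable_sum borel_measurable_times) auto
    have gml: "g \<in> borel_measurable lebesgue" using measurable_completion[of g lborel borel] gm by simp
    have \<Omega>l: "\<Omega> \<in> sets lebesgue" using \<Omega> by simp
    have I3: "powint p (lebesgue_on \<Omega>) (\<lambda>x. h x - g x) \<le> ennreal (\<epsilon>' * (c3 * 2 * P))"
    proof -
      have "powint p (lebesgue_on \<Omega>) (\<lambda>x. h x - g x) \<le> ennreal \<epsilon>' * powint p lebesgue h"
        using w unfolding Dg Dh powint_lebesgue powint_lebesgue_on[OF \<Omega>] .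
      also have "... \<le> ennreal \<epsilon>' * ennreal (c3 * 2 * P)" by (intro mult_left_mono I2) auto
      finally show ?thesis using \<epsilon>'(1) c3 P by (simp add: ennreal_mult)
    qed
    have "powint p (lebesgue_on \<Omega>) (\<lambda>x. f x - g x) = powint p (lebesgue_on \<Omega>) (\<lambda>x. (f x - h x) + (h x - g x))"
      by simp
    also have "... \<le> ennreal c3 * (powint p (lebesgue_on \<Omega>) (\<lambda>x. f x - h x) + powint p (lebesgue_on \<Omega>) (\<lambda>x. h x - g x))"
      unfolding c3_def using fm hml gml p
      by (intro powint_add_le measurable_restrict_space1 borel_measurable_diff) auto
    also have "... \<le> ennreal c3 * (powint p lebesgue (\<lambda>x. f x - h x) + powint p (lebesgue_on \<Omega>) (\<lambda>x. h x - g x))"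
      by (intro mult_left_mono add_mono powint_restrict_le \<Omega>l) auto
    also have "... \<le> ennreal c3 * (ennreal (\<eta> * P) + ennreal (\<epsilon>' * (c3 * 2 * P)))"
      by (intro mult_left_mono add_mono I1 I3) auto
    also have "... = ennreal (c3 * (\<eta> * P + \<epsilon>' * (c3 * 2 * P)))"
      using c3 P \<eta> \<epsilon>' by (simp add: ennreal_mult)
    also have "... \<le> ennreal (E * P)"
    proof (rule ennreal_leI)
      have "c3 * (\<eta> * P + \<epsilon>' * (c3 * 2 * P)) = (c3 * \<eta> + c3 * (\<epsilon>' * (c3 * 2))) * P" by (simp add: algebra_simps)
      also have "... \<le> (E / 2 + E / 2) * P" using \<eta> \<epsilon>' P by (intro mult_right_mono add_mono) auto
      finally show "c3 * (\<eta> * P + \<epsilon>' * (c3 * 2 * P)) \<le> E * P" by simp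
    qed
    also have "E * P = (\<epsilon> / 2 * P powr (1 / p)) powr p"
    proof -
      have "(P powr (1 / p)) powr p = P" using P p by (simp add: powr_powr)
      then show ?thesis unfolding E_def using \<epsilon> by (subst powr_mult) auto
    qed
    finally have "Lp_norm p (lebesgue_on \<Omega>) (\<lambda>x. f x - g x) \<le> ennreal (\<epsilon> / 2 * P powr (1 / p))"
      using p \<epsilon> by (intro Lp_norm_leI) auto
    also have "... < ennreal (\<epsilon> * P powr (1 / p))"
      using \<epsilon> P by (intro ennreal_lessI) auto
    also have "... = ennreal \<epsilon> * Lp_norm p lebesgue f" using \<epsilon> by (simp add: LP ennreal_mult)
    finally have less: "Lp_norm p (lebesgue_on \<Omega>) (\<lambda>x. f x - g x) < ennreal \<epsilon> * Lp_norm p lebesgue f" .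
    have "g \<in> V_local \<Gamma> F M" unfolding V_local_def g_def
      by (rule CollectI) (rule exI[of _ "\<lambda>\<gamma>. w (to_nat_on \<Gamma> \<gamma>)"], simp)
    then show "\<exists>g\<in>V_local \<Gamma> F M. Lp_norm p (lebesgue_on \<Omega>) (\<lambda>x. f x - g x) < ennreal \<epsilon> * Lp_norm p lebesgue f"
      using less by blast
  qed
qed

end
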